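(* Consider the $2$-dimensional anti-pre-Lie Poisson algebras $A_{01},\dots,A_{05}$, $A_{06}^{\lambda}$, $A_{07}$, $A_{08}^{\lambda}$ ($\lambda\ne-1$), $A_{09}$, $A_{10}^{\alpha,\beta}$, $A_{11}^{\alpha,\beta}$, $A_{12}^{\alpha,\beta}$, $A_{13}^{\alpha}$, $A_{14}^{\alpha}$, $A_{15}^{\alpha}$ ($\alpha\neq\frac12$), $A_{16}^{\alpha}$, $A_{17}$, $A_{18}^{\alpha}$ (all parameters in $\mathbb C$) and the zero algebra $\mathbb C^8$ (both products zero), as defined in the context. Their orbits have the following dimensions: $4$ for $A_{01}$, $A_{05}$, $A_{10}^{\delta,\varepsilon}$, $A_{11}^{\delta,\varepsilon}$, $A_{13}^{\delta}$, $A_{15}^{\delta}$ ($\delta\neq\frac12$), $A_{17}$; $3$ for $A_{02}$, $A_{03}$, $A_{06}^{\beta}$ ($\beta\ne-1$), $A_{07}$, $A_{08}^{\beta}$ ($\beta\neq-1,-2$), $A_{09}$, $A_{12}^{\beta,\gamma}$, $A_{14}^{\beta}$, $A_{16}^{\beta}$; $2$ for $A_{04}$, $A_{06}^{-1}$, $A_{08}^{-2}$, $A_{18}^{\alpha}$; $0$ for $\mathbb C^8$. For two algebras $T,T'$ of this list one has $T\to T'$ if and only if $T\cong T'$ or $T'$ can be reached from $T$ by a chain of the following degenerations (valid for all parameter values subject to the indicated restrictions): $A_{01}\to A_{02}$; $A_{01}\to A_{03}$; $A_{05}\to A_{06}^{0}$; $A_{05}\to A_{08}^{0}$; $A_{10}^{\beta,\beta}\to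 A_{12}^{\beta,\beta}$; $A_{10}^{\delta,\varepsilon}\to A_{14}^{\delta}$ and $A_{10}^{\delta,\varepsilon}\to A_{14}^{\varepsilon}$; $A_{10}^{\delta,\varepsilon}\to A_{04}$ if $\delta\neq\varepsilon$; $A_{10}^{\delta,\varepsilon}\to A_{18}^{\alpha}$ for every $\alpha$ if $\delta\neq\varepsilon$; $A_{11}^{\delta,\varepsilon}\to A_{12}^{\delta,\varepsilon}$; $A_{11}^{\delta,\varepsilon}\to A_{04}$; $A_{11}^{\delta,\varepsilon}\to A_{18}^{\alpha}$ if $\alpha\ne2\varepsilon-\delta$; $A_{13}^{\delta}\to A_{14}^{\delta}$; $A_{13}^{\delta}\to A_{03}$; $A_{13}^{\delta}\to A_{18}^{\alpha}$ if $\alpha\neq\delta$; $A_{15}^{0}\to A_{06}^{-2}$; $A_{15}^{1}\to A_{02}$; $A_{15}^{\delta}\to A_{08}^{1/(\delta-1)}$ if $\delta\ne0,\frac12,1$; $A_{15}^{\delta}\to A_{18}^{\alpha}$ for every $\delta\neq\frac12$ and every $\alpha$; $A_{17}\to A_{08}^{0}$; $A_{17}\to A_{18}^{\alpha}$ for every $\alpha$; $A_{12}^{\beta,\gamma}\to A_{18}^{2\gamma-\beta}$; $A_{14}^{\beta}\to A_{18}^{\beta}$; $A_{16}^{\beta}\to A_{08}^{-2}$; $A_{16}^{\beta}\to A_{18}^{\beta}$; $A_{02}\to A_{04}$; $A_{03}\to A_{04}$; $A_{06}^{\beta}\to A_{04}$ if $\beta\neq-1$; $A_{08}^{\beta}\to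 A_{04}$ if $\beta\neq-1,-2$; $A_{07}\to A_{04}$; $A_{07}\to A_{06}^{-1}$; $A_{09}\to A_{04}$; $A_{09}\to A_{08}^{-2}$; $A_{04}\to\mathbb C^8$; $A_{06}^{-1}\to\mathbb C^8$; $A_{08}^{-2}\to\mathbb C^8$; $A_{18}^{\alpha}\to\mathbb C^8$.
   Context: An anti-pre-Lie algebra is a complex vector space with a bilinear product $\circ$ such that, writing $[x,y]=x\circ y-y\circ x$, one has $x\circ(y\circ z)-y\circ(x\circ z)=[y,x]\circ z$ and $[x,y]\circ z+[y,z]\circ x+[z,x]\circ y=0$. An anti-pre-Lie Poisson algebra is a complex vector space with a commutative associative product $\cdot$ and an anti-pre-Lie product $\circ$ such that $2(x\circ y)\cdot z-2(y\circ x)\cdot z=y\cdot(x\circ z)-x\cdot(y\circ z)$ and $2\,x\circ(y\cdot z)=(z\cdot x)\circ y+z\cdot(x\circ y)$. Fix a $2$-dimensional complex vector space $V$ with basis $e_1,e_2$. A $2$-dimensional such algebra is viewed as a pair $(\mu,\mu')\in \mathrm{Bil}(V\times V,V)^2\cong\mathbb C^{16}$ ($\mu$ is $\cdot$, $\mu'$ is $\circ$). $\mathrm{GL}(V)$ acts by $(g*(\mu,\mu'))(x,y)=(g\mu(g^{-1}x,g^{-1}y),\,g\mu'(g^{-1}x,g^{-1}y))$; $O(T)$ is the orbit of a structure representing $T$. We write $T\to T'$ ($T$ degenerates to $T'$) if a structure representing $T'$ lies in the Zariski closure $\overline{O(T)}$. The algebras are (unlisted products are zero, $\cdot$ is commutative;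 $A_{01}$--$A_{09}$ have $\cdot=0$): $A_{01}: e_1\circ e_1=e_1,\ e_2\circ e_2=e_2$; $A_{02}: e_1\circ e_1=e_1,\ e_1\circ e_2=e_2,\ e_2\circ e_1=e_2$; $A_{03}: e_1\circ e_1=e_1$; $A_{04}: e_1\circ e_1=e_2$; $A_{05}: e_1\circ e_1=-e_2,\ e_2\circ e_1=-e_1$; $A_{06}^{\lambda}: e_2\circ e_1=-e_1,\ e_2\circ e_2=\lambda e_2$; $A_{07}: e_2\circ e_1=-e_1,\ e_2\circ e_2=e_1-e_2$; $A_{08}^{\lambda}$: $e_1\circ e_2=(\lambda+1)e_1,\ e_2\circ e_1=\lambda e_1,\ e_2\circ e_2=(\lambda-1)e_2$; $A_{09}: e_1\circ e_2=-e_1,\ e_2\circ e_1=-2e_1,\ e_2\circ e_2=e_1-3e_2$; $A_{10}^{\alpha,\beta}: e_1\cdot e_1=e_1,\ e_2\cdot e_2=e_2,\ e_1\circ e_1=\alpha e_1,\ e_2\circ e_2=\beta e_2$; $A_{11}^{\alpha,\beta}: e_1\cdot e_1=e_1,\ e_1\cdot e_2=e_2,\ e_1\circ e_1=(2\alpha-\beta)e_1+e_2,\ e_1\circ e_2=\alpha e_2,\ e_2\circ e_1=\beta e_2$; $A_{12}^{\alpha,\beta}: e_1\cdot e_1=e_1,\ e_1\cdot e_2=e_2,\ e_1\circ e_1=(2\alpha-\beta)e_1,\ e_1\circ e_2=\alpha e_2,\ e_2\circ e_1=\beta e_2$; $A_{13}^{\alpha}: e_1\cdot e_1=e_1,\ e_1\circ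 e_1=\alpha e_1,\ e_2\circ e_2=e_2$; $A_{14}^{\alpha}: e_1\cdot e_1=e_1,\ e_1\circ e_1=\alpha e_1$; $A_{15}^{\alpha}$ ($\alpha\neq\frac12$): $e_1\cdot e_1=e_2,\ e_1\circ e_1=(2-\alpha)e_1,\ e_1\circ e_2=e_2,\ e_2\circ e_1=\alpha e_2$; $A_{16}^{\alpha}: e_1\cdot e_1=e_2,\ e_1\circ e_1=\frac32e_1+\alpha e_2,\ e_1\circ e_2=e_2,\ e_2\circ e_1=\frac12e_2$; $A_{17}: e_1\cdot e_1=e_2,\ e_1\circ e_1=-e_1,\ e_2\circ e_1=e_2$; $A_{18}^{\alpha}: e_1\cdot e_1=e_2,\ e_1\circ e_1=\alpha e_2$. *)

theory Defs
  imports "HOL-Analysis.Analysis" "HOL-Library.Extended_Nat"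
begin

type_synonym V = "complex ^ 2"
type_synonym strct = "(V \<Rightarrow> V \<Rightarrow> V) \<times> (V \<Rightarrow> V \<Rightarrow> V)"

abbreviation e1 :: V where "e1 \<equiv> axis 1 1"
abbreviation e2 :: V where "e2 \<equiv> axis 2 1"

text \<open>The constant \<^const>\<open>bilinear\<close> of the library means real-bilinear, hence the explicit
  complex scalar multiplication here.\<close>

definition cbilinear :: "(V \<Rightarrow> V \<Rightarrow> V) \<Rightarrow> bool" where
  "cbilinear m \<longleftrightarrow>
     (\<forall>x. Vector_Spaces.linear (*s) (*s) (\<lambda>y. m x y)) \<and>
     (\<forall>y. Vector_Spaces.linear (*s) (*s) (\<lambda>x. m x y))"

definition Bil2 :: "strct set" where
  "Bil2 = {(m, m'). cbilinear m \<and> cbilinear m'}"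

definition anti_pre_Lie :: "(V \<Rightarrow> V \<Rightarrow> V) \<Rightarrow> bool" where
  "anti_pre_Lie m \<longleftrightarrow> cbilinear m \<and>
     (\<forall>x y z. m x (m y z) - m y (m x z) = m (m y x - m x y) z) \<and>
     (\<forall>x y z. m (m x y - m y x) z + m (m y z - m z y) x + m (m z x - m x z) y = 0)"

definition anti_pre_Lie_Poisson :: "strct \<Rightarrow> bool" where
  "anti_pre_Lie_Poisson = (\<lambda>(d, c).
     cbilinear d \<and> (\<forall>x y. d x y = d y x) \<and> (\<forall>x y z. d (d x y) z = d x (d y z)) \<and>
     anti_pre_Lie c \<and>
     (\<forall>x y z. 2 *s d (c x y) z - 2 *s d (c y x) z = d y (c x z) - d x (c y z)) \<and>
     (\<forall>x y z. 2 *s c x (d y z) = c (d z x) y + d z (c x y)))"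

text \<open>Elements of GL(V) are given by their matrices with respect to \<open>e1, e2\<close>.\<close>

definition act :: "complex ^ 2 ^ 2 \<Rightarrow> strct \<Rightarrow> strct" where
  "act g s =
     ((\<lambda>x y. g *v fst s (matrix_inv g *v x) (matrix_inv g *v y)),
      (\<lambda>x y. g *v snd s (matrix_inv g *v x) (matrix_inv g *v y)))"

definition orbit :: "strct \<Rightarrow> strct set" where
  "orbit s = {act g s | g. invertible g}"

definition isomorphic :: "strct \<Rightarrow> strct \<Rightarrow> bool" where
  "isomorphic s t \<longleftrightarrow> (\<exists>g :: complex ^ 2 ^ 2. invertible g \<and>
     (\<forall>x y. g *v fst s x y = fst t (g *v x) (g *v y)) \<and>
     (\<forall>x y. g *v snd s x y = snd t (g *v x) (g *v y)))"

text \<open>Polynomials in the 16 structure constants.\<close>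

inductive_set poly_funs :: "(strct \<Rightarrow> complex) set" where
  const: "(\<lambda>_. a) \<in> poly_funs"
| coord_fst: "(\<lambda>s. fst s (axis i 1) (axis j 1) $ k) \<in> poly_funs"
| coord_snd: "(\<lambda>s. snd s (axis i 1) (axis j 1) $ k) \<in> poly_funs"
| add: "p \<in> poly_funs \<Longrightarrow> q \<in> poly_funs \<Longrightarrow> (\<lambda>s. p s + q s) \<in> poly_funs"
| mult: "p \<in> poly_funs \<Longrightarrow> q \<in> poly_funs \<Longrightarrow> (\<lambda>s. p s * q s) \<in> poly_funs"

definition zero_locus :: "(strct \<Rightarrow> complex) set \<Rightarrow> strct set" where
  "zero_locus F = {s \<in> Bil2. \<forall>p \<in> F. p s = 0}"

definition zariski :: "strct topology" where
  "zariski = topology (\<lambda>U. \<exists>F \<subseteq> poly_funs. U = Bil2 - zero_locus F)"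

lemma istopology_zariski:
  "istopology (\<lambda>U. \<exists>F \<subseteq> poly_funs. U = Bil2 - zero_locus F)"
  unfolding istopology_def
proof (intro conjI allI impI)
  fix S T
  assume "\<exists>F \<subseteq> poly_funs. S = Bil2 - zero_locus F"
    and "\<exists>F \<subseteq> poly_funs. T = Bil2 - zero_locus F"
  then obtain F G where F: "F \<subseteq> poly_funs" "S = Bil2 - zero_locus F"
    and G: "G \<subseteq> poly_funs" "T = Bil2 - zero_locus G" by blast
  let ?H = "\<Union>p \<in> F. \<Union>q \<in> G. {\<lambda>s. p s * q s}"
  have "?H \<subseteq> poly_funs" using F(1) G(1) by (auto intro!: poly_funs.mult)
  moreover have "zero_locus ?H = {s \<in> Bil2. \<forall>p \<in> F. \<forall>q \<in> G. p s = 0 \<or> q s = 0}"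
    by (auto simp: zero_locus_def)
  then have "S \<inter> T = Bil2 - zero_locus ?H"
    by (auto simp: F(2) G(2) zero_locus_def)
  ultimately show "\<exists>H \<subseteq> poly_funs. S \<inter> T = Bil2 - zero_locus H" by blast
next
  fix K
  assume "\<forall>U \<in> K. \<exists>F \<subseteq> poly_funs. U = Bil2 - zero_locus F"
  then obtain F where F: "\<And>U. U \<in> K \<Longrightarrow> F U \<subseteq> poly_funs \<and> U = Bil2 - zero_locus (F U)"
    by metis
  have "(\<Union>U \<in> K. U) = (\<Union>U \<in> K. Bil2 - zero_locus (F U))"
    by (rule SUP_cong) (use F in blast)+
  also have "\<dots> = Bil2 - zero_locus (\<Union>U \<in> K. F U)"
    unfolding zero_locus_def by blast
  finally have "\<Union>K = Bil2 - zero_locus (\<Union>U \<in> K. F U)" by simp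
  moreover have "(\<Union>U \<in> K. F U) \<subseteq> poly_funs" using F by blast
  ultimately show "\<exists>H \<subseteq> poly_funs. \<Union>K = Bil2 - zero_locus H" by blast
qed

lemma openin_zariski:
  "openin zariski U \<longleftrightarrow> (\<exists>F \<subseteq> poly_funs. U = Bil2 - zero_locus F)"
  by (simp add: zariski_def topology_inverse'[OF istopology_zariski])

lemma topspace_zariski: "topspace zariski = Bil2"
proof
  show "topspace zariski \<subseteq> Bil2"
    unfolding topspace_def by (auto simp: openin_zariski)
  have "{\<lambda>_. 1} \<subseteq> poly_funs" by (simp add: poly_funs.const)
  moreover have "Bil2 = Bil2 - zero_locus {\<lambda>_. 1}" by (simp add: zero_locus_def)
  ultimately have "openin zariski Bil2" unfolding openin_zariski by blast
  then show "Bil2 \<subseteq> topspace zariski" by (rule openin_subset)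
qed

lemma closedin_zariski:
  "closedin zariski C \<longleftrightarrow> (\<exists>F \<subseteq> poly_funs. C = zero_locus F)"
proof -
  have "C \<subseteq> Bil2 \<and> Bil2 - C = Bil2 - zero_locus F \<longleftrightarrow> C = zero_locus F" for F
    unfolding zero_locus_def by blast
  then show ?thesis
    unfolding closedin_def openin_zariski topspace_zariski by blast
qed

text \<open>By convention the empty space gets dimension 0 instead of \<open>-\<infinity>\<close>; orbits are nonempty.\<close>

definition irreducible_closedin :: "'a topology \<Rightarrow> 'a set \<Rightarrow> bool" where
  "irreducible_closedin X C \<longleftrightarrow> closedin X C \<and> C \<noteq> {} \<and>
     (\<forall>A B. closedin X A \<and> closedin X B \<and> C = A \<union> B \<longrightarrow> C = A \<or> C = B)"

definition krull_dim :: "'a topology \<Rightarrow> enat" where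
  "krull_dim X = Sup {enat n | n. \<exists>Z :: nat \<Rightarrow> 'a set.
     (\<forall>i \<le> n. irreducible_closedin X (Z i)) \<and> (\<forall>i < n. Z i \<subset> Z (Suc i))}"

definition orbit_dim :: "strct \<Rightarrow> enat" where
  "orbit_dim s = krull_dim (subtopology zariski (orbit s))"

definition degenerates :: "strct \<Rightarrow> strct \<Rightarrow> bool" where
  "degenerates s s' \<longleftrightarrow> (\<exists>t. isomorphic s' t \<and> t \<in> zariski closure_of orbit s)"

text \<open>The bilinear product with values \<open>a, b, c, d\<close> at
  \<open>(e1, e1), (e1, e2), (e2, e1), (e2, e2)\<close>.\<close>

definition table :: "V \<Rightarrow> V \<Rightarrow> V \<Rightarrow> V \<Rightarrow> V \<Rightarrow> V \<Rightarrow> V" where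
  "table a b c d x y =
     (x$1 * y$1) *s a + (x$1 * y$2) *s b + (x$2 * y$1) *s c + (x$2 * y$2) *s d"

datatype algebra =
    A01 | A02 | A03 | A04 | A05 | A06 complex | A07 | A08 complex | A09
  | A10 complex complex | A11 complex complex | A12 complex complex
  | A13 complex | A14 complex | A15 complex | A16 complex | A17 | A18 complex
  | C8

fun dot :: "algebra \<Rightarrow> V \<Rightarrow> V \<Rightarrow> V" where
  "dot (A10 \<alpha> \<beta>) = table e1 0 0 e2"
| "dot (A11 \<alpha> \<beta>) = table e1 e2 e2 0"
| "dot (A12 \<alpha> \<beta>) = table e1 e2 e2 0"
| "dot (A13 \<alpha>) = table e1 0 0 0"
| "dot (A14 \<alpha>) = table e1 0 0 0"
| "dot (A15 \<alpha>) = table e2 0 0 0"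
| "dot (A16 \<alpha>) = table e2 0 0 0"
| "dot A17 = table e2 0 0 0"
| "dot (A18 \<alpha>) = table e2 0 0 0"
| "dot _ = table 0 0 0 0"

fun circ :: "algebra \<Rightarrow> V \<Rightarrow> V \<Rightarrow> V" where
  "circ A01 = table e1 0 0 e2"
| "circ A02 = table e1 e2 e2 0"
| "circ A03 = table e1 0 0 0"
| "circ A04 = table e2 0 0 0"
| "circ A05 = table (- e2) 0 (- e1) 0"
| "circ (A06 l) = table 0 0 (- e1) (l *s e2)"
| "circ A07 = table 0 0 (- e1) (e1 - e2)"
| "circ (A08 l) = table 0 ((l + 1) *s e1) (l *s e1) ((l - 1) *s e2)"
| "circ A09 = table 0 (- e1) (- 2 *s e1) (e1 - 3 *s e2)"
| "circ (A10 \<alpha> \<beta>) = table (\<alpha> *s e1) 0 0 (\<beta> *s e2)"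
| "circ (A11 \<alpha> \<beta>) = table ((2 * \<alpha> - \<beta>) *s e1 + e2) (\<alpha> *s e2) (\<beta> *s e2) 0"
| "circ (A12 \<alpha> \<beta>) = table ((2 * \<alpha> - \<beta>) *s e1) (\<alpha> *s e2) (\<beta> *s e2) 0"
| "circ (A13 \<alpha>) = table (\<alpha> *s e1) 0 0 e2"
| "circ (A14 \<alpha>) = table (\<alpha> *s e1) 0 0 0"
| "circ (A15 \<alpha>) = table ((2 - \<alpha>) *s e1) e2 (\<alpha> *s e2) 0"
| "circ (A16 \<alpha>) = table ((3/2) *s e1 + \<alpha> *s e2) e2 ((1/2) *s e2) 0"
| "circ A17 = table (- e1) 0 e2 0"
| "circ (A18 \<alpha>) = table (\<alpha> *s e2) 0 0 0"
| "circ C8 = table 0 0 0 0"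

definition strct_of :: "algebra \<Rightarrow> strct" where
  "strct_of T = (dot T, circ T)"

definition listed :: "algebra set" where
  "listed = {T. (\<forall>l. T = A08 l \<longrightarrow> l \<noteq> -1) \<and> (\<forall>\<alpha>. T = A15 \<alpha> \<longrightarrow> \<alpha> \<noteq> 1/2)}"

lemma cbilinear_table: "cbilinear (table a b c d)"
  unfolding cbilinear_def Vector_Spaces.linear_iff table_def
  by (auto simp: vec_eq_iff algebra_simps intro!: vec.vector_space_axioms)

lemma anti_pre_Lie_Poisson_strct_of: "anti_pre_Lie_Poisson (strct_of T)"
proof -
  have comp: "table a b c d x y $ i =
      x$1 * y$1 * a$i + x$1 * y$2 * b$i + x$2 * y$1 * c$i + x$2 * y$2 * d$i" for a b c d x y i
    by (simp add: table_def)
  have e: "e1 $ 1 = 1" "e1 $ 2 = 0" "e2 $ 1 = 0" "e2 $ 2 = 1"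
    by (simp_all add: axis_def)
  show ?thesis
    by (induction T;
        simp add: anti_pre_Lie_Poisson_def anti_pre_Lie_def strct_of_def cbilinear_table
          vec_eq_iff forall_2 comp e;
        (intro conjI allI)?; simp add: field_simps)
qed

inductive degeneration_step :: "algebra \<Rightarrow> algebra \<Rightarrow> bool" where
  "degeneration_step A01 A02"
| "degeneration_step A01 A03"
| "degeneration_step A05 (A06 0)"
| "degeneration_step A05 (A08 0)"
| "degeneration_step (A10 \<beta> \<beta>) (A12 \<beta> \<beta>)"
| "degeneration_step (A10 \<delta> \<epsilon>) (A14 \<delta>)"
| "degeneration_step (A10 \<delta> \<epsilon>) (A14 \<epsilon>)"
| "\<delta> \<noteq> \<epsilon> \<Longrightarrow> degeneration_step (A10 \<delta> \<epsilon>) A04"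
| "\<delta> \<noteq> \<epsilon> \<Longrightarrow> degeneration_step (A10 \<delta> \<epsilon>) (A18 \<alpha>)"
| "degeneration_step (A11 \<delta> \<epsilon>) (A12 \<delta> \<epsilon>)"
| "degeneration_step (A11 \<delta> \<epsilon>) A04"
| "\<alpha> \<noteq> 2 * \<epsilon> - \<delta> \<Longrightarrow> degeneration_step (A11 \<delta> \<epsilon>) (A18 \<alpha>)"
| "degeneration_step (A13 \<delta>) (A14 \<delta>)"
| "degeneration_step (A13 \<delta>) A03"
| "\<alpha> \<noteq> \<delta> \<Longrightarrow> degeneration_step (A13 \<delta>) (A18 \<alpha>)"
| "degeneration_step (A15 0) (A06 (- 2))"
| "degeneration_step (A15 1) A02"
| "\<delta> \<noteq> 0 \<Longrightarrow> \<delta> \<noteq> 1/2 \<Longrightarrow> \<delta> \<noteq> 1 \<Longrightarrow> degeneration_step (A15 \<delta>) (A08 (1 / (\<delta> - 1)))"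
| "\<delta> \<noteq> 1/2 \<Longrightarrow> degeneration_step (A15 \<delta>) (A18 \<alpha>)"
| "degeneration_step A17 (A08 0)"
| "degeneration_step A17 (A18 \<alpha>)"
| "degeneration_step (A12 \<beta> \<gamma>) (A18 (2 * \<gamma> - \<beta>))"
| "degeneration_step (A14 \<beta>) (A18 \<beta>)"
| "degeneration_step (A16 \<beta>) (A08 (- 2))"
| "degeneration_step (A16 \<beta>) (A18 \<beta>)"
| "degeneration_step A02 A04"
| "degeneration_step A03 A04"
| "\<beta> \<noteq> -1 \<Longrightarrow> degeneration_step (A06 \<beta>) A04"
| "\<beta> \<noteq> -1 \<Longrightarrow> \<beta> \<noteq> -2 \<Longrightarrow> degeneration_step (A08 \<beta>) A04"
| "degeneration_step A07 A04"
| "degeneration_step A07 (A06 (- 1))"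
| "degeneration_step A09 A04"
| "degeneration_step A09 (A08 (- 2))"
| "degeneration_step A04 C8"
| "degeneration_step (A06 (- 1)) C8"
| "degeneration_step (A08 (- 2)) C8"
| "degeneration_step (A18 \<alpha>) C8"

end

theory Submission
  imports Defs "HOL-Computational_Algebra.Polynomial" "HOL-Library.Function_Algebras"
begin

text \<open>Each elementary degeneration is the limit \<open>t \<rightarrow> 0\<close> of the structure constants in a basis
  depending on \<open>t\<close>. Conversely, an identity between products and traces of multiplication operators
  that holds in an algebra holds on its orbit, because it is covariant, and on the closure of the
  orbit, because it is polynomial. For each algebra a few such identities are satisfied by no
  algebra of the list other than those it should degenerate to.

  A chain of irreducible closed sets \<open>Z\<^sub>0 \<subset> \<dots> \<subset> Z\<^sub>n\<close> in an orbit yields algebraically independent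
  functions \<open>h\<^sub>1, \<dots>, h\<^sub>n\<close> on \<open>Z\<^sub>n\<close>, where \<open>h\<^sub>i\<close> vanishes on \<open>Z\<^sub>i\<^sub>-\<^sub>1\<close> but not on \<open>Z\<^sub>i\<close>. If a dense part of
  the orbit is parametrized by \<open>k\<close> variables, counting monomials of bounded degree gives \<open>n \<le> k\<close>. A
  chain of length \<open>k\<close> consists of the closures of the images of an increasing sequence of affine
  spaces of matrices.\<close>

section \<open>Structures in coordinates\<close>

text \<open>Two obstacles shape the dimension proofs. The action involves the inverse matrix, so
  along a family of matrices a polynomial function becomes a rational one, meaningful at invertible
  members only. Its denominator is a power of the determinant; counting and zero-divisor arguments
  take place after multiplication by such a power, and the count succeeds because all degrees grow
  only linearly with the bound on the exponents. Moreover, the four matrix entries as parameters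
  only give the bound 4. Smaller orbits have automorphism groups of positive dimension; multiplying
  a generic matrix from the right by an automorphism normalizes some of its entries, and the
  remaining ones are the \<open>k\<close> parameters.

  For non-degenerations, the parameter of a family has to be read off from something that survives
  in a limit. Ratios between traces of multiplication operators do: proportionality of two traces is
  a covariant polynomial condition, and it determines the ratio unless both traces vanish. They
  vanish on \<open>A04\<close> and \<open>A18\<close>, which is why these limits often occur
  whatever the parameter of the source is.\<close>

lemma axis_nth [simp]: "e1 $ 1 = 1" "e1 $ 2 = 0" "e2 $ 1 = 0" "e2 $ 2 = 1"
  by (simp_all add: axis_def)

lemma V_expand: "x = x$1 *s e1 + x$2 *s e2" for x :: V
  by (simp add: vec_eq_iff forall_2)

lemma vec_eq_2: "x = y \<longleftrightarrow> x$1 = y$1 \<and> x$2 = y$2" for x y :: V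
  by (simp add: vec_eq_iff forall_2)

lemma axis_cases: "axis i 1 = e1 \<or> axis i 1 = e2" for i :: 2
  using exhaust_2[of i] by auto

lemma table_nth:
  "table a b c d x y $ k = x$1 * y$1 * a$k + x$1 * y$2 * b$k + x$2 * y$1 * c$k + x$2 * y$2 * d$k"
  by (simp add: table_def)

lemma table_axis [simp]:
  "table a b c d e1 e1 = a" "table a b c d e1 e2 = b"
  "table a b c d e2 e1 = c" "table a b c d e2 e2 = d"
  by (simp_all add: table_def)

lemma cbilinear_add_scale:
  assumes "cbilinear m"
  shows "m (x + x') y = m x y + m x' y" "m x (y + y') = m x y + m x y'"
    "m (c *s x) y = c *s m x y" "m x (c *s y) = c *s m x y"
  using assms unfolding cbilinear_def Vector_Spaces.linear_iff by auto

lemma cbilinear_eq_table: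
  assumes "cbilinear m"
  shows "m = table (m e1 e1) (m e1 e2) (m e2 e1) (m e2 e2)"
proof (intro ext)
  fix x y
  have "m x y = m (x$1 *s e1 + x$2 *s e2) (y$1 *s e1 + y$2 *s e2)"
    by (rule arg_cong2[of x _ y _ m]) (rule V_expand)+
  also have "\<dots> = table (m e1 e1) (m e1 e2) (m e2 e1) (m e2 e2) x y"
    by (simp add: cbilinear_add_scale[OF assms] table_def vec_eq_iff algebra_simps)
  finally show "m x y = table (m e1 e1) (m e1 e2) (m e2 e1) (m e2 e2) x y" .
qed

lemma strct_of_Bil2: "strct_of T \<in> Bil2"
  using cbilinear_table by (induction T) (simp_all add: strct_of_def Bil2_def)

lemma Bil2_iff: "s \<in> Bil2 \<longleftrightarrow> cbilinear (fst s) \<and> cbilinear (snd s)"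
  by (cases s) (simp add: Bil2_def)

section \<open>The action\<close>

definition mat2 :: "complex \<Rightarrow> complex \<Rightarrow> complex \<Rightarrow> complex \<Rightarrow> complex ^ 2 ^ 2" where
  "mat2 p q r s = vector [vector [p, q], vector [r, s]]"

lemma mat2_nth [simp]:
  "mat2 p q r s $ 1 $ 1 = p" "mat2 p q r s $ 1 $ 2 = q"
  "mat2 p q r s $ 2 $ 1 = r" "mat2 p q r s $ 2 $ 2 = s"
  by (simp_all add: mat2_def)

lemma mat2_eta: "mat2 (g$1$1) (g$1$2) (g$2$1) (g$2$2) = g"
  by (simp add: vec_eq_iff forall_2)

lemma det_mat2 [simp]: "det (mat2 p q r s) = p * s - q * r"
  by (simp add: det_2)

lemma invertible_mat2 [simp]: "invertible (mat2 p q r s) \<longleftrightarrow> p * s - q * r \<noteq> 0"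
  by (simp add: invertible_det_nz)

lemma matrix_vector_2: "(g *v x) $ k = g$k$1 * x$1 + g$k$2 * x$2" for g :: "complex^2^2"
  by (simp add: matrix_vector_mult_def sum_2)

lemma matrix_inv:
  fixes g :: "complex^2^2"
  assumes "invertible g"
  shows "g ** matrix_inv g = mat 1" "matrix_inv g ** g = mat 1"
proof -
  have "g ** matrix_inv g = mat 1 \<and> matrix_inv g ** g = mat 1"
    unfolding matrix_inv_def by (rule someI_ex) (use assms in \<open>simp add: invertible_def\<close>)
  then show "g ** matrix_inv g = mat 1" "matrix_inv g ** g = mat 1" by auto
qed

lemma matrix_inv_eqI:
  fixes g h :: "complex^2^2"
  assumes "g ** h = mat 1" "h ** g = mat 1"
  shows "matrix_inv g = h"
proof -
  have "invertible g" using assms by (auto simp: invertible_def)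
  then show ?thesis
    by (metis assms(2) matrix_inv(1) matrix_mul_assoc matrix_mul_lid matrix_mul_rid)
qed

lemma invertible_matrix_inv:
  fixes g :: "complex^2^2"
  assumes "invertible g"
  shows "invertible (matrix_inv g)"
  using matrix_inv[OF assms] by (auto simp: invertible_def)

lemma matrix_inv_2:
  fixes g :: "complex^2^2"
  assumes "invertible g"
  shows "matrix_inv g = mat2 (g$2$2 / det g) (- g$1$2 / det g) (- g$2$1 / det g) (g$1$1 / det g)"
    (is "_ = ?h")
proof -
  have d: "det g \<noteq> 0" using assms by (simp add: invertible_det_nz)
  have e: "det g = g$1$1 * g$2$2 - g$1$2 * g$2$1" by (rule det_2)
  have "g ** ?h = mat 1" "?h ** g = mat 1"
    using d
    by (simp_all add: vec_eq_iff forall_2 matrix_matrix_mult_def sum_2 mat_def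
        diff_divide_distrib[symmetric] add_divide_distrib[symmetric] mult.commute e)
  then show ?thesis by (rule matrix_inv_eqI)
qed

lemma inv_mult_vec [simp]:
  fixes g :: "complex^2^2"
  assumes "invertible g"
  shows "matrix_inv g *v (g *v x) = x" "g *v (matrix_inv g *v x) = x"
  using assms by (simp_all add: matrix_vector_mul_assoc matrix_inv)

lemma act_Bil2:
  assumes "s \<in> Bil2"
  shows "act g s \<in> Bil2"
  using assms unfolding Bil2_iff cbilinear_def Vector_Spaces.linear_iff act_def
  by (auto simp: matrix_vector_right_distrib vector_scalar_commute)

lemma act_one [simp]: "act (mat 1) s = s"
proof -
  have "matrix_inv (mat 1 :: complex^2^2) = mat 1"
    by (rule matrix_inv_eqI) simp_all
  then show ?thesis by (simp add: act_def)
qed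

lemma matrix_inv_mult:
  fixes g h :: "complex^2^2"
  assumes "invertible g" "invertible h"
  shows "matrix_inv (g ** h) = matrix_inv h ** matrix_inv g"
proof (rule matrix_inv_eqI)
  show "g ** h ** (matrix_inv h ** matrix_inv g) = mat 1"
    using assms by (metis matrix_inv(1) matrix_mul_assoc matrix_mul_rid)
  show "matrix_inv h ** matrix_inv g ** (g ** h) = mat 1"
    using assms by (metis matrix_inv(2) matrix_mul_assoc matrix_mul_rid)
qed

lemma act_act:
  assumes "invertible g" "invertible h"
  shows "act g (act h s) = act (g ** h) s"
  by (simp add: act_def matrix_inv_mult[OF assms] matrix_vector_mul_assoc)

lemma act_eqI:
  assumes "invertible g"
    and "\<And>x y. fst t (g *v x) (g *v y) = g *v fst s x y"
    and "\<And>x y. snd t (g *v x) (g *v y) = g *v snd s x y"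
  shows "act g s = t"
  by (rule prod_eqI; intro ext)
    (simp_all add: act_def assms(2,3)[symmetric] assms(1))

lemma isomorphic_iff: "isomorphic s t \<longleftrightarrow> t \<in> orbit s"
proof
  assume "isomorphic s t"
  then obtain g :: "complex^2^2" where "invertible g" "act g s = t"
    unfolding isomorphic_def using act_eqI by metis
  then show "t \<in> orbit s" by (auto simp: orbit_def)
next
  assume "t \<in> orbit s"
  then obtain g where "invertible g" "t = act g s" by (auto simp: orbit_def)
  then show "isomorphic s t"
    unfolding isomorphic_def by (auto simp: act_def intro!: exI[of _ g])
qed

lemma orbit_refl: "s \<in> orbit s"
proof -
  have "invertible (mat 1 :: complex^2^2)" by (auto simp: invertible_def intro!: exI[of _ "mat 1"])
  then show ?thesis unfolding orbit_def using act_one[of s] by (metis (mono_tags) mem_Collect_eq)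
qed

lemma orbit_sym:
  assumes "t \<in> orbit s"
  shows "s \<in> orbit t"
proof -
  obtain g where g: "invertible g" "t = act g s" using assms by (auto simp: orbit_def)
  have i: "invertible (matrix_inv g)" by (simp add: g(1) invertible_matrix_inv)
  have "act (matrix_inv g) t = s"
    by (simp add: g act_act[OF i g(1)] matrix_inv(2)[OF g(1)])
  then show ?thesis using i by (auto simp: orbit_def)
qed

lemma act_orbit: "invertible g \<Longrightarrow> t \<in> orbit s \<Longrightarrow> act g t \<in> orbit s"
  unfolding orbit_def using act_act invertible_mult by blast

lemma orbit_Bil2: "s \<in> Bil2 \<Longrightarrow> orbit s \<subseteq> Bil2"
  by (auto simp: orbit_def act_Bil2)

section \<open>Polynomial functions and closures\<close>

text \<open>Products of arbitrary vectors are polynomial in the structure constants only where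
  bilinearity holds, so agreement with a member of \<open>poly_funs\<close> is demanded on
  \<open>Bil2\<close> alone.\<close>

definition poly_on :: "(strct \<Rightarrow> complex) \<Rightarrow> bool" where
  "poly_on F \<longleftrightarrow> (\<exists>f \<in> poly_funs. \<forall>s \<in> Bil2. f s = F s)"

lemma poly_onI: "f \<in> poly_funs \<Longrightarrow> poly_on f"
  by (auto simp: poly_on_def)

lemma poly_on_const: "poly_on (\<lambda>_. a)"
  by (auto intro!: poly_onI poly_funs.const)

lemma poly_on_add: "poly_on f \<Longrightarrow> poly_on g \<Longrightarrow> poly_on (\<lambda>s. f s + g s)"
  unfolding poly_on_def by (metis (no_types, lifting) poly_funs.add)

lemma poly_on_mult: "poly_on f \<Longrightarrow> poly_on g \<Longrightarrow> poly_on (\<lambda>s. f s * g s)"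
  unfolding poly_on_def by (metis (no_types, lifting) poly_funs.mult)

lemma poly_on_cong: "poly_on f \<Longrightarrow> (\<And>s. s \<in> Bil2 \<Longrightarrow> f s = g s) \<Longrightarrow> poly_on g"
  unfolding poly_on_def by metis

text \<open>Bilinearity expands the product over the basis. The arguments may themselves depend
  polynomially on \<open>s\<close>, which makes iterated products polynomial.\<close>

lemma poly_on_fst:
  assumes "\<And>k. poly_on (\<lambda>s. u s $ k)" "\<And>k. poly_on (\<lambda>s. v s $ k)"
  shows "poly_on (\<lambda>s. fst s (u s) (v s) $ k)"
proof (rule poly_on_cong)
  show "poly_on (\<lambda>s. u s $ 1 * v s $ 1 * fst s e1 e1 $ k + u s $ 1 * v s $ 2 * fst s e1 e2 $ k +
      u s $ 2 * v s $ 1 * fst s e2 e1 $ k + u s $ 2 * v s $ 2 * fst s e2 e2 $ k)"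
    by (intro poly_on_add poly_on_mult assms poly_onI poly_funs.coord_fst)
  fix s :: strct assume "s \<in> Bil2"
  then have "cbilinear (fst s)" by (simp add: Bil2_iff)
  from cbilinear_eq_table[OF this] show
    "u s $ 1 * v s $ 1 * fst s e1 e1 $ k + u s $ 1 * v s $ 2 * fst s e1 e2 $ k +
      u s $ 2 * v s $ 1 * fst s e2 e1 $ k + u s $ 2 * v s $ 2 * fst s e2 e2 $ k =
      fst s (u s) (v s) $ k"
    by (metis table_nth)
qed

lemma poly_on_snd:
  assumes "\<And>k. poly_on (\<lambda>s. u s $ k)" "\<And>k. poly_on (\<lambda>s. v s $ k)"
  shows "poly_on (\<lambda>s. snd s (u s) (v s) $ k)"
proof (rule poly_on_cong)
  show "poly_on (\<lambda>s. u s $ 1 * v s $ 1 * snd s e1 e1 $ k + u s $ 1 * v s $ 2 * snd s e1 e2 $ k +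
      u s $ 2 * v s $ 1 * snd s e2 e1 $ k + u s $ 2 * v s $ 2 * snd s e2 e2 $ k)"
    by (intro poly_on_add poly_on_mult assms poly_onI poly_funs.coord_snd)
  fix s :: strct assume "s \<in> Bil2"
  then have "cbilinear (snd s)" by (simp add: Bil2_iff)
  from cbilinear_eq_table[OF this] show
    "u s $ 1 * v s $ 1 * snd s e1 e1 $ k + u s $ 1 * v s $ 2 * snd s e1 e2 $ k +
      u s $ 2 * v s $ 1 * snd s e2 e1 $ k + u s $ 2 * v s $ 2 * snd s e2 e2 $ k =
      snd s (u s) (v s) $ k"
    by (metis table_nth)
qed

text \<open>For a fixed matrix the action is linear in the structure constants.\<close>

lemma poly_on_act:
  assumes "f \<in> poly_funs"
  shows "poly_on (\<lambda>s. f (act g s))"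
  using assms
proof induction
  case (coord_fst i j k)
  show ?case
    by (simp add: act_def matrix_vector_2)
      (intro poly_on_add poly_on_mult poly_on_const poly_on_fst)
next
  case (coord_snd i j k)
  show ?case
    by (simp add: act_def matrix_vector_2)
      (intro poly_on_add poly_on_mult poly_on_const poly_on_snd)
qed (auto intro: poly_on_const poly_on_add poly_on_mult)

text \<open>Closed sets are zero loci, so the closure is cut out by everything that vanishes on
  \<open>S\<close>. This turns membership in a closure into a statement about single
  polynomials.\<close>

lemma in_closure_iff:
  assumes "S \<subseteq> Bil2"
  shows "t \<in> zariski closure_of S \<longleftrightarrow>
    t \<in> Bil2 \<and> (\<forall>f \<in> poly_funs. (\<forall>u \<in> S. f u = 0) \<longrightarrow> f t = 0)"
proof
  assume t: "t \<in> zariski closure_of S"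
  then have "t \<in> Bil2" using closure_of_subset_topspace[of zariski S] topspace_zariski by blast
  moreover have "f t = 0" if f: "f \<in> poly_funs" "\<forall>u \<in> S. f u = 0" for f
  proof -
    have "closedin zariski (zero_locus {f})" using f(1) by (auto simp: closedin_zariski)
    moreover have "S \<subseteq> zero_locus {f}" using assms f(2) by (auto simp: zero_locus_def)
    ultimately have "zariski closure_of S \<subseteq> zero_locus {f}" by (simp add: closure_of_minimal)
    then show ?thesis using t by (auto simp: zero_locus_def)
  qed
  ultimately show "t \<in> Bil2 \<and> (\<forall>f \<in> poly_funs. (\<forall>u \<in> S. f u = 0) \<longrightarrow> f t = 0)" by blast
next
  assume t: "t \<in> Bil2 \<and> (\<forall>f \<in> poly_funs. (\<forall>u \<in> S. f u = 0) \<longrightarrow> f t = 0)"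
  have "closedin zariski (zariski closure_of S)" by simp
  then obtain F where F: "F \<subseteq> poly_funs" "zariski closure_of S = zero_locus F"
    unfolding closedin_zariski by blast
  have "S \<subseteq> zero_locus F"
    using closure_of_subset[of S zariski] assms topspace_zariski F(2) by simp
  then have "f u = 0" if "f \<in> F" "u \<in> S" for f u
    using that by (auto simp: zero_locus_def)
  then have "\<forall>f \<in> F. f t = 0" using F(1) t by blast
  then show "t \<in> zariski closure_of S" using F(2) t by (simp add: zero_locus_def)
qed

text \<open>Since \<open>g\<close> permutes the orbit, the pullback of a function vanishing on the
  orbit vanishes there too, hence at \<open>t\<close>. So the choice of a representative in the
  definition of degeneration does not matter.\<close>

lemma closure_act:
  assumes "s \<in> Bil2" "t \<in> zariski closure_of orbit s" "invertible g"
  shows "act g t \<in> zariski closure_of orbit s"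
proof -
  note cl = in_closure_iff[OF orbit_Bil2[OF assms(1)]]
  have t: "t \<in> Bil2" "\<And>f. f \<in> poly_funs \<Longrightarrow> (\<forall>u \<in> orbit s. f u = 0) \<Longrightarrow> f t = 0"
    using assms(2) cl by auto
  have "f (act g t) = 0" if f: "f \<in> poly_funs" "\<forall>u \<in> orbit s. f u = 0" for f
  proof -
    obtain f' where f': "f' \<in> poly_funs" "\<forall>s \<in> Bil2. f' s = f (act g s)"
      using poly_on_act[OF f(1)] by (auto simp: poly_on_def)
    have "\<forall>u \<in> orbit s. f' u = 0"
    proof
      fix u assume u: "u \<in> orbit s"
      then have "f (act g u) = 0" using f(2) act_orbit[OF assms(3)] by blast
      moreover have "u \<in> Bil2" using u orbit_Bil2[OF assms(1)] by blast
      ultimately show "f' u = 0" using f'(2) by simp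
    qed
    then have "f' t = 0" using t(2) f'(1) by blast
    then show ?thesis using f'(2) t(1) by simp
  qed
  then show ?thesis using cl act_Bil2[OF t(1)] by blast
qed

lemma degenerates_iff:
  assumes "s \<in> Bil2"
  shows "degenerates s s' \<longleftrightarrow> s' \<in> zariski closure_of orbit s"
proof
  assume "degenerates s s'"
  then obtain t where t: "t \<in> orbit s'" "t \<in> zariski closure_of orbit s"
    by (auto simp: degenerates_def isomorphic_iff)
  then obtain g where "invertible g" "s' = act g t"
    using orbit_sym[OF t(1)] by (auto simp: orbit_def)
  then show "s' \<in> zariski closure_of orbit s" using closure_act assms t(2) by blast
next
  assume "s' \<in> zariski closure_of orbit s"
  then show "degenerates s s'"
    unfolding degenerates_def isomorphic_iff using orbit_refl by blast
qed

lemma degenerates_trans: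
  assumes "s \<in> Bil2" "s' \<in> Bil2" "degenerates s s'" "degenerates s' s''"
  shows "degenerates s s''"
proof -
  have "s' \<in> zariski closure_of orbit s" using assms(1,3) degenerates_iff by blast
  then have "orbit s' \<subseteq> zariski closure_of orbit s"
    using closure_act[OF assms(1)] unfolding orbit_def[of s'] by blast
  then have "zariski closure_of orbit s' \<subseteq> zariski closure_of orbit s"
    by (simp add: closure_of_minimal)
  then show ?thesis using assms degenerates_iff by blast
qed

lemma isomorphic_degenerates:
  assumes "s \<in> Bil2" "isomorphic s t"
  shows "degenerates s t"
  using assms closure_of_subset[of "orbit s" zariski] orbit_Bil2 topspace_zariski
  by (auto simp: degenerates_iff isomorphic_iff)

section \<open>Polynomials in several variables\<close>

abbreviation fun_scale :: "complex \<Rightarrow> ('a \<Rightarrow> complex) \<Rightarrow> 'a \<Rightarrow> complex" where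
  "fun_scale c f \<equiv> \<lambda>x. c * f x"

lemma fun_vector_space: "vector_space fun_scale"
  by unfold_locales (auto simp: fun_eq_iff algebra_simps)

lemma fun_module: "module fun_scale"
  by unfold_locales (auto simp: fun_eq_iff algebra_simps)

text \<open>Bounding the degree in each variable separately, not in total, leaves
  \<open>(M + 1) ^ k\<close> exponent vectors, which keeps the later count elementary.\<close>

definition Pol :: "nat \<Rightarrow> nat \<Rightarrow> ((nat \<Rightarrow> complex) \<Rightarrow> complex) set" where
  "Pol k M = module.span fun_scale ((\<lambda>e p. \<Prod>i<k. p i ^ e i) ` ({..<k} \<rightarrow>\<^sub>E {..M}))"

lemma Pol_0: "(\<lambda>_. 0) \<in> Pol k M"
  unfolding Pol_def zero_fun_def[symmetric] by (rule module.span_zero[OF fun_module])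

lemma Pol_add:
  assumes "f \<in> Pol k M" "g \<in> Pol k M"
  shows "(\<lambda>p. f p + g p) \<in> Pol k M"
proof -
  have "f + g \<in> Pol k M" using assms unfolding Pol_def by (rule module.span_add[OF fun_module])
  then show ?thesis by (simp add: plus_fun_def)
qed

lemma Pol_scale: "f \<in> Pol k M \<Longrightarrow> (\<lambda>p. c * f p) \<in> Pol k M"
  unfolding Pol_def by (rule module.span_scale[OF fun_module])

lemma Pol_monom:
  assumes "\<And>i. i < k \<Longrightarrow> e i \<le> M"
  shows "(\<lambda>p. \<Prod>i<k. p i ^ e i) \<in> Pol k M"
proof -
  have "(\<lambda>p. \<Prod>i<k. p i ^ e i) = (\<lambda>p :: nat \<Rightarrow> complex. \<Prod>i<k. p i ^ (restrict e {..<k}) i)"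
    by (intro ext prod.cong) auto
  moreover have "restrict e {..<k} \<in> {..<k} \<rightarrow>\<^sub>E {..M}" using assms by auto
  ultimately show ?thesis unfolding Pol_def by (intro module.span_base[OF fun_module] image_eqI)
qed

lemma Pol_induct [consumes 1, case_names monom zero add scale]:
  assumes "f \<in> Pol k M"
    and "\<And>e. (\<And>i. i < k \<Longrightarrow> e i \<le> M) \<Longrightarrow> P (\<lambda>p. \<Prod>i<k. p i ^ e i)"
    and "P (\<lambda>_. 0)"
    and "\<And>f g. P f \<Longrightarrow> P g \<Longrightarrow> P (\<lambda>p. f p + g p)"
    and "\<And>c f. P f \<Longrightarrow> P (\<lambda>p. c * f p)"
  shows "P f"
proof (rule module.span_induct[OF fun_module assms(1)[unfolded Pol_def]])
  show "P f" if "f \<in> (\<lambda>e p. \<Prod>i<k. p i ^ e i) ` ({..<k} \<rightarrow>\<^sub>E {..M})" for f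
    using that assms(2) by (auto simp: PiE_iff)
  show "module.subspace fun_scale {f. P f}"
    unfolding module.subspace_def[OF fun_module] using assms(3-5)
      by (simp add: zero_fun_def plus_fun_def)
qed

lemma Pol_mult:
  assumes "f \<in> Pol k M" "g \<in> Pol k N"
  shows "(\<lambda>p. f p * g p) \<in> Pol k (M + N)"
  using assms(1)
proof (induction rule: Pol_induct)
  case (monom e)
  show ?case using assms(2)
  proof (induction rule: Pol_induct)
    case (monom e')
    have "(\<lambda>p. \<Prod>i<k. p i ^ (e i + e' i)) \<in> Pol k (M + N)"
      using monom \<open>\<And>i. i < k \<Longrightarrow> e i \<le> M\<close> by (intro Pol_monom add_mono) auto
    then show ?case by (simp add: power_add prod.distrib)
  next
    case (add f g)
    then show ?case using Pol_add by (simp add: distrib_left)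
  next
    case (scale c f)
    then show ?case using Pol_scale[of _ k "M + N" c] by (simp add: mult.left_commute)
  qed (simp add: Pol_0)
next
  case (add f g)
  then show ?case using Pol_add by (simp add: distrib_right)
next
  case (scale c f)
  then show ?case using Pol_scale[of _ k "M + N" c] by (simp add: mult.assoc)
qed (simp add: Pol_0)

lemma Pol_mono:
  assumes "f \<in> Pol k M" "M \<le> N"
  shows "f \<in> Pol k N"
  using assms(1)
  by (induction rule: Pol_induct) (use assms(2) in \<open>force intro: Pol_monom Pol_0 Pol_add Pol_scale\<close>)+

lemma Pol_1: "(\<lambda>_. 1) \<in> Pol k M"
  using Pol_monom[of k "\<lambda>_. 0" M] by simp

lemma Pol_const: "(\<lambda>_. c) \<in> Pol k M"
  using Pol_scale[OF Pol_1, of c k M] by simp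

lemma Pol_diff: "f \<in> Pol k M \<Longrightarrow> g \<in> Pol k M \<Longrightarrow> (\<lambda>p. f p - g p) \<in> Pol k M"
  using Pol_add[of f k M "\<lambda>p. - 1 * g p"] Pol_scale[of g k M "- 1"] by simp

lemma Pol_var:
  assumes "i < k"
  shows "(\<lambda>p. p i) \<in> Pol k 1"
proof -
  have "(\<lambda>p. \<Prod>j<k. p j ^ (if j = i then 1 else 0)) \<in> Pol k 1"
    by (rule Pol_monom) simp
  moreover have "(\<Prod>j<k. p j ^ (if j = i then 1 else 0)) = p i" for p :: "nat \<Rightarrow> complex"
    using assms by (subst prod.remove[of _ i]) auto
  ultimately show ?thesis by simp
qed

lemma Pol_power: "f \<in> Pol k M \<Longrightarrow> (\<lambda>p. f p ^ n) \<in> Pol k (M * n)"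
proof (induction n)
  case (Suc n)
  then show ?case using Pol_mult[of f k M "\<lambda>p. f p ^ n" "M * n"] by simp
qed (simp add: Pol_1)

lemma Pol_sum:
  "(\<And>a. a \<in> A \<Longrightarrow> f a \<in> Pol k M) \<Longrightarrow> (\<lambda>p. \<Sum>a\<in>A. f a p) \<in> Pol k M"
  by (induction A rule: infinite_finite_induct) (auto intro: Pol_0 Pol_add)

text \<open>One-parameter families of matrices are analysed through \<open>poly\<close>, where
  products of nonzero polynomials are nonzero and a polynomial vanishing at every point is
  0.\<close>

lemma Pol_1_poly:
  assumes "f \<in> Pol 1 M"
  obtains P :: "complex poly" where "\<And>p. f p = poly P (p 0)"
proof -
  have "\<exists>P :: complex poly. \<forall>p. f p = poly P (p 0)"
    using assms
  proof (induction rule: Pol_induct)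
    case (monom e)
    show ?case by (rule exI[of _ "Polynomial.monom 1 (e 0)"]) (simp add: poly_monom)
  next
    case zero
    show ?case by (rule exI[of _ 0]) simp
  next
    case (add f g)
    then show ?case by (metis poly_add)
  next
    case (scale c f)
    then show ?case by (metis poly_smult)
  qed
  then show ?thesis using that by blast
qed

text \<open>The span has at most \<open>(M + 1) ^ k\<close> generators. Linear dependence is a
  notion about sets of functions, so a repetition \<open>f a = f b\<close> is treated apart, with
  the relation \<open>f a - f b = 0\<close>.\<close>

lemma Pol_dependent:
  assumes "finite A" "\<And>a. a \<in> A \<Longrightarrow> f a \<in> Pol k M" "card A > (M + 1) ^ k"
  obtains x :: "'a \<Rightarrow> complex" where "\<exists>a\<in>A. x a \<noteq> 0" "\<And>p. (\<Sum>a\<in>A. x a * f a p) = 0"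
proof (cases "inj_on f A")
  case False
  then obtain a b where ab: "a \<in> A" "b \<in> A" "f a = f b" "a \<noteq> b" by (auto simp: inj_on_def)
  define x :: "'a \<Rightarrow> complex" where "x c = (if c = a then 1 else if c = b then - 1 else 0)" for c
  have "(\<Sum>c\<in>A. x c * f c p) = 0" for p
  proof -
    have "(\<Sum>c\<in>A. x c * f c p) = (\<Sum>c\<in>{a, b}. x c * f c p)"
      using assms(1) ab by (intro sum.mono_neutral_right) (auto simp: x_def)
    then show ?thesis using ab by (simp add: x_def)
  qed
  moreover have "\<exists>c\<in>A. x c \<noteq> 0" using ab(1) by (auto simp: x_def)
  ultimately show ?thesis using that by blast
next
  case True
  let ?B = "(\<lambda>e p. \<Prod>i<k. p i ^ e i :: complex) ` ({..<k} \<rightarrow>\<^sub>E {..M})"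
  have fin: "finite ?B" by (intro finite_imageI finite_PiE) auto
  have "card ?B \<le> card ({..<k} \<rightarrow>\<^sub>E {..M})"
    by (rule card_image_le) (intro finite_PiE; auto)
  also have "\<dots> = (M + 1) ^ k" by (simp add: card_PiE)
  finally have "card ?B < card (f ` A)" using assms(3) card_image[OF True] by simp
  then have "module.dependent fun_scale (f ` A)"
    using vector_space.independent_span_bound[OF fun_vector_space fin, of "f ` A"]
      assms(2) unfolding Pol_def by fastforce
  then obtain u where u: "\<exists>v\<in>f ` A. u v \<noteq> 0" "(\<Sum>v\<in>f ` A. (\<lambda>p. u v * v p)) = 0"
    using module.dependent_finite[OF fun_module, of "f ` A"] assms(1) by auto
  have ev: "(\<Sum>v\<in>S. (g v :: 'b \<Rightarrow> complex)) p = (\<Sum>v\<in>S. g v p)" for g S and p :: 'b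
    by (induction S rule: infinite_finite_induct) auto
  have "(\<Sum>a\<in>A. u (f a) * f a p) = 0" for p
  proof -
    have "(\<Sum>a\<in>A. u (f a) * f a p) = (\<Sum>v\<in>f ` A. u v * v p)"
      by (simp add: sum.reindex[OF True])
    also have "\<dots> = (\<Sum>v\<in>f ` A. (\<lambda>p. u v * v p)) p" by (simp only: ev)
    finally show ?thesis using u(2) by simp
  qed
  then show ?thesis using that[of "\<lambda>a. u (f a)"] u(1) by blast
qed

section \<open>Pulling polynomial functions back along a family of matrices\<close>

definition Pol_family :: "nat \<Rightarrow> ((nat \<Rightarrow> complex) \<Rightarrow> complex ^ 2 ^ 2) \<Rightarrow> bool" where
  "Pol_family k l \<longleftrightarrow> (\<forall>i j. (\<lambda>p. l p $ i $ j) \<in> Pol k 1)"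

lemma Pol_family_mat2:
  assumes "a \<in> Pol k 1" "b \<in> Pol k 1" "c \<in> Pol k 1" "d \<in> Pol k 1"
  shows "Pol_family k (\<lambda>p. mat2 (a p) (b p) (c p) (d p))"
  unfolding Pol_family_def using assms by (simp add: forall_2)

lemma Pol_det:
  assumes "Pol_family k l"
  shows "(\<lambda>p. det (l p)) \<in> Pol k 2"
proof -
  have "(\<lambda>p. l p $ i $ j) \<in> Pol k 1" for i j using assms by (simp add: Pol_family_def)
  then have "(\<lambda>p. l p $ i $ j * l p $ i' $ j') \<in> Pol k (1 + 1)" for i j i' j' by (intro Pol_mult)
  then have "(\<lambda>p. l p $ i $ j * l p $ i' $ j') \<in> Pol k 2" for i j i' j' by (simp only: one_add_one)
  then show ?thesis unfolding det_2 by (intro Pol_diff)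
qed

lemma Pol_3:
  assumes "f \<in> Pol k 1" "g \<in> Pol k 1" "h \<in> Pol k 1"
  shows "(\<lambda>p. f p * g p * h p) \<in> Pol k 3"
  using Pol_mult[OF Pol_mult[OF assms(1,2)] assms(3)] by (simp add: eval_nat_numeral)

text \<open>\<open>h\<close> is the adjugate of \<open>g\<close>. Each of the two arguments of the
  product contributes one factor \<open>1 / det g\<close>, so the square of the determinant clears
  the denominators and leaves a cubic expression in the entries of \<open>g\<close>.\<close>

lemma act_coord:
  fixes g :: "complex^2^2" and m :: "V \<Rightarrow> V \<Rightarrow> V"
  assumes "cbilinear m" "invertible g"
  defines "h \<equiv> mat2 (g$2$2) (- g$1$2) (- g$2$1) (g$1$1)"
  shows "(g *v m (matrix_inv g *v axis i 1) (matrix_inv g *v axis j 1)) $ k * det g ^ 2 =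
    (\<Sum>n\<in>UNIV. \<Sum>a\<in>UNIV. \<Sum>b\<in>UNIV. m (axis a 1) (axis b 1) $ n * (g$k$n * h$a$i * h$b$j))"
proof -
  have d: "det g \<noteq> 0" using assms(2) by (simp add: invertible_det_nz)
  have inv: "matrix_inv g *v axis i 1 = (1 / det g) *s (h *v axis i 1)" for i
    using d by (simp add: matrix_inv_2[OF assms(2)] h_def vec_eq_2 matrix_vector_2 field_simps)
  have h: "(h *v axis i 1) $ a = h$a$i" for a i
    using exhaust_2[of i] by (auto simp: matrix_vector_2)
  have m: "m x y $ n = (\<Sum>a\<in>UNIV. \<Sum>b\<in>UNIV. x$a * y$b * m (axis a 1) (axis b 1) $ n)" for x y n
    by (subst cbilinear_eq_table[OF assms(1)]) (simp add: table_nth sum_2)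
  have "(g *v m (matrix_inv g *v axis i 1) (matrix_inv g *v axis j 1)) $ k * det g ^ 2 =
      (g *v m (h *v axis i 1) (h *v axis j 1)) $ k"
    using d by (simp add: inv cbilinear_add_scale[OF assms(1)] vector_scalar_commute
        power2_eq_square)
  also have "\<dots> = (\<Sum>n\<in>UNIV. g$k$n * (\<Sum>a\<in>UNIV. \<Sum>b\<in>UNIV. h$a$i * h$b$j * m (axis a 1) (axis b 1) $ n))"
    by (simp only: matrix_vector_mult_def[of g] vec_lambda_beta m[of "h *v axis i 1" "h *v axis j 1"] h)
  finally show ?thesis by (simp add: sum_distrib_left ac_simps)
qed

lemma Pol_family_adj:
  assumes "Pol_family k l"
  shows "Pol_family k (\<lambda>p. mat2 (l p$2$2) (- l p$1$2) (- l p$2$1) (l p$1$1))"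
  using assms Pol_scale[where c = "- 1" and k = k and M = 1]
  by (intro Pol_family_mat2) (simp_all add: Pol_family_def)

lemma act_coord_Pol:
  assumes "Pol_family k l" "cbilinear m"
  obtains F where "F \<in> Pol k 3" "\<And>p. det (l p) \<noteq> 0 \<Longrightarrow>
    F p = (l p *v m (matrix_inv (l p) *v axis i 1) (matrix_inv (l p) *v axis j 1)) $ n * det (l p) ^ 2"
proof -
  define h where "h p = mat2 (l p$2$2) (- l p$1$2) (- l p$2$1) (l p$1$1)" for p
  define F where "F p = (\<Sum>c\<in>UNIV. \<Sum>a\<in>UNIV. \<Sum>b\<in>UNIV.
      m (axis a 1) (axis b 1) $ c * (l p$n$c * h p$a$i * h p$b$j))" for p
  have "(\<lambda>p. l p$a$b) \<in> Pol k 1" "(\<lambda>p. h p$a$b) \<in> Pol k 1" for a b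
    using assms(1) Pol_family_adj[OF assms(1)] by (simp_all add: Pol_family_def h_def)
  then have "F \<in> Pol k 3"
    unfolding F_def by (intro Pol_sum Pol_scale Pol_3)
  moreover have "F p =
      (l p *v m (matrix_inv (l p) *v axis i 1) (matrix_inv (l p) *v axis j 1)) $ n * det (l p) ^ 2"
    if "det (l p) \<noteq> 0" for p
    using act_coord[OF assms(2), of "l p" i j n] that by (simp add: F_def h_def invertible_det_nz)
  ultimately show ?thesis using that by blast
qed

text \<open>Structure constants have the denominator \<open>det (l p) ^ 2\<close>, and sums are
  brought to the common denominator \<open>det (l p) ^ (N + N')\<close>. The exponent depends on
  \<open>f\<close>, and nothing is claimed at singular matrices, where the action has no
  meaning.\<close>

lemma poly_funs_pullback:
  assumes "f \<in> poly_funs" "Pol_family k l" "s \<in> Bil2"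
  shows "\<exists>N M. \<exists>F \<in> Pol k M. \<forall>p. det (l p) \<noteq> 0 \<longrightarrow> F p = f (act (l p) s) * det (l p) ^ N"
  using assms(1)
proof induction
  case (const a)
  show ?case by (rule exI[of _ 0], rule exI[of _ 0], rule bexI[OF _ Pol_const[of a]]) simp
next
  case (coord_fst i j n)
  have "cbilinear (fst s)" using assms(3) by (simp add: Bil2_iff)
  from act_coord_Pol[OF assms(2) this, of i j n] show ?case
    unfolding act_def fst_conv by metis
next
  case (coord_snd i j n)
  have "cbilinear (snd s)" using assms(3) by (simp add: Bil2_iff)
  from act_coord_Pol[OF assms(2) this, of i j n] show ?case
    unfolding act_def snd_conv by metis
next
  case (add f g)
  obtain N M F where F: "F \<in> Pol k M"
    "\<And>p. det (l p) \<noteq> 0 \<Longrightarrow> F p = f (act (l p) s) * det (l p) ^ N"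
    using add.IH(1) by blast
  obtain N' M' G where G: "G \<in> Pol k M'"
    "\<And>p. det (l p) \<noteq> 0 \<Longrightarrow> G p = g (act (l p) s) * det (l p) ^ N'"
    using add.IH(2) by blast
  let ?H = "\<lambda>p. F p * det (l p) ^ N' + G p * det (l p) ^ N"
  have "?H \<in> Pol k (max (M + 2 * N') (M' + 2 * N))"
    using Pol_mult[OF F(1) Pol_power[OF Pol_det[OF assms(2)], of N']]
      Pol_mult[OF G(1) Pol_power[OF Pol_det[OF assms(2)], of N]]
    by (intro Pol_add) (auto elim: Pol_mono)
  moreover have "?H p = (f (act (l p) s) + g (act (l p) s)) * det (l p) ^ (N + N')"
    if "det (l p) \<noteq> 0" for p
    using F(2)[OF that] G(2)[OF that] by (simp add: power_add algebra_simps)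
  ultimately show ?case
    by (intro exI[of _ "N + N'"] exI[of _ "max (M + 2 * N') (M' + 2 * N)"] bexI[of _ ?H]) auto
next
  case (mult f g)
  obtain N M F where F: "F \<in> Pol k M"
    "\<And>p. det (l p) \<noteq> 0 \<Longrightarrow> F p = f (act (l p) s) * det (l p) ^ N"
    using mult.IH(1) by blast
  obtain N' M' G where G: "G \<in> Pol k M'"
    "\<And>p. det (l p) \<noteq> 0 \<Longrightarrow> G p = g (act (l p) s) * det (l p) ^ N'"
    using mult.IH(2) by blast
  have "F p * G p = f (act (l p) s) * g (act (l p) s) * det (l p) ^ (N + N')"
    if "det (l p) \<noteq> 0" for p
    using F(2)[OF that] G(2)[OF that] by (simp add: power_add algebra_simps)
  then show ?case
    using Pol_mult[OF F(1) G(1)]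
    by (intro exI[of _ "N + N'"] exI[of _ "M + M'"] bexI[of _ "\<lambda>p. F p * G p"]) auto
qed

section \<open>Algebraic independence along a chain\<close>

fun mon :: "(strct \<Rightarrow> complex) list \<Rightarrow> nat list \<Rightarrow> strct \<Rightarrow> complex" where
  "mon (h # hs) (e # es) = (\<lambda>t. h t ^ e * mon hs es t)"
| "mon _ _ = (\<lambda>_. 1)"

definition exps :: "nat \<Rightarrow> nat \<Rightarrow> nat list set" where
  "exps n E = {es. length es = n \<and> set es \<subseteq> {..E}}"

lemma exps_0 [simp]: "exps 0 E = {[]}"
  by (auto simp: exps_def)

lemma finite_exps [simp]: "finite (exps n E)"
  using finite_lists_length_eq[of "{..E}" n] by (simp add: exps_def conj_commute)

lemma card_exps: "card (exps n E) = (E + 1) ^ n"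
  using card_lists_length_eq[of "{..E}" n] by (simp add: exps_def conj_commute)

text \<open>Orders a polynomial in several functions by the powers of the first one, as needed in
  \<open>alg_indep_Cons\<close>.\<close>

lemma sum_exps_Suc: "sum f (exps (Suc n) E) = (\<Sum>j\<le>E. \<Sum>es\<in>exps n E. f (j # es))"
proof -
  have "exps (Suc n) E = (\<lambda>(j, es). j # es) ` ({..E} \<times> exps n E)"
  proof (rule set_eqI)
    fix xs
    have "xs \<in> exps (Suc n) E \<longleftrightarrow> (\<exists>j es. xs = j # es \<and> j \<le> E \<and> es \<in> exps n E)"
      by (auto simp: exps_def length_Suc_conv)
    then show "xs \<in> exps (Suc n) E \<longleftrightarrow> xs \<in> (\<lambda>(j, es). j # es) ` ({..E} \<times> exps n E)"
      by force
  qed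
  then have "sum f (exps (Suc n) E) = (\<Sum>(j, es)\<in>{..E} \<times> exps n E. f (j # es))"
    by (simp add: sum.reindex inj_on_def case_prod_unfold)
  then show ?thesis by (simp add: sum.cartesian_product)
qed

text \<open>A polynomial relation is a family of coefficients on a box of exponents, and
  \<open>E\<close> ranges over all boxes. The empty list is independent precisely on nonempty
  sets.\<close>

definition alg_indep :: "(strct \<Rightarrow> complex) list \<Rightarrow> strct set \<Rightarrow> bool" where
  "alg_indep hs Z \<longleftrightarrow> (\<forall>E x. (\<forall>t\<in>Z. (\<Sum>es\<in>exps (length hs) E. x es * mon hs es t) = 0) \<longrightarrow>
     (\<forall>es\<in>exps (length hs) E. x es = 0))"

lemma poly_funs_power: "f \<in> poly_funs \<Longrightarrow> (\<lambda>s. f s ^ n) \<in> poly_funs"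
  by (induction n) (auto intro: poly_funs.const poly_funs.mult)

lemma poly_funs_sum:
  "(\<And>a. a \<in> A \<Longrightarrow> f a \<in> poly_funs) \<Longrightarrow> (\<lambda>s. \<Sum>a\<in>A. f a s) \<in> poly_funs"
  by (induction A rule: infinite_finite_induct) (auto intro: poly_funs.const poly_funs.add)

lemma poly_funs_mon: "set hs \<subseteq> poly_funs \<Longrightarrow> (\<lambda>s. mon hs es s) \<in> poly_funs"
proof (induction hs es rule: list_induct2')
  case (4 h hs e es)
  then have "(\<lambda>s. h s ^ e * mon hs es s) \<in> poly_funs"
    by (intro poly_funs.mult poly_funs_power) auto
  then show ?case by (simp add: fun_eq_iff)
qed (simp_all add: poly_funs.const)

text \<open>Write a relation on \<open>Z'\<close> as the sum of \<open>h ^ j * A j\<close> and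
  suppose that the coefficients below \<open>j\<close> are already 0. As \<open>h\<close> is not
  identically 0 on \<open>Z'\<close>, the hypothesis \<open>prime\<close> allows
  \<open>h ^ j\<close> to be cancelled. On \<open>Z\<close>, where \<open>h\<close> vanishes, only
  \<open>A j\<close> is left of the quotient \<open>G\<close>, and independence on \<open>Z\<close>
  makes its coefficients 0.\<close>

lemma alg_indep_Cons:
  assumes indep: "alg_indep hs Z" and hs: "set hs \<subseteq> poly_funs" and h: "h \<in> poly_funs"
    and Z: "Z \<subseteq> Z'" "\<And>t. t \<in> Z \<Longrightarrow> h t = 0" "t0 \<in> Z'" "h t0 \<noteq> 0"
    and prime: "\<And>p q. p \<in> poly_funs \<Longrightarrow> q \<in> poly_funs \<Longrightarrow> (\<forall>t\<in>Z'. p t * q t = 0) \<Longrightarrow>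
      (\<forall>t\<in>Z'. p t = 0) \<or> (\<forall>t\<in>Z'. q t = 0)"
  shows "alg_indep (h # hs) Z'"
  unfolding alg_indep_def
proof (intro allI impI)
  fix E x
  assume rel: "\<forall>t\<in>Z'. (\<Sum>es\<in>exps (length (h # hs)) E. x es * mon (h # hs) es t) = 0"
  let ?n = "length hs"
  define A where "A j t = (\<Sum>es\<in>exps ?n E. x (j # es) * mon hs es t)" for j t
  have A_poly: "A j \<in> poly_funs" for j
    unfolding A_def using hs by (intro poly_funs_sum poly_funs.mult poly_funs.const poly_funs_mon)
  have rel': "(\<Sum>j\<le>E. h t ^ j * A j t) = 0" if "t \<in> Z'" for t
    using rel[rule_format, OF that] by (simp add: sum_exps_Suc A_def sum_distrib_left ac_simps)
  have zero: "\<forall>es\<in>exps ?n E. x (j # es) = 0" if "j \<le> E" for j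
    using that
  proof (induction j rule: less_induct)
    case (less j)
    define G where "G t = (\<Sum>i\<in>{j..E}. h t ^ (i - j) * A i t)" for t
    have G_poly: "G \<in> poly_funs"
      unfolding G_def by (intro poly_funs_sum poly_funs.mult poly_funs_power h A_poly)
    have "h t ^ j * G t = 0" if "t \<in> Z'" for t
    proof -
      have "(\<Sum>i\<le>E. h t ^ i * A i t) = (\<Sum>i\<in>{j..E}. h t ^ i * A i t)"
        using less by (intro sum.mono_neutral_right) (auto simp: A_def not_le)
      also have "\<dots> = (\<Sum>i\<in>{j..E}. h t ^ j * (h t ^ (i - j) * A i t))"
        by (intro sum.cong) (auto simp: power_add[symmetric] mult.assoc[symmetric])
      finally show ?thesis using rel'[OF that] by (simp add: G_def sum_distrib_left)
    qed
    then have "(\<forall>t\<in>Z'. h t ^ j = 0) \<or> (\<forall>t\<in>Z'. G t = 0)"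
      using poly_funs_power[OF h] G_poly by (intro prime) auto
    then have G: "G t = 0" if "t \<in> Z'" for t using Z(3,4) that by auto
    have "A j t = 0" if t: "t \<in> Z" for t
    proof -
      have "G t = (\<Sum>i\<in>{j}. h t ^ (i - j) * A i t)"
        unfolding G_def using less.prems Z(2)[OF t] by (intro sum.mono_neutral_right) auto
      moreover have "G t = 0" using G Z(1) t by blast
      ultimately show ?thesis by simp
    qed
    then have "\<forall>t\<in>Z. (\<Sum>es\<in>exps ?n E. x (j # es) * mon hs es t) = 0" by (simp add: A_def)
    then show ?case
      using indep[unfolded alg_indep_def, THEN spec[of _ E], THEN spec[of _ "\<lambda>es. x (j # es)"]]
      by blast
  qed
  show "\<forall>es\<in>exps (length (h # hs)) E. x es = 0"
  proof
    fix es assume "es \<in> exps (length (h # hs)) E"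
    then obtain j es' where "es = j # es'" "j \<le> E" "es' \<in> exps ?n E"
      by (auto simp: exps_def length_Suc_conv)
    then show "x es = 0" using zero by blast
  qed
qed

lemma closedin_sub_iff:
  "closedin (subtopology zariski X) C \<longleftrightarrow> (\<exists>F \<subseteq> poly_funs. C = X \<inter> zero_locus F)"
  by (auto simp: closedin_subtopology closedin_zariski)

text \<open>\<open>Z\<close> is the union of the two closed subsets on which \<open>p\<close> and
  \<open>q\<close> vanish.\<close>

lemma irreducible_prime:
  assumes irr: "irreducible_closedin (subtopology zariski X) Z" and "X \<subseteq> Bil2"
    and p: "p \<in> poly_funs" and q: "q \<in> poly_funs" and pq: "\<forall>t\<in>Z. p t * q t = 0"
  shows "(\<forall>t\<in>Z. p t = 0) \<or> (\<forall>t\<in>Z. q t = 0)"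
proof -
  have cl: "closedin (subtopology zariski X) Z" using irr by (simp add: irreducible_closedin_def)
  then obtain F where F: "F \<subseteq> poly_funs" "Z = X \<inter> zero_locus F" by (auto simp: closedin_sub_iff)
  have c: "closedin (subtopology zariski X) {t \<in> Z. f t = 0}" if "f \<in> poly_funs" for f
    unfolding closedin_sub_iff using F that
    by (intro exI[of _ "insert f F"]) (auto simp: zero_locus_def)
  have "Z = {t \<in> Z. p t = 0} \<union> {t \<in> Z. q t = 0}" using pq by auto
  then have "Z = {t \<in> Z. p t = 0} \<or> Z = {t \<in> Z. q t = 0}"
    using irr c[OF p] c[OF q] unfolding irreducible_closedin_def by blast
  then show ?thesis by blast
qed

lemma chain_alg_indep:
  assumes "X \<subseteq> Bil2" "\<And>i. i \<le> n \<Longrightarrow> irreducible_closedin (subtopology zariski X) (Z i)"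
    and "\<And>i. i < n \<Longrightarrow> Z i \<subset> Z (Suc i)"
  shows "\<exists>hs. length hs = n \<and> set hs \<subseteq> poly_funs \<and> alg_indep hs (Z n)"
  using assms(2,3)
proof (induction n)
  case 0
  then have "Z 0 \<noteq> {}" by (simp add: irreducible_closedin_def)
  then show ?case by (intro exI[of _ "[]"]) (auto simp: alg_indep_def)
next
  case (Suc n)
  then obtain hs where hs: "length hs = n" "set hs \<subseteq> poly_funs" "alg_indep hs (Z n)"
    by (metis le_SucI less_SucI)
  have sub: "Z n \<subset> Z (Suc n)" using Suc.prems(2) by simp
  have irr: "irreducible_closedin (subtopology zariski X) (Z i)" if "i \<le> Suc n" for i
    using Suc.prems(1) that by blast
  obtain F where F: "F \<subseteq> poly_funs" "Z n = X \<inter> zero_locus F"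
    using irr[of n] by (auto simp: irreducible_closedin_def closedin_sub_iff)
  have "Z (Suc n) \<subseteq> X"
    using irr[of "Suc n"] by (auto simp: irreducible_closedin_def closedin_sub_iff)
  \<comment> \<open>A point of \<open>Z (Suc n)\<close> outside \<open>Z n\<close> violates one of
    the equations that cut \<open>Z n\<close> out of \<open>X\<close>; this equation is the new
    function.\<close>
  then obtain t0 h where t0: "t0 \<in> Z (Suc n)" "h \<in> F" "h t0 \<noteq> 0"
    using sub F(2) assms(1) by (auto simp: zero_locus_def)
  have "alg_indep (h # hs) (Z (Suc n))"
  proof (rule alg_indep_Cons[OF hs(3,2)])
    show "h \<in> poly_funs" using F t0 by blast
    show "Z n \<subseteq> Z (Suc n)" using sub by blast
    show "h t = 0" if "t \<in> Z n" for t using that F(2) t0(2) by (auto simp: zero_locus_def)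
    show "t0 \<in> Z (Suc n)" "h t0 \<noteq> 0" using t0 by auto
    show "(\<forall>t\<in>Z (Suc n). p t = 0) \<or> (\<forall>t\<in>Z (Suc n). q t = 0)"
      if "p \<in> poly_funs" "q \<in> poly_funs" "\<forall>t\<in>Z (Suc n). p t * q t = 0" for p q
      using irreducible_prime[OF irr assms(1) that] by simp
  qed
  then show ?case using hs F t0 by (intro exI[of _ "h # hs"]) auto
qed

section \<open>Upper bounds for orbit dimensions\<close>

text \<open>\<open>N\<close> and \<open>M\<close> are chosen before \<open>E\<close>: one power of
  the determinant serves all monomials of a box, and the degrees are linear in \<open>E\<close>. The
  count in \<open>orbit_dim_le\<close> rests on both.\<close>

lemma mon_pullback:
  assumes "Pol_family k l" "s \<in> Bil2" "set hs \<subseteq> poly_funs"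
  shows "\<exists>N M. \<forall>E. \<forall>es \<in> exps (length hs) E. \<exists>F \<in> Pol k (M * E).
    \<forall>p. det (l p) \<noteq> 0 \<longrightarrow> F p = mon hs es (act (l p) s) * det (l p) ^ (N * E)"
  using assms(3)
proof (induction hs)
  case Nil
  show ?case
    by (intro exI[of _ 0] allI ballI bexI[of _ "\<lambda>_. 1"]) (simp_all add: Pol_1)
next
  case (Cons h hs)
  have "set hs \<subseteq> poly_funs" using Cons.prems by simp
  from Cons.IH[OF this] obtain N M where IH: "\<forall>E. \<forall>es \<in> exps (length hs) E. \<exists>F \<in> Pol k (M * E).
      \<forall>p. det (l p) \<noteq> 0 \<longrightarrow> F p = mon hs es (act (l p) s) * det (l p) ^ (N * E)"
    by blast
  obtain N' M' H where H: "H \<in> Pol k M'"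
    "\<And>p. det (l p) \<noteq> 0 \<Longrightarrow> H p = h (act (l p) s) * det (l p) ^ N'"
    using poly_funs_pullback[of h, OF _ assms(1,2)] Cons.prems by auto
  have "\<exists>F \<in> Pol k ((M + M' + 2 * N') * E). \<forall>p. det (l p) \<noteq> 0 \<longrightarrow>
      F p = mon (h # hs) es (act (l p) s) * det (l p) ^ ((N + N') * E)"
    if es: "es \<in> exps (length (h # hs)) E" for E es
  proof -
    obtain e es' where e: "es = e # es'" "e \<le> E" "es' \<in> exps (length hs) E"
      using es by (auto simp: exps_def length_Suc_conv)
    obtain F where F: "F \<in> Pol k (M * E)"
      "\<And>p. det (l p) \<noteq> 0 \<Longrightarrow> F p = mon hs es' (act (l p) s) * det (l p) ^ (N * E)"
      using IH e(3) by blast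
    \<comment> \<open>The surplus factor raises the power of the determinant from
      \<open>N' * e\<close> to \<open>N' * E\<close>, the same for every exponent
      \<open>e\<close>.\<close>
    define G where "G p = H p ^ e * det (l p) ^ (N' * (E - e)) * F p" for p
    have "G \<in> Pol k (M' * e + 2 * (N' * (E - e)) + M * E)"
      unfolding G_def by (intro Pol_mult Pol_power Pol_det assms H F)
    moreover have "M' * e + 2 * (N' * (E - e)) + M * E \<le> (M + M' + 2 * N') * E"
    proof -
      have "M' * e \<le> M' * E" "2 * (N' * (E - e)) \<le> 2 * (N' * E)"
        using e(2) by (intro mult_le_mono; simp)+
      moreover have "(M + M' + 2 * N') * E = M * E + M' * E + 2 * (N' * E)"
        by (simp add: algebra_simps)
      ultimately show ?thesis by linarith
    qed
    ultimately have "G \<in> Pol k ((M + M' + 2 * N') * E)" by (rule Pol_mono)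
    moreover have "G p = mon (h # hs) es (act (l p) s) * det (l p) ^ ((N + N') * E)"
      if "det (l p) \<noteq> 0" for p
    proof -
      have "N' * e + N' * (E - e) = N' * E"
        using e(2) by (simp add: distrib_left[symmetric])
      then have "det (l p) ^ (N' * e) * det (l p) ^ (N' * (E - e)) = det (l p) ^ (N' * E)"
        by (simp only: power_add[symmetric])
      then show ?thesis
        using H(2)[OF that] F(2)[OF that]
        by (simp add: G_def e(1) power_mult_distrib power_mult[symmetric] distrib_right power_add)
    qed
    ultimately show ?thesis by blast
  qed
  then show ?case by blast
qed

text \<open>A chain longer than \<open>k\<close> would give more monomials than the pulled back
  polynomials have room for, hence a linear relation among these. Divided by the power of the
  determinant it is a relation among the monomials at all \<open>act (l p) s\<close>, by
  \<open>dense\<close> on the orbit, and so on the top of the chain, against independence.\<close>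

lemma orbit_dim_le:
  assumes s: "s \<in> Bil2" and l: "Pol_family k l"
    and dense: "\<And>f. f \<in> poly_funs \<Longrightarrow> (\<forall>p. det (l p) \<noteq> 0 \<longrightarrow> f (act (l p) s) = 0) \<Longrightarrow>
      \<forall>t \<in> orbit s. f t = 0"
  shows "orbit_dim s \<le> enat k"
  unfolding orbit_dim_def krull_dim_def
proof (rule Sup_least, clarsimp)
  fix n and Z :: "nat \<Rightarrow> strct set"
  assume Z: "\<forall>i\<le>n. irreducible_closedin (subtopology zariski (orbit s)) (Z i)"
    "\<forall>i<n. Z i \<subset> Z (Suc i)"
  show "n \<le> k"
  proof (rule ccontr)
    assume "\<not> n \<le> k"
    then have n: "k + 1 \<le> n" by simp
    obtain hs where hs: "length hs = n" "set hs \<subseteq> poly_funs" "alg_indep hs (Z n)"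
      using chain_alg_indep[OF orbit_Bil2[OF s], of n Z] Z by blast
    obtain N M where NM: "\<And>E es. es \<in> exps n E \<Longrightarrow> \<exists>F \<in> Pol k (M * E).
        \<forall>p. det (l p) \<noteq> 0 \<longrightarrow> F p = mon hs es (act (l p) s) * det (l p) ^ (N * E)"
      using mon_pullback[OF l s hs(2)] hs(1) by blast
    \<comment> \<open>With this choice \<open>((M + 1) * (E + 1)) ^ k\<close> equals
      \<open>E * (E + 1) ^ k\<close>, which is just below \<open>(E + 1) ^ (k + 1)\<close>.\<close>
    define E where "E = (M + 1) ^ k"
    from NM[of _ E] obtain F where F: "\<And>es. es \<in> exps n E \<Longrightarrow> F es \<in> Pol k (M * E)"
      "\<And>es p. es \<in> exps n E \<Longrightarrow> det (l p) \<noteq> 0 \<Longrightarrow>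
        F es p = mon hs es (act (l p) s) * det (l p) ^ (N * E)"
      by metis
    have "(M * E + 1) ^ k \<le> ((M + 1) * (E + 1)) ^ k"
      by (rule power_mono) (simp_all add: algebra_simps)
    also have "\<dots> = E * (E + 1) ^ k" by (simp only: power_mult_distrib E_def)
    also have "\<dots> < (E + 1) ^ (k + 1)" by simp
    also have "\<dots> \<le> (E + 1) ^ n" using n by (intro power_increasing) auto
    finally have "(M * E + 1) ^ k < card (exps n E)" by (simp add: card_exps)
    then obtain x where x: "\<exists>es\<in>exps n E. x es \<noteq> 0" "\<And>p. (\<Sum>es\<in>exps n E. x es * F es p) = 0"
      using Pol_dependent[of "exps n E" F k "M * E"] F(1) finite_exps by blast
    let ?G = "\<lambda>t. \<Sum>es\<in>exps n E. x es * mon hs es t"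
    have "?G (act (l p) s) = 0" if "det (l p) \<noteq> 0" for p
    proof -
      have "?G (act (l p) s) * det (l p) ^ (N * E) = (\<Sum>es\<in>exps n E. x es * F es p)"
        using F(2) that by (simp add: sum_distrib_right mult.assoc)
      then show ?thesis using x(2) that by simp
    qed
    moreover have "?G \<in> poly_funs"
      using hs(2) by (intro poly_funs_sum poly_funs.mult poly_funs.const poly_funs_mon)
    ultimately have "\<forall>t \<in> orbit s. ?G t = 0" by (intro dense) auto
    moreover have "Z n \<subseteq> orbit s"
      using Z(1) by (auto simp: irreducible_closedin_def closedin_sub_iff)
    ultimately have "\<forall>es\<in>exps n E. x es = 0"
      using hs(1,3) unfolding alg_indep_def by blast
    then show False using x(1) by blast
  qed
qed

text \<open>Varying the single entry \<open>g$i$j\<close> moves \<open>g\<close> along a line on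
  which almost all matrices are invertible with nonzero entry there. A polynomial on that line
  vanishing at almost all points also vanishes at \<open>g\<close>.\<close>

lemma vanishes_on_orbit:
  assumes s: "s \<in> Bil2" and f: "f \<in> poly_funs"
    and van: "\<And>g. invertible g \<Longrightarrow> g$i$j \<noteq> 0 \<Longrightarrow> f (act g s) = 0"
    and g: "invertible g"
  shows "f (act g s) = 0"
proof -
  define L :: "(nat \<Rightarrow> complex) \<Rightarrow> complex^2^2"
    where "L c = (\<chi> a b. g$a$b + (if a = i \<and> b = j then c 0 else 0))" for c
  have fam: "Pol_family 1 L"
    unfolding Pol_family_def
  proof (intro allI)
    fix a b show "(\<lambda>p. L p $ a $ b) \<in> Pol 1 1"
      unfolding L_def
      by (cases "a = i \<and> b = j") (auto simp del: One_nat_def intro!: Pol_add Pol_const Pol_var)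
  qed
  have L0: "L (\<lambda>_. 0) = g" by (simp add: L_def vec_eq_iff)
  obtain N M F where F: "F \<in> Pol 1 M"
    "\<And>c. det (L c) \<noteq> 0 \<Longrightarrow> F c = f (act (L c) s) * det (L c) ^ N"
    using poly_funs_pullback[OF f fam s] by blast
  obtain P where P: "\<And>c. F c = poly P (c 0)" using Pol_1_poly[OF F(1)] by blast
  obtain D where D: "\<And>c. det (L c) = poly D (c 0)" using Pol_1_poly[OF Pol_det[OF fam]] by blast
  \<comment> \<open>The factors \<open>poly D c\<close> and \<open>g$i$j + c\<close> absorb the
    values of \<open>c\<close> at which \<open>van\<close> says nothing. Neither is the zero
    polynomial, so \<open>P\<close> is.\<close>
  have "poly P c * poly D c * (g$i$j + c) = 0" for c
  proof (cases "poly D c = 0 \<or> g$i$j + c = 0")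
    case False
    then have "det (L (\<lambda>_. c)) \<noteq> 0" "L (\<lambda>_. c) $i$j \<noteq> 0"
      using D[of "\<lambda>_. c"] by (simp_all add: L_def)
    then have "F (\<lambda>_. c) = 0" using F(2)[of "\<lambda>_. c"] van by (simp add: invertible_det_nz)
    then show ?thesis using P[of "\<lambda>_. c"] by simp
  qed auto
  then have "poly (P * D * [:g$i$j, 1:]) c = 0" for c by (simp add: algebra_simps)
  then have "P * D * [:g$i$j, 1:] = 0" using poly_all_0_iff_0 by blast
  moreover have "D \<noteq> 0" using D[of "\<lambda>_. 0"] g L0 by (auto simp: invertible_det_nz)
  ultimately have "P = 0" by (simp only: mult_eq_0_iff pCons_eq_0_iff) simp
  then show ?thesis
    using F(2)[of "\<lambda>_. 0"] P[of "\<lambda>_. 0"] L0 g by (simp add: invertible_det_nz)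
qed

definition automorphism :: "complex ^ 2 ^ 2 \<Rightarrow> strct \<Rightarrow> bool" where
  "automorphism h s \<longleftrightarrow> invertible h \<and> (\<forall>x y. h *v fst s x y = fst s (h *v x) (h *v y)) \<and>
     (\<forall>x y. h *v snd s x y = snd s (h *v x) (h *v y))"

text \<open>The matrices \<open>l p\<close> represent the cosets of the stabilizer in a dense open subset of GL(V).\<close>

lemma orbit_dim_le_slice:
  fixes l :: "(nat \<Rightarrow> complex) \<Rightarrow> complex ^ 2 ^ 2"
  assumes s: "s \<in> Bil2" and fam: "Pol_family k l"
    and slice: "\<And>g. det g \<noteq> 0 \<Longrightarrow> g$i$j \<noteq> 0 \<Longrightarrow> \<exists>p h. automorphism h s \<and> g = l p ** h"
  shows "orbit_dim s \<le> enat k"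
proof (rule orbit_dim_le[OF s fam])
  fix f assume f: "f \<in> poly_funs" "\<forall>p. det (l p) \<noteq> 0 \<longrightarrow> f (act (l p) s) = 0"
  have "f (act g s) = 0" if g: "invertible g" "g$i$j \<noteq> 0" for g
  proof -
    have d: "det g \<noteq> 0" using g by (simp add: invertible_det_nz)
    obtain p h where h: "automorphism h s" "g = l p ** h" using slice[OF d g(2)] by blast
    have inv: "invertible h" using h(1) by (simp add: automorphism_def)
    have l: "det (l p) \<noteq> 0" using d h(2) by (auto simp: det_mul)
    have "act h s = s" using h(1) by (intro act_eqI) (auto simp: automorphism_def)
    then have "act g s = act (l p) s"
      using act_act[of "l p" h s] inv l h(2) by (simp add: invertible_det_nz)
    then show ?thesis using f(2) l by simp
  qed
  then have "f (act g s) = 0" if "invertible g" for g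
    using vanishes_on_orbit[OF s f(1) _ that] by blast
  then show "\<forall>t \<in> orbit s. f t = 0" by (auto simp: orbit_def)
qed

section \<open>Lower bounds for orbit dimensions\<close>

definition closure_in_orbit :: "(complex ^ 2 ^ 2) set \<Rightarrow> strct \<Rightarrow> strct set" where
  "closure_in_orbit L s = {t \<in> orbit s. \<forall>f \<in> poly_funs.
     (\<forall>g \<in> L. invertible g \<longrightarrow> f (act g s) = 0) \<longrightarrow> f t = 0}"

text \<open>Two points of \<open>L\<close> are joined by a line in \<open>L\<close>, and polynomials restricted to a line have no
  zero divisors.\<close>

lemma irreducible_closure_in_orbit:
  assumes s: "s \<in> Bil2"
    and aff: "\<And>g h c. g \<in> L \<Longrightarrow> h \<in> L \<Longrightarrow> (\<chi> i j. g$i$j + c * (h$i$j - g$i$j)) \<in> L"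
    and g0: "g0 \<in> L" "invertible g0"
  shows "irreducible_closedin (subtopology zariski (orbit s)) (closure_in_orbit L s)"
  unfolding irreducible_closedin_def
proof (intro conjI allI impI)
  let ?Z = "closure_in_orbit L s"
  have in_Z: "act g s \<in> ?Z" if "g \<in> L" "invertible g" for g
    using that by (auto simp: closure_in_orbit_def orbit_def)
  show "closedin (subtopology zariski (orbit s)) ?Z"
    unfolding closedin_sub_iff
    using orbit_Bil2[OF s]
    by (intro exI[of _ "{f \<in> poly_funs. \<forall>g \<in> L. invertible g \<longrightarrow> f (act g s) = 0}"])
      (auto simp: closure_in_orbit_def zero_locus_def)
  show "?Z \<noteq> {}" using in_Z[OF g0] by blast
  fix A B
  assume AB: "closedin (subtopology zariski (orbit s)) A \<and>
    closedin (subtopology zariski (orbit s)) B \<and> ?Z = A \<union> B"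
  have point: "\<exists>f \<in> poly_funs. \<exists>g \<in> L. (\<forall>t \<in> C. f t = 0) \<and> invertible g \<and> f (act g s) \<noteq> 0"
    if C: "closedin (subtopology zariski (orbit s)) C" "C \<subseteq> ?Z" "?Z \<noteq> C" for C
  proof -
    obtain F where F: "F \<subseteq> poly_funs" "C = orbit s \<inter> zero_locus F"
      using C(1) by (auto simp: closedin_sub_iff)
    obtain t where t: "t \<in> ?Z" "t \<notin> C" using C(2,3) by blast
    then have "t \<in> orbit s" by (simp add: closure_in_orbit_def)
    then obtain f where f: "f \<in> F" "f t \<noteq> 0"
      using t(2) F(2) orbit_Bil2[OF s] by (auto simp: zero_locus_def)
    then obtain g where "g \<in> L" "invertible g" "f (act g s) \<noteq> 0"
      using t(1) F(1) unfolding closure_in_orbit_def by blast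
    moreover have "\<forall>t \<in> C. f t = 0" using F(2) f(1) by (auto simp: zero_locus_def)
    ultimately show ?thesis using F(1) f(1) by blast
  qed
  show "?Z = A \<or> ?Z = B"
  proof (rule ccontr)
    assume "\<not> (?Z = A \<or> ?Z = B)"
    then obtain f g f' g' where f: "f \<in> poly_funs" "g \<in> L" "\<forall>t
      \<in> A. f t = 0" "invertible g" "f (act g s) \<noteq> 0"
      and f': "f' \<in> poly_funs" "g' \<in> L" "\<forall>t \<in> B. f' t = 0" "invertible g'" "f' (act g' s) \<noteq> 0"
      using point[of A] point[of B] AB by blast
    define l :: "(nat \<Rightarrow> complex) \<Rightarrow> complex^2^2"
      where "l c = (\<chi> i j. g$i$j + c 0 * (g'$i$j - g$i$j))" for c
    have fam: "Pol_family 1 l"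
      unfolding Pol_family_def l_def
      by (auto intro!: Pol_add Pol_const Pol_var Pol_scale
          simp: mult.commute[of _ "_ - _"] simp del: One_nat_def)
    have l01: "l (\<lambda>_. 0) = g" "l (\<lambda>_. 1) = g'" by (simp_all add: l_def vec_eq_iff)
    obtain N M F where F: "F \<in> Pol 1 M"
      "\<And>c. det (l c) \<noteq> 0 \<Longrightarrow> F c = f (act (l c) s) * det (l c) ^ N"
      using poly_funs_pullback[OF f(1) fam s] by blast
    obtain N' M' F' where F': "F' \<in> Pol 1 M'"
      "\<And>c. det (l c) \<noteq> 0 \<Longrightarrow> F' c = f' (act (l c) s) * det (l c) ^ N'"
      using poly_funs_pullback[OF f'(1) fam s] by blast
    obtain P where P: "\<And>c. F c = poly P (c 0)" using Pol_1_poly[OF F(1)] by blast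
    obtain P' where P': "\<And>c. F' c = poly P' (c 0)" using Pol_1_poly[OF F'(1)] by blast
    obtain D where D: "\<And>c. det (l c) = poly D (c 0)" using Pol_1_poly[OF Pol_det[OF fam]] by blast
    have "poly P 0 \<noteq> 0" using F(2)[of "\<lambda>_. 0"] P[of "\<lambda>_. 0"] f l01 by (simp add: invertible_det_nz)
    moreover have "poly P' 1 \<noteq> 0"
      using F'(2)[of "\<lambda>_. 1"] P'[of "\<lambda>_. 1"] f' l01 by (simp add: invertible_det_nz)
    moreover have "poly D 0 \<noteq> 0" using D[of "\<lambda>_. 0"] f l01 by (simp add: invertible_det_nz)
    \<comment> \<open>\<open>P\<close> and \<open>D\<close> are nonzero at the end \<open>g\<close>
      of the line, \<open>P'\<close> at the end \<open>g'\<close>. A parameter at which all three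
      are nonzero gives an invertible matrix in \<open>L\<close> whose image lies neither in
      \<open>A\<close> nor in \<open>B\<close>.\<close>
    ultimately have "P * P' * D \<noteq> 0" by auto
    then obtain c where "poly (P * P' * D) c \<noteq> 0" using poly_all_0_iff_0 by blast
    then have c: "poly P c \<noteq> 0" "poly P' c \<noteq> 0" "poly D c \<noteq> 0" by auto
    let ?g = "l (\<lambda>_. c)"
    have det: "det ?g \<noteq> 0" using c(3) D[of "\<lambda>_. c"] by simp
    have "?g \<in> L" unfolding l_def using aff f(2) f'(2) by blast
    then have "act ?g s \<in> A \<union> B" using in_Z det AB by (simp add: invertible_det_nz)
    then have "f (act ?g s) = 0 \<or> f' (act ?g s) = 0" using f(3) f'(3) by blast
    then show False
      using F(2)[OF det] F'(2)[OF det] P[of "\<lambda>_. c"] P'[of "\<lambda>_. c"] c by auto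
  qed
qed

text \<open>\<open>(a, b, c, d)\<close> are the stages at which the four entries of the matrix become free.\<close>

fun stage :: "nat \<times> nat \<times> nat \<times> nat \<Rightarrow> nat \<Rightarrow> (complex ^ 2 ^ 2) set" where
  "stage (a, b, c, d) i = {g. (i < a \<longrightarrow> g$1$1 = 1) \<and> (i < b \<longrightarrow> g$1$2 = 0) \<and>
     (i < c \<longrightarrow> g$2$1 = 0) \<and> (i < d \<longrightarrow> g$2$2 = 1)}"

text \<open>A function vanishing on the image of one stage but not on that of the next makes the
  inclusion of closures strict; \<open>k\<close> inclusions involve the stages 0 to
  \<open>k\<close>. The identity matrix lies in every stage, so no closure is empty.\<close>

lemma orbit_dim_ge:
  fixes r :: "nat \<times> nat \<times> nat \<times> nat"
  defines "L \<equiv> stage r"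
  assumes s: "s \<in> Bil2"
    and sep: "\<And>i. i < k \<Longrightarrow> \<exists>f \<in> poly_funs. (\<forall>g \<in> L i. invertible g \<longrightarrow> f (act g s) = 0) \<and>
      (\<exists>g \<in> L (Suc i). invertible g \<and> f (act g s) \<noteq> 0)"
  shows "enat k \<le> orbit_dim s"
proof -
  obtain a b c d where r: "r = (a, b, c, d)" by (cases r)
  let ?Z = "\<lambda>i. closure_in_orbit (L i) s"
  have "irreducible_closedin (subtopology zariski (orbit s)) (?Z i)" for i
  proof (rule irreducible_closure_in_orbit[OF s])
    show "mat2 1 0 0 1 \<in> L i" "invertible (mat2 1 0 0 1)" by (simp_all add: L_def r)
  qed (auto simp: L_def r)
  moreover have "?Z i \<subset> ?Z (Suc i)" if i: "i < k" for i
  proof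
    have "L i \<subseteq> L (Suc i)" by (auto simp: L_def r)
    then show "?Z i \<subseteq> ?Z (Suc i)" unfolding closure_in_orbit_def by blast
    obtain f g where f: "f \<in> poly_funs" "\<forall>g \<in> L i. invertible g \<longrightarrow> f (act g s) = 0"
      "g \<in> L (Suc i)" "invertible g" "f (act g s) \<noteq> 0"
      using sep[OF i] by blast
    have "act g s \<in> ?Z (Suc i)" using f(3,4) by (auto simp: closure_in_orbit_def orbit_def)
    moreover have "act g s \<notin> ?Z i" using f unfolding closure_in_orbit_def by blast
    ultimately show "?Z i \<noteq> ?Z (Suc i)" by blast
  qed
  ultimately have "\<exists>Z :: nat \<Rightarrow> strct set.
      (\<forall>i\<le>k. irreducible_closedin (subtopology zariski (orbit s)) (Z i)) \<and> (\<forall>i<k. Z i \<subset> Z (Suc i))"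
    by (intro exI[of _ ?Z]) blast
  then show ?thesis unfolding orbit_dim_def krull_dim_def by (intro Sup_upper) blast
qed

section \<open>The orbit dimensions\<close>

lemma orbit_dim_eqI:
  "orbit_dim s \<le> enat (numeral m) \<Longrightarrow> enat (numeral m) \<le> orbit_dim s \<Longrightarrow> orbit_dim s = numeral m"
  by (simp add: numeral_eq_enat)

lemma mat2_mult:
  "mat2 p q r u ** mat2 p' q' r' u' =
    mat2 (p * p' + q * r') (p * q' + q * u') (r * p' + u * r') (r * q' + u * u')"
  by (simp add: vec_eq_iff forall_2 matrix_matrix_mult_def sum_2)

lemmas automorphism_simps =
  automorphism_def strct_of_def vec_eq_2 matrix_vector_2 table_nth algebra_simps power2_eq_square

section \<open>Upper bounds from groups of automorphisms\<close>

lemma orbit_dim_le_4: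
  assumes "s \<in> Bil2"
  shows "orbit_dim s \<le> enat 4"
proof (rule orbit_dim_le_slice[OF assms, where l = "\<lambda>p. mat2 (p 0) (p 1) (p 2) (p 3)"])
  show "Pol_family 4 (\<lambda>p. mat2 (p 0) (p 1) (p 2) (p 3))"
    by (intro Pol_family_mat2 Pol_var) auto
  fix g :: "complex^2^2"
  have "automorphism (mat 1) s" by (auto simp: automorphism_def invertible_det_nz)
  then show "\<exists>(p :: nat \<Rightarrow> complex) h. automorphism h s \<and> g = mat2 (p 0) (p 1) (p 2) (p 3) ** h"
    by (intro exI[of _ "\<lambda>i :: nat. if i = 0 then g$1$1
        else if i = 1 then g$1$2 else if i = 2 then g$2$1 else g$2$2"]
        exI[of _ "mat 1"]) (simp add: mat2_eta)
qed

text \<open>Right multiplication by an automorphism is a column operation on \<open>g\<close> that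
  leaves \<open>act g s\<close> unchanged. Here the second column can be rescaled, which normalizes
  \<open>g$2$2\<close> to 1 where it is nonzero.\<close>

lemma orbit_dim_le_3_diag2:
  assumes "s \<in> Bil2" "\<And>v. v \<noteq> 0 \<Longrightarrow> automorphism (mat2 1 0 0 v) s"
  shows "orbit_dim s \<le> enat 3"
proof (rule orbit_dim_le_slice[OF assms(1), where l = "\<lambda>p. mat2 (p 0) (p 1) (p 2) 1"])
  show "Pol_family 3 (\<lambda>p. mat2 (p 0) (p 1) (p 2) 1)"
    by (intro Pol_family_mat2 Pol_var Pol_const) auto
  fix g :: "complex^2^2" assume g: "g$2$2 \<noteq> 0"
  show "\<exists>(p :: nat \<Rightarrow> complex) h. automorphism h s \<and> g = mat2 (p 0) (p 1) (p 2) 1 ** h"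
    by (intro exI[of _ "\<lambda>i :: nat. if i = 0 then g$1$1
        else if i = 1 then g$1$2 / g$2$2 else g$2$1"]
        exI[of _ "mat2 1 0 0 (g$2$2)"])
      (use g assms(2) in \<open>simp add: mat2_mult mat2_eta\<close>)
qed

lemma orbit_dim_le_3_diag1:
  assumes "s \<in> Bil2" "\<And>v. v \<noteq> 0 \<Longrightarrow> automorphism (mat2 v 0 0 1) s"
  shows "orbit_dim s \<le> enat 3"
proof (rule orbit_dim_le_slice[OF assms(1), where l = "\<lambda>p. mat2 1 (p 0) (p 1) (p 2)"])
  show "Pol_family 3 (\<lambda>p. mat2 1 (p 0) (p 1) (p 2))"
    by (intro Pol_family_mat2 Pol_var Pol_const) auto
  fix g :: "complex^2^2" assume g: "g$1$1 \<noteq> 0"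
  show "\<exists>(p :: nat \<Rightarrow> complex) h. automorphism h s \<and> g = mat2 1 (p 0) (p 1) (p 2) ** h"
    by (intro exI[of _ "\<lambda>i :: nat. if i = 0 then g$1$2
        else if i = 1 then g$2$1 / g$1$1 else g$2$2"]
        exI[of _ "mat2 (g$1$1) 0 0 1"])
      (use g assms(2) in \<open>simp add: mat2_mult mat2_eta\<close>)
qed

text \<open>Adding multiples of the first column to the second clears \<open>g$1$2\<close> where
  \<open>g$1$1\<close> is nonzero.\<close>

lemma orbit_dim_le_3_upper:
  assumes "s \<in> Bil2" "\<And>v. automorphism (mat2 1 v 0 1) s"
  shows "orbit_dim s \<le> enat 3"
proof (rule orbit_dim_le_slice[OF assms(1), where l = "\<lambda>p. mat2 (p 0) 0 (p 1) (p 2)"])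
  show "Pol_family 3 (\<lambda>p. mat2 (p 0) 0 (p 1) (p 2))"
    by (intro Pol_family_mat2 Pol_var Pol_const) auto
  fix g :: "complex^2^2" assume g: "g$1$1 \<noteq> 0"
  show "\<exists>(p :: nat \<Rightarrow> complex) h. automorphism h s \<and> g = mat2 (p 0) 0 (p 1) (p 2) ** h"
    by (intro exI[of _ "\<lambda>i :: nat. if i = 0 then g$1$1
        else if i = 1 then g$2$1 else g$2$2 - g$2$1 * (g$1$2 / g$1$1)"]
        exI[of _ "mat2 1 (g$1$2 / g$1$1) 0 1"])
      (use g assms(2) in \<open>simp add: mat2_mult mat2_eta\<close>)
qed

lemma orbit_dim_le_3_lower:
  assumes "s \<in> Bil2" "\<And>v. automorphism (mat2 1 0 v 1) s"
  shows "orbit_dim s \<le> enat 3"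
proof (rule orbit_dim_le_slice[OF assms(1), where l = "\<lambda>p. mat2 (p 0) (p 1) 0 (p 2)"])
  show "Pol_family 3 (\<lambda>p. mat2 (p 0) (p 1) 0 (p 2))"
    by (intro Pol_family_mat2 Pol_var Pol_const) auto
  fix g :: "complex^2^2" assume g: "g$2$2 \<noteq> 0"
  show "\<exists>(p :: nat \<Rightarrow> complex) h. automorphism h s \<and> g = mat2 (p 0) (p 1) 0 (p 2) ** h"
    by (intro exI[of _ "\<lambda>i :: nat. if i = 0 then g$1$1 - g$1$2 * (g$2$1 / g$2$2)
        else if i = 1 then g$1$2 else g$2$2"]
        exI[of _ "mat2 1 0 (g$2$1 / g$2$2) 1"])
      (use g assms(2) in \<open>simp add: mat2_mult mat2_eta\<close>)
qed

text \<open>Column operations by these automorphisms turn the first row into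
  \<open>(1, 0)\<close>.\<close>

lemma orbit_dim_le_2_affine:
  assumes "s \<in> Bil2" "\<And>v w. v \<noteq> 0 \<Longrightarrow> automorphism (mat2 v w 0 1) s"
  shows "orbit_dim s \<le> enat 2"
proof (rule orbit_dim_le_slice[OF assms(1), where l = "\<lambda>p. mat2 1 0 (p 0) (p 1)"])
  show "Pol_family 2 (\<lambda>p. mat2 1 0 (p 0) (p 1))"
    by (intro Pol_family_mat2 Pol_var Pol_const) auto
  fix g :: "complex^2^2" assume g: "g$1$1 \<noteq> 0"
  show "\<exists>(p :: nat \<Rightarrow> complex) h. automorphism h s \<and> g = mat2 1 0 (p 0) (p 1) ** h"
    by (intro exI[of _ "\<lambda>i :: nat. if i = 0 then g$2$1 / g$1$1 else g$2$2 - g$2$1 / g$1$1 * g$1$2"]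
        exI[of _ "mat2 (g$1$1) (g$1$2) 0 1"])
      (use g assms(2) in \<open>simp add: mat2_mult mat2_eta\<close>)
qed

lemma orbit_dim_le_2_weighted:
  assumes "s \<in> Bil2" "\<And>v w. v \<noteq> 0 \<Longrightarrow> automorphism (mat2 v 0 w (v^2)) s"
  shows "orbit_dim s \<le> enat 2"
proof (rule orbit_dim_le_slice[OF assms(1), where l = "\<lambda>p. mat2 1 (p 0) 0 (p 1)"])
  show "Pol_family 2 (\<lambda>p. mat2 1 (p 0) 0 (p 1))"
    by (intro Pol_family_mat2 Pol_var Pol_const) auto
  fix g :: "complex^2^2" assume g: "det g \<noteq> 0" "g$2$2 \<noteq> 0"
  \<comment> \<open>This value is forced: if \<open>y\<close> is the lower right entry of the slice,
    then \<open>det g = y * v^3\<close> and \<open>g$2$2 = y * v^2\<close>.\<close>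
  define v where "v = det g / g$2$2"
  have v: "v \<noteq> 0" using g by (simp add: v_def)
  have "v + g$1$2 * (g$2$1 / g$2$2) = g$1$1" using g(2) by (simp add: v_def det_2 field_simps)
  then have "mat2 1 (g$1$2 / v^2) 0 (g$2$2 / v^2) ** mat2 v 0 (v^2 * (g$2$1 / g$2$2)) (v^2) = g"
    using v g(2) by (simp add: mat2_mult vec_eq_iff forall_2)
  then show "\<exists>(p :: nat \<Rightarrow> complex) h. automorphism h s \<and> g = mat2 1 (p 0) 0 (p 1) ** h"
    by (intro exI[of _ "\<lambda>i :: nat. if i = 0 then g$1$2 / v^2 else g$2$2 / v^2"]
        exI[of _ "mat2 v 0 (v^2 * (g$2$1 / g$2$2)) (v^2)"])
      (use assms(2)[OF v] in simp)
qed

text \<open>One strict inclusion of a chain with its witnesses as explicit arguments, so that a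
  chain can be written down by instantiation.\<close>

definition separates ::
    "nat \<times> nat \<times> nat \<times> nat \<Rightarrow> strct \<Rightarrow> nat \<Rightarrow> (strct \<Rightarrow> complex) \<Rightarrow> complex ^ 2 ^ 2 \<Rightarrow> bool" where
  "separates r s i f h \<longleftrightarrow> f \<in> poly_funs \<and>
     (\<forall>g \<in> stage r i. invertible g \<longrightarrow> f (act g s) = 0) \<and>
     h \<in> stage r (Suc i) \<and> invertible h \<and> f (act h s) \<noteq> 0"

lemma orbit_dim_ge_2:
  assumes "s \<in> Bil2" "separates r s 0 fa ga" "separates r s 1 fb gb"
  shows "enat 2 \<le> orbit_dim s"
  by (rule orbit_dim_ge[OF assms(1), of _ r])
    (use assms in \<open>auto simp: separates_def less_Suc_eq numeral_2_eq_2\<close>)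

lemma orbit_dim_ge_3:
  assumes "s \<in> Bil2" "separates r s 0 fa ga" "separates r s 1 fb gb" "separates r s 2 fc gc"
  shows "enat 3 \<le> orbit_dim s"
  by (rule orbit_dim_ge[OF assms(1), of _ r])
    (use assms in \<open>auto simp: separates_def less_Suc_eq numeral_2_eq_2 numeral_3_eq_3\<close>)

lemma orbit_dim_ge_4:
  assumes "s \<in> Bil2" "separates r s 0 fa ga" "separates r s 1 fb gb" "separates r s 2 fc gc"
    "separates r s 3 fd gd"
  shows "enat 4 \<le> orbit_dim s"
proof (rule orbit_dim_ge[OF assms(1), of _ r])
  fix i :: nat assume "i < 4"
  then consider "i = 0" | "i = 1" | "i = 2" | "i = 3" by linarith
  then show "\<exists>f \<in> poly_funs. (\<forall>g \<in> stage r i. invertible g \<longrightarrow> f (act g s) = 0) \<and>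
      (\<exists>g \<in> stage r (Suc i). invertible g \<and> f (act g s) \<noteq> 0)"
    by cases (use assms in \<open>auto simp: separates_def\<close>)
qed

lemma poly_funs_diff:
  assumes "f \<in> poly_funs" "g \<in> poly_funs"
  shows "(\<lambda>s. f s - g s) \<in> poly_funs"
  using poly_funs.add[OF assms(1) poly_funs.mult[OF poly_funs.const[of "- 1"] assms(2)]] by simp

lemmas separator_simps =
  separates_def act_def matrix_inv_2 strct_of_def matrix_vector_2 table_nth det_2
    invertible_det_nz field_simps

lemmas poly_fun_intros =
  poly_funs.const poly_funs.add poly_funs_diff poly_funs.coord_fst poly_funs.coord_snd

lemma orbit_dim_C8: "orbit_dim (strct_of C8) = 0"
proof -
  have "orbit_dim (strct_of C8) \<le> enat 0"
  proof (rule orbit_dim_le_slice[OF strct_of_Bil2, where l = "\<lambda>p. mat2 1 0 0 1"])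
    show "Pol_family 0 (\<lambda>p. mat2 1 0 0 1)" by (intro Pol_family_mat2 Pol_const)
    fix g :: "complex^2^2" assume "det g \<noteq> 0"
    then have "automorphism g (strct_of C8)"
      by (simp add: automorphism_simps invertible_det_nz)
    then show "\<exists>(p :: nat \<Rightarrow> complex) h. automorphism h (strct_of C8) \<and> g = mat2 1 0 0 1 ** h"
      by (intro exI[of _ "\<lambda>_. 0"] exI[of _ g]) (simp
        add: vec_eq_iff forall_2 matrix_matrix_mult_def sum_2)
  qed
  then show ?thesis by (simp add: zero_enat_def[symmetric])
qed

section \<open>Orbits of dimension 4\<close>

text \<open>The stages are the identity, the scalings of \<open>e2\<close>, the diagonal, the upper
  triangular and all matrices. Each separating function compares a structure constant with the value
  it keeps throughout one stage and loses in the next.\<close>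

lemma orbit_dim_A01:
  "orbit_dim (strct_of A01) = 4"
proof (rule orbit_dim_eqI)
  show "orbit_dim (strct_of A01) \<le> enat 4"
    by (rule orbit_dim_le_4[OF strct_of_Bil2])
  show "enat 4 \<le> orbit_dim (strct_of A01)"
    by (rule orbit_dim_ge_4[OF strct_of_Bil2, where r = "(2, 3, 4, 1)"
        and fa = "\<lambda>t. snd t e2 e2 $ 2 - 1" and ga = "mat2 1 0 0 2"
        and fb = "\<lambda>t. snd t e1 e1 $ 1 - 1" and gb = "mat2 2 0 0 1"
        and fc = "\<lambda>t. snd t e1 e2 $ 1" and gc = "mat2 1 1 0 1"
        and fd = "\<lambda>t. snd t e1 e1 $ 2" and gd = "mat2 1 0 1 1"])
      (auto simp: separator_simps intro!: poly_fun_intros)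
qed

lemma orbit_dim_A10:
  "orbit_dim (strct_of (A10 \<delta> \<epsilon>)) = 4"
proof (rule orbit_dim_eqI)
  show "orbit_dim (strct_of (A10 \<delta> \<epsilon>)) \<le> enat 4"
    by (rule orbit_dim_le_4[OF strct_of_Bil2])
  show "enat 4 \<le> orbit_dim (strct_of (A10 \<delta> \<epsilon>))"
    by (rule orbit_dim_ge_4[OF strct_of_Bil2, where r = "(2, 3, 4, 1)"
        and fa = "\<lambda>t. fst t e2 e2 $ 2 - 1" and ga = "mat2 1 0 0 2"
        and fb = "\<lambda>t. fst t e1 e1 $ 1 - 1" and gb = "mat2 2 0 0 1"
        and fc = "\<lambda>t. fst t e1 e2 $ 1" and gc = "mat2 1 1 0 1"
        and fd = "\<lambda>t. fst t e1 e1 $ 2" and gd = "mat2 1 0 1 1"])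
      (auto simp: separator_simps intro!: poly_fun_intros)
qed

lemma orbit_dim_A13:
  "orbit_dim (strct_of (A13 \<delta>)) = 4"
proof (rule orbit_dim_eqI)
  show "orbit_dim (strct_of (A13 \<delta>)) \<le> enat 4"
    by (rule orbit_dim_le_4[OF strct_of_Bil2])
  show "enat 4 \<le> orbit_dim (strct_of (A13 \<delta>))"
    by (rule orbit_dim_ge_4[OF strct_of_Bil2, where r = "(2, 3, 4, 1)"
        and fa = "\<lambda>t. snd t e2 e2 $ 2 - 1" and ga = "mat2 1 0 0 2"
        and fb = "\<lambda>t. fst t e1 e1 $ 1 - 1" and gb = "mat2 2 0 0 1"
        and fc = "\<lambda>t. fst t e1 e2 $ 1" and gc = "mat2 1 1 0 1"
        and fd = "\<lambda>t. fst t e1 e1 $ 2" and gd = "mat2 1 0 1 1"])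
      (auto simp: separator_simps intro!: poly_fun_intros)
qed

text \<open>\<open>fd\<close> is the trace of the left multiplication by \<open>e1\<close>. Up to
  sign it is the second coordinate of \<open>matrix_inv g *v e1\<close>, which is 0 as long as
  \<open>g\<close> is upper triangular.\<close>

lemma orbit_dim_A05:
  "orbit_dim (strct_of A05) = 4"
proof (rule orbit_dim_eqI)
  show "orbit_dim (strct_of A05) \<le> enat 4"
    by (rule orbit_dim_le_4[OF strct_of_Bil2])
  show "enat 4 \<le> orbit_dim (strct_of A05)"
    by (rule orbit_dim_ge_4[OF strct_of_Bil2, where r = "(1, 3, 4, 2)"
        and fa = "\<lambda>t. snd t e1 e1 $ 2 + 1" and ga = "mat2 2 0 0 1"
        and fb = "\<lambda>t. snd t e2 e1 $ 1 + 1" and gb = "mat2 1 0 0 2"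
        and fc = "\<lambda>t. snd t e2 e2 $ 2" and gc = "mat2 1 1 0 1"
        and fd = "\<lambda>t. snd t e1 e1 $ 1 + snd t e1 e2 $ 2" and gd = "mat2 1 0 1 1"])
      (auto simp: separator_simps intro!: poly_fun_intros)
qed

lemma orbit_dim_A11:
  "orbit_dim (strct_of (A11 \<delta> \<epsilon>)) = 4"
proof (rule orbit_dim_eqI)
  show "orbit_dim (strct_of (A11 \<delta> \<epsilon>)) \<le> enat 4"
    by (rule orbit_dim_le_4[OF strct_of_Bil2])
  show "enat 4 \<le> orbit_dim (strct_of (A11 \<delta> \<epsilon>))"
    by (rule orbit_dim_ge_4[OF strct_of_Bil2, where r = "(2, 4, 3, 1)"
        and fa = "\<lambda>t. snd t e1 e1 $ 2 - 1" and ga = "mat2 1 0 0 2"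
        and fb = "\<lambda>t. fst t e1 e1 $ 1 - 1" and gb = "mat2 2 0 0 1"
        and fc = "\<lambda>t. fst t e1 e1 $ 2" and gc = "mat2 1 0 1 1"
        and fd = "\<lambda>t. fst t e2 e2 $ 1" and gd = "mat2 1 1 0 1"])
      (auto simp: separator_simps intro!: poly_fun_intros)
qed

text \<open>\<open>fb\<close> tests the trace of the right multiplication by \<open>e1\<close>,
  which is \<open>(2 - \<delta>) + \<delta> = 2\<close> and therefore always changes when
  \<open>e1\<close> is scaled. At the shear \<open>mat2 1 0 1 1\<close> the function
  \<open>fc\<close> has the value \<open>1 - 2 * \<delta>\<close>; this is where
  \<open>\<delta> \<noteq> 1/2\<close> enters.\<close>

lemma orbit_dim_A15:
  assumes "\<delta> \<noteq> 1/2"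
  shows "orbit_dim (strct_of (A15 \<delta>)) = 4"
proof (rule orbit_dim_eqI)
  show "orbit_dim (strct_of (A15 \<delta>)) \<le> enat 4"
    by (rule orbit_dim_le_4[OF strct_of_Bil2])
  show "enat 4 \<le> orbit_dim (strct_of (A15 \<delta>))"
    by (rule orbit_dim_ge_4[OF strct_of_Bil2, where r = "(2, 4, 3, 1)"
        and fa = "\<lambda>t. fst t e1 e1 $ 2 - 1" and ga = "mat2 1 0 0 2"
        and fb = "\<lambda>t. snd t e1 e1 $ 1 + snd t e2 e1 $ 2 - 2" and gb = "mat2 2 0 0 1"
        and fc = "\<lambda>t. snd t e1 e1 $ 2" and gc = "mat2 1 0 1 1"
        and fd = "\<lambda>t. fst t e2 e2 $ 1" and gd = "mat2 1 1 0 1"])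
      (use assms in \<open>auto simp: separator_simps intro!: poly_fun_intros\<close>)
qed

lemma orbit_dim_A17:
  "orbit_dim (strct_of A17) = 4"
proof (rule orbit_dim_eqI)
  show "orbit_dim (strct_of A17) \<le> enat 4"
    by (rule orbit_dim_le_4[OF strct_of_Bil2])
  show "enat 4 \<le> orbit_dim (strct_of A17)"
    by (rule orbit_dim_ge_4[OF strct_of_Bil2, where r = "(2, 4, 3, 1)"
        and fa = "\<lambda>t. fst t e1 e1 $ 2 - 1" and ga = "mat2 1 0 0 2"
        and fb = "\<lambda>t. snd t e1 e1 $ 1 + 1" and gb = "mat2 2 0 0 1"
        and fc = "\<lambda>t. snd t e1 e1 $ 2" and gc = "mat2 1 0 1 1"
        and fd = "\<lambda>t. fst t e2 e2 $ 1" and gd = "mat2 1 1 0 1"])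
      (auto simp: separator_simps intro!: poly_fun_intros)
qed

section \<open>Orbits of dimension 3\<close>

lemma orbit_dim_A02:
  "orbit_dim (strct_of A02) = 3"
proof (rule orbit_dim_eqI)
  show "orbit_dim (strct_of A02) \<le> enat 3"
    by (rule orbit_dim_le_3_diag2[OF strct_of_Bil2]) (simp add: automorphism_simps)
  show "enat 3 \<le> orbit_dim (strct_of A02)"
    by (rule orbit_dim_ge_3[OF strct_of_Bil2, where r = "(1, 3, 2, 3)"
        and fa = "\<lambda>t. snd t e1 e1 $ 1 - 1" and ga = "mat2 2 0 0 1"
        and fb = "\<lambda>t. snd t e1 e1 $ 2" and gb = "mat2 1 0 1 1"
        and fc = "\<lambda>t. snd t e2 e2 $ 1" and gc = "mat2 1 1 0 1"])
      (auto simp: separator_simps intro!: poly_fun_intros)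
qed

lemma orbit_dim_A03:
  "orbit_dim (strct_of A03) = 3"
proof (rule orbit_dim_eqI)
  show "orbit_dim (strct_of A03) \<le> enat 3"
    by (rule orbit_dim_le_3_diag2[OF strct_of_Bil2]) (simp add: automorphism_simps)
  show "enat 3 \<le> orbit_dim (strct_of A03)"
    by (rule orbit_dim_ge_3[OF strct_of_Bil2, where r = "(1, 3, 2, 3)"
        and fa = "\<lambda>t. snd t e1 e1 $ 1 - 1" and ga = "mat2 2 0 0 1"
        and fb = "\<lambda>t. snd t e1 e1 $ 2" and gb = "mat2 1 0 1 1"
        and fc = "\<lambda>t. snd t e2 e2 $ 1" and gc = "mat2 1 1 0 1"])
      (auto simp: separator_simps intro!: poly_fun_intros)
qed

lemma orbit_dim_A12:
  "orbit_dim (strct_of (A12 \<beta> \<gamma>)) = 3"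
proof (rule orbit_dim_eqI)
  show "orbit_dim (strct_of (A12 \<beta> \<gamma>)) \<le> enat 3"
    by (rule orbit_dim_le_3_diag2[OF strct_of_Bil2]) (simp add: automorphism_simps)
  show "enat 3 \<le> orbit_dim (strct_of (A12 \<beta> \<gamma>))"
    by (rule orbit_dim_ge_3[OF strct_of_Bil2, where r = "(1, 3, 2, 3)"
        and fa = "\<lambda>t. fst t e1 e1 $ 1 - 1" and ga = "mat2 2 0 0 1"
        and fb = "\<lambda>t. fst t e1 e1 $ 2" and gb = "mat2 1 0 1 1"
        and fc = "\<lambda>t. fst t e2 e2 $ 1" and gc = "mat2 1 1 0 1"])
      (auto simp: separator_simps intro!: poly_fun_intros)
qed

lemma orbit_dim_A14:
  "orbit_dim (strct_of (A14 \<beta>)) = 3"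
proof (rule orbit_dim_eqI)
  show "orbit_dim (strct_of (A14 \<beta>)) \<le> enat 3"
    by (rule orbit_dim_le_3_diag2[OF strct_of_Bil2]) (simp add: automorphism_simps)
  show "enat 3 \<le> orbit_dim (strct_of (A14 \<beta>))"
    by (rule orbit_dim_ge_3[OF strct_of_Bil2, where r = "(1, 3, 2, 3)"
        and fa = "\<lambda>t. fst t e1 e1 $ 1 - 1" and ga = "mat2 2 0 0 1"
        and fb = "\<lambda>t. fst t e1 e1 $ 2" and gb = "mat2 1 0 1 1"
        and fc = "\<lambda>t. fst t e2 e2 $ 1" and gc = "mat2 1 1 0 1"])
      (auto simp: separator_simps intro!: poly_fun_intros)
qed

text \<open>At the two shears \<open>fb\<close> and \<open>fc\<close> have the value
  \<open>\<beta> + 1\<close>.\<close>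

lemma orbit_dim_A06:
  assumes "\<beta> \<noteq> - 1"
  shows "orbit_dim (strct_of (A06 \<beta>)) = 3"
proof (rule orbit_dim_eqI)
  show "orbit_dim (strct_of (A06 \<beta>)) \<le> enat 3"
    by (rule orbit_dim_le_3_diag1[OF strct_of_Bil2]) (simp add: automorphism_simps)
  show "enat 3 \<le> orbit_dim (strct_of (A06 \<beta>))"
    by (rule orbit_dim_ge_3[OF strct_of_Bil2, where r = "(3, 2, 3, 1)"
        and fa = "\<lambda>t. snd t e2 e1 $ 1 + 1" and ga = "mat2 1 0 0 2"
        and fb = "\<lambda>t. snd t e2 e2 $ 1" and gb = "mat2 1 1 0 1"
        and fc = "\<lambda>t. snd t e1 e1 $ 2" and gc = "mat2 1 0 1 1"])
      (use assms in \<open>auto simp: separator_simps add_eq_0_iff intro!: poly_fun_intros\<close>)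
qed

text \<open>At the two shears \<open>fb\<close> and \<open>fc\<close> have the value
  \<open>- (\<beta> + 2)\<close>, and scaling \<open>e2\<close> changes the constant in
  \<open>fa\<close> only if \<open>\<beta> + 1\<close> is nonzero. This accounts for both excluded
  parameters.\<close>

lemma orbit_dim_A08:
  assumes "\<beta> \<noteq> - 1" "\<beta> \<noteq> - 2"
  shows "orbit_dim (strct_of (A08 \<beta>)) = 3"
proof (rule orbit_dim_eqI)
  show "orbit_dim (strct_of (A08 \<beta>)) \<le> enat 3"
    by (rule orbit_dim_le_3_diag1[OF strct_of_Bil2]) (simp add: automorphism_simps)
  show "enat 3 \<le> orbit_dim (strct_of (A08 \<beta>))"
    by (rule orbit_dim_ge_3[OF strct_of_Bil2, where r = "(3, 2, 3, 1)"
        and fa = "\<lambda>t. snd t e1 e2 $ 1 - (\<beta> + 1)" and ga = "mat2 1 0 0 2"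
        and fb = "\<lambda>t. snd t e2 e2 $ 1" and gb = "mat2 1 1 0 1"
        and fc = "\<lambda>t. snd t e1 e1 $ 2" and gc = "mat2 1 0 1 1"])
      (use assms in \<open>auto simp: separator_simps minus_equation_iff[of \<beta>] intro!: poly_fun_intros\<close>)
qed

lemma orbit_dim_A07:
  "orbit_dim (strct_of A07) = 3"
proof (rule orbit_dim_eqI)
  show "orbit_dim (strct_of A07) \<le> enat 3"
    by (rule orbit_dim_le_3_upper[OF strct_of_Bil2]) (simp add: automorphism_simps)
  show "enat 3 \<le> orbit_dim (strct_of A07)"
    by (rule orbit_dim_ge_3[OF strct_of_Bil2, where r = "(1, 3, 3, 2)"
        and fa = "\<lambda>t. snd t e2 e2 $ 1 - 1" and ga = "mat2 2 0 0 1"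
        and fb = "\<lambda>t. snd t e2 e1 $ 1 + 1" and gb = "mat2 1 0 0 2"
        and fc = "\<lambda>t. snd t e1 e1 $ 2" and gc = "mat2 1 0 1 1"])
      (auto simp: separator_simps intro!: poly_fun_intros)
qed

lemma orbit_dim_A09:
  "orbit_dim (strct_of A09) = 3"
proof (rule orbit_dim_eqI)
  show "orbit_dim (strct_of A09) \<le> enat 3"
    by (rule orbit_dim_le_3_upper[OF strct_of_Bil2]) (simp add: automorphism_simps)
  show "enat 3 \<le> orbit_dim (strct_of A09)"
    by (rule orbit_dim_ge_3[OF strct_of_Bil2, where r = "(1, 3, 3, 2)"
        and fa = "\<lambda>t. snd t e2 e2 $ 1 - 1" and ga = "mat2 2 0 0 1"
        and fb = "\<lambda>t. snd t e2 e1 $ 1 + 2" and gb = "mat2 1 0 0 2"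
        and fc = "\<lambda>t. snd t e1 e1 $ 2" and gc = "mat2 1 0 1 1"])
      (auto simp: separator_simps intro!: poly_fun_intros)
qed

text \<open>The family extends \<open>A15\<close> to \<open>\<delta> = 1/2\<close>, where the value
  \<open>1 - 2 * \<delta>\<close> that detects lower shears is 0: they have become
  automorphisms.\<close>

lemma orbit_dim_A16:
  "orbit_dim (strct_of (A16 \<beta>)) = 3"
proof (rule orbit_dim_eqI)
  show "orbit_dim (strct_of (A16 \<beta>)) \<le> enat 3"
    by (rule orbit_dim_le_3_lower[OF strct_of_Bil2]) (simp add: automorphism_simps)
  show "enat 3 \<le> orbit_dim (strct_of (A16 \<beta>))"
    by (rule orbit_dim_ge_3[OF strct_of_Bil2, where r = "(2, 3, 3, 1)"
        and fa = "\<lambda>t. fst t e1 e1 $ 2 - 1" and ga = "mat2 1 0 0 2"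
        and fb = "\<lambda>t. snd t e1 e2 $ 2 - 1" and gb = "mat2 2 0 0 1"
        and fc = "\<lambda>t. fst t e2 e2 $ 1" and gc = "mat2 1 1 0 1"])
      (auto simp: separator_simps intro!: poly_fun_intros)
qed

section \<open>Orbits of dimension 2\<close>

lemma orbit_dim_A04:
  "orbit_dim (strct_of A04) = 2"
proof (rule orbit_dim_eqI)
  show "orbit_dim (strct_of A04) \<le> enat 2"
    by (rule orbit_dim_le_2_weighted[OF strct_of_Bil2]) (simp add: automorphism_simps)
  show "enat 2 \<le> orbit_dim (strct_of A04)"
    by (rule orbit_dim_ge_2[OF strct_of_Bil2, where r = "(2, 2, 2, 1)"
        and fa = "\<lambda>t. snd t e1 e1 $ 2 - 1" and ga = "mat2 1 0 0 2"
        and fb = "\<lambda>t. snd t e2 e2 $ 1" and gb = "mat2 1 1 0 1"])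
      (auto simp: separator_simps intro!: poly_fun_intros)
qed

lemma orbit_dim_A18:
  "orbit_dim (strct_of (A18 \<alpha>)) = 2"
proof (rule orbit_dim_eqI)
  show "orbit_dim (strct_of (A18 \<alpha>)) \<le> enat 2"
    by (rule orbit_dim_le_2_weighted[OF strct_of_Bil2]) (simp add: automorphism_simps)
  show "enat 2 \<le> orbit_dim (strct_of (A18 \<alpha>))"
    by (rule orbit_dim_ge_2[OF strct_of_Bil2, where r = "(2, 2, 2, 1)"
        and fa = "\<lambda>t. fst t e1 e1 $ 2 - 1" and ga = "mat2 1 0 0 2"
        and fb = "\<lambda>t. fst t e2 e2 $ 1" and gb = "mat2 1 1 0 1"])
      (auto simp: separator_simps intro!: poly_fun_intros)
qed

text \<open>The \<open>circ\<close> product of \<open>x\<close> and \<open>y\<close> is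
  \<open>- x$2\<close> times \<open>y\<close>, so every invertible linear map preserving the second
  coordinate is an automorphism.\<close>

lemma orbit_dim_A06_minus_1:
  "orbit_dim (strct_of (A06 (- 1))) = 2"
proof (rule orbit_dim_eqI)
  show "orbit_dim (strct_of (A06 (- 1))) \<le> enat 2"
    by (rule orbit_dim_le_2_affine[OF strct_of_Bil2]) (simp add: automorphism_simps)
  show "enat 2 \<le> orbit_dim (strct_of (A06 (- 1)))"
    by (rule orbit_dim_ge_2[OF strct_of_Bil2, where r = "(2, 2, 2, 1)"
        and fa = "\<lambda>t. snd t e2 e1 $ 1 + 1" and ga = "mat2 1 0 0 2"
        and fb = "\<lambda>t. snd t e1 e1 $ 1" and gb = "mat2 1 0 1 1"])
      (auto simp: separator_simps intro!: poly_fun_intros)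
qed

text \<open>The \<open>circ\<close> product of \<open>x\<close> and \<open>y\<close> is
  \<open>- 2 * x$2\<close> times \<open>y\<close> minus \<open>y$2\<close> times \<open>x\<close>;
  again the second coordinate determines it.\<close>

lemma orbit_dim_A08_minus_2:
  "orbit_dim (strct_of (A08 (- 2))) = 2"
proof (rule orbit_dim_eqI)
  show "orbit_dim (strct_of (A08 (- 2))) \<le> enat 2"
    by (rule orbit_dim_le_2_affine[OF strct_of_Bil2]) (simp add: automorphism_simps)
  show "enat 2 \<le> orbit_dim (strct_of (A08 (- 2)))"
    by (rule orbit_dim_ge_2[OF strct_of_Bil2, where r = "(2, 2, 2, 1)"
        and fa = "\<lambda>t. snd t e2 e1 $ 1 + 2" and ga = "mat2 1 0 0 2"
        and fb = "\<lambda>t. snd t e1 e1 $ 1" and gb = "mat2 1 0 1 1"])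
      (auto simp: separator_simps intro!: poly_fun_intros)
qed

section \<open>Degenerations as limits\<close>

lemma poly_funs_tendsto:
  assumes "f \<in> poly_funs"
    and "\<And>i j k. ((\<lambda>t. fst (S t) (axis i 1) (axis j 1) $ k) \<longlongrightarrow> fst s (axis i 1) (axis j 1) $ k) F"
    and "\<And>i j k. ((\<lambda>t. snd (S t) (axis i 1) (axis j 1) $ k) \<longlongrightarrow> snd s (axis i 1) (axis j 1) $ k) F"
  shows "((\<lambda>t. f (S t)) \<longlongrightarrow> f s) F"
  using assms(1)
  by induction (auto intro: tendsto_add tendsto_mult assms(2,3))

text \<open>The columns of \<open>mat2 (p t) (q t) (r t) (u t)\<close> form a basis of the original algebra; in this
  basis the structure constants are \<open>a t, ..., d' t\<close>.\<close>

lemma degeneratesI: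
  fixes a b c d a' b' c' d' :: "complex \<Rightarrow> V" and p q r u :: "complex \<Rightarrow> complex"
  assumes s: "s \<in> Bil2"
    and det: "\<And>t. t \<noteq> 0 \<Longrightarrow> p t * u t - q t * r t \<noteq> 0"
    and dot: "\<And>t x y. t \<noteq> 0 \<Longrightarrow>
      fst s (mat2 (p t) (q t) (r t) (u t) *v x) (mat2 (p t) (q t) (r t) (u t) *v y)
        = mat2 (p t) (q t) (r t) (u t) *v table (a t) (b t) (c t) (d t) x y"
    and circ: "\<And>t x y. t \<noteq> 0 \<Longrightarrow>
      snd s (mat2 (p t) (q t) (r t) (u t) *v x) (mat2 (p t) (q t) (r t) (u t) *v y)
        = mat2 (p t) (q t) (r t) (u t) *v table (a' t) (b' t) (c' t) (d' t) x y"
    and cont: "isCont a 0" "isCont b 0" "isCont c 0" "isCont d 0"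
      "isCont a' 0" "isCont b' 0" "isCont c' 0" "isCont d' 0"
  shows "degenerates s (table (a 0) (b 0) (c 0) (d 0), table (a' 0) (b' 0) (c' 0) (d' 0))"
proof -
  define S where "S t = (table (a t) (b t) (c t) (d t), table (a' t) (b' t) (c' t) (d' t))" for t
  have orb: "S t \<in> orbit s" if "t \<noteq> 0" for t
  proof -
    let ?h = "mat2 (p t) (q t) (r t) (u t)"
    have "act ?h (S t) = s"
      using det[OF that] dot[OF that] circ[OF that] by (intro act_eqI) (simp_all add: S_def)
    then have "s \<in> orbit (S t)" using det[OF that] by (force simp: orbit_def)
    then show ?thesis by (rule orbit_sym)
  qed
  have lim: "(\<lambda>t. fst (S t) (axis i 1) (axis j 1) $ k) \<midarrow>0\<rightarrow> fst (S 0) (axis i 1) (axis j 1) $ k"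
    "(\<lambda>t. snd (S t) (axis i 1) (axis j 1) $ k) \<midarrow>0\<rightarrow> snd (S 0) (axis i 1) (axis j 1) $ k" for i j k
    unfolding S_def using cont axis_cases[of i] axis_cases[of j]
    by (auto simp: isCont_def intro!: tendsto_vec_nth)
  have "f (S 0) = 0" if f: "f \<in> poly_funs" "\<forall>u \<in> orbit s. f u = 0" for f
  proof -
    have "(\<lambda>t. f (S t)) \<midarrow>0\<rightarrow> f (S 0)"
      by (rule poly_funs_tendsto[OF f(1)]) (use lim in auto)
    moreover have "\<forall>\<^sub>F t in at 0. f (S t) = 0"
      unfolding eventually_at_topological using f(2) orb by (intro exI[of _ UNIV]) auto
    then have "(\<lambda>t. f (S t)) \<midarrow>0\<rightarrow> 0" by (rule tendsto_eventually)
    ultimately show ?thesis by (rule LIM_unique)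
  qed
  moreover have "S 0 \<in> Bil2" by (simp add: S_def Bil2_iff cbilinear_table)
  ultimately have "S 0 \<in> zariski closure_of orbit s"
    using in_closure_iff[OF orbit_Bil2[OF s]] by blast
  then show ?thesis using degenerates_iff[OF s] by (simp add: S_def)
qed

lemma isCont_vector_2:
  fixes f g :: "complex \<Rightarrow> complex"
  assumes "isCont f t" "isCont g t"
  shows "isCont (\<lambda>t. vector [f t, g t] :: V) t"
  unfolding isCont_def
proof (rule vec_tendstoI)
  fix i :: 2
  show "(\<lambda>t. (vector [f t, g t] :: V) $ i) \<midarrow>t\<rightarrow> (vector [f t, g t] :: V) $ i"
    using exhaust_2[of i] assms by (auto simp: isCont_def)
qed

lemma degenerates_strct_ofI:
  fixes a b c d a' b' c' d' :: "complex \<Rightarrow> V" and p q r u :: "complex \<Rightarrow> complex"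
  assumes "\<And>t. t \<noteq> 0 \<Longrightarrow> p t * u t - q t * r t \<noteq> 0"
    and "\<And>t x y. t \<noteq> 0 \<Longrightarrow>
      dot T (mat2 (p t) (q t) (r t) (u t) *v x) (mat2 (p t) (q t) (r t) (u t) *v y)
        = mat2 (p t) (q t) (r t) (u t) *v table (a t) (b t) (c t) (d t) x y"
    and "\<And>t x y. t \<noteq> 0 \<Longrightarrow>
      circ T (mat2 (p t) (q t) (r t) (u t) *v x) (mat2 (p t) (q t) (r t) (u t) *v y)
        = mat2 (p t) (q t) (r t) (u t) *v table (a' t) (b' t) (c' t) (d' t) x y"
    and "isCont a 0" "isCont b 0" "isCont c 0" "isCont d 0"
      "isCont a' 0" "isCont b' 0" "isCont c' 0" "isCont d' 0"
    and "dot T' = table (a 0) (b 0) (c 0) (d 0)" "circ T' = table (a' 0) (b' 0) (c' 0) (d' 0)"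
  shows "degenerates (strct_of T) (strct_of T')"
  using degeneratesI[of "strct_of T" p u q r a b c d a' b' c' d'] assms strct_of_Bil2[of T]
  by (simp add: strct_of_def)

lemma table_eqI:
  "a = a' \<Longrightarrow> b = b' \<Longrightarrow> c = c' \<Longrightarrow> d = d' \<Longrightarrow> table a b c d = table a' b' c' d'"
  by simp

lemmas degeneration_simps = vec_eq_2 table_nth matrix_vector_2 field_simps power2_eq_square
lemmas degeneration_intros = continuous_intros isCont_vector_2 table_eqI

section \<open>Explicit families of bases\<close>

text \<open>The unit \<open>e1 + e2\<close> is kept, while the idempotent \<open>e2\<close> is
  replaced by \<open>t *s e2\<close>, whose square is \<open>t\<close> times itself.\<close>

lemma A01_to_A02:
  "degenerates (strct_of A01) (strct_of A02)"
  by (rule degenerates_strct_ofI[where p = "\<lambda>t. 1" and q = "\<lambda>t. 0" and r = "\<lambda>t. 1" and u = "\<lambda>t. t"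
      and a = "\<lambda>t. 0" and b = "\<lambda>t. 0" and c = "\<lambda>t. 0" and d = "\<lambda>t. 0"
      and a' = "\<lambda>t. vector [1, 0]" and b' = "\<lambda>t. vector [0, 1]" and c' = "\<lambda>t. vector [0, 1]"
        and d' = "\<lambda>t. vector [0, t]"])
    (auto simp: degeneration_simps intro!: degeneration_intros)

lemma A01_to_A03:
  "degenerates (strct_of A01) (strct_of A03)"
  by (rule degenerates_strct_ofI[where p = "\<lambda>t. 1" and q = "\<lambda>t. 0" and r = "\<lambda>t. 0" and u = "\<lambda>t. t"
      and a = "\<lambda>t. 0" and b = "\<lambda>t. 0" and c = "\<lambda>t. 0" and d = "\<lambda>t. 0"
      and a' = "\<lambda>t. vector [1, 0]" and b' = "\<lambda>t. 0" and c' = "\<lambda>t. 0" and d' = "\<lambda>t. vector [0, t]"])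
    (auto simp: degeneration_simps intro!: degeneration_intros)

lemma A05_to_A06:
  "degenerates (strct_of A05) (strct_of (A06 0))"
  by (rule degenerates_strct_ofI[where p = "\<lambda>t. t" and q = "\<lambda>t. 0" and r = "\<lambda>t. 0" and u = "\<lambda>t. 1"
      and a = "\<lambda>t. 0" and b = "\<lambda>t. 0" and c = "\<lambda>t. 0" and d = "\<lambda>t. 0"
      and a' = "\<lambda>t. vector [0, - (t^2)]" and b' = "\<lambda>t. 0" and c' = "\<lambda>t. vector [- 1, 0]"
        and d' = "\<lambda>t. 0"])
    (auto simp: degeneration_simps intro!: degeneration_intros)

text \<open>The eigenvectors \<open>e1 - e2\<close> and \<open>e1 + e2\<close> of the right
  multiplication by \<open>e1\<close> are used, the first one scaled by \<open>t\<close>.\<close>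

lemma A05_to_A08:
  "degenerates (strct_of A05) (strct_of (A08 0))"
  by (rule degenerates_strct_ofI[where p = "\<lambda>t. t" and q = "\<lambda>t. 1" and r = "\<lambda>t. - t" and u = "\<lambda>t. 1"
      and a = "\<lambda>t. 0" and b = "\<lambda>t. 0" and c = "\<lambda>t. 0" and d = "\<lambda>t. 0"
      and a' = "\<lambda>t. vector [t, 0]" and b' = "\<lambda>t. vector [1, 0]" and c' = "\<lambda>t. vector [0, - t]"
        and d' = "\<lambda>t. vector [0, - 1]"])
    (auto simp: degeneration_simps intro!: degeneration_intros)

lemma A10_to_A12:
  "degenerates (strct_of (A10 \<beta> \<beta>)) (strct_of (A12 \<beta> \<beta>))"
  by (rule degenerates_strct_ofI[where p = "\<lambda>t. 1" and q = "\<lambda>t. 0" and r = "\<lambda>t. 1" and u = "\<lambda>t. t"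
      and a = "\<lambda>t. vector [1, 0]" and b = "\<lambda>t. vector [0, 1]" and c = "\<lambda>t. vector [0, 1]"
        and d = "\<lambda>t. vector [0, t]"
      and a' = "\<lambda>t. vector [\<beta>, 0]" and b' = "\<lambda>t. vector [0, \<beta>]" and c' = "\<lambda>t. vector [0, \<beta>]"
        and d' = "\<lambda>t. vector [0, \<beta> * t]"])
    (auto simp: degeneration_simps intro!: degeneration_intros)

lemma A10_to_A14:
  "degenerates (strct_of (A10 \<delta> \<epsilon>)) (strct_of (A14 \<delta>))"
  by (rule degenerates_strct_ofI[where p = "\<lambda>t. 1" and q = "\<lambda>t. 0" and r = "\<lambda>t. 0" and u = "\<lambda>t. t"
      and a = "\<lambda>t. vector [1, 0]" and b = "\<lambda>t. 0" and c = "\<lambda>t. 0" and d = "\<lambda>t. vector [0, t]"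
      and a' = "\<lambda>t. vector [\<delta>, 0]" and b' = "\<lambda>t. 0" and c' = "\<lambda>t. 0"
        and d' = "\<lambda>t. vector [0, \<epsilon> * t]"])
    (auto simp: degeneration_simps intro!: degeneration_intros)

text \<open>For \<open>t\<close> times the \<open>dot\<close> unit the \<open>dot\<close> square
  tends to 0. Its \<open>circ\<close> square is a small multiple of it plus a remainder, nonzero as
  \<open>\<delta> \<noteq> \<epsilon>\<close>, and this remainder is the second basis
  vector.\<close>

lemma A10_to_A04:
  assumes "\<delta> \<noteq> \<epsilon>"
  shows "degenerates (strct_of (A10 \<delta> \<epsilon>)) (strct_of A04)"
  by (rule degenerates_strct_ofI[where p = "\<lambda>t. t" and q = "\<lambda>t. 0" and r = "\<lambda>t. t"
    and u = "\<lambda>t. t^2 * (\<epsilon> - \<delta>)"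
      and a = "\<lambda>t. vector [t, 0]" and b = "\<lambda>t. vector [0, t]" and c = "\<lambda>t. vector [0, t]"
        and d = "\<lambda>t. vector [0, t^2 * (\<epsilon> - \<delta>)]"
      and a' = "\<lambda>t. vector [\<delta> * t, 1]" and b' = "\<lambda>t. vector [0, \<epsilon> * t]"
        and c' = "\<lambda>t. vector [0, \<epsilon> * t]" and d' = "\<lambda>t. vector [0, \<epsilon> * t^2 * (\<epsilon> - \<delta>)]"])
    (use assms in \<open>auto simp: degeneration_simps intro!: degeneration_intros\<close>)

lemma A14_to_A18:
  "degenerates (strct_of (A14 \<beta>)) (strct_of (A18 \<beta>))"
  by (rule degenerates_strct_ofI[where p = "\<lambda>t. t" and q = "\<lambda>t. 0" and r = "\<lambda>t. 1" and u = "\<lambda>t. - t"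
      and a = "\<lambda>t. vector [t, 1]" and b = "\<lambda>t. 0" and c = "\<lambda>t. 0" and d = "\<lambda>t. 0"
      and a' = "\<lambda>t. vector [\<beta> * t, \<beta>]" and b' = "\<lambda>t. 0" and c' = "\<lambda>t. 0" and d' = "\<lambda>t. 0"])
    (auto simp: degeneration_simps intro!: degeneration_intros)

text \<open>The first vector is \<open>t *s (e1 + y *s e2)\<close>, the second is what its
  \<open>dot\<close> square adds to a multiple of it. For \<open>A10 \<delta> \<epsilon>\<close> the
  \<open>circ\<close> square then adds \<open>(\<epsilon> * y - \<delta>) / (y - 1)\<close> times
  the second vector; equating this with \<open>\<alpha>\<close> and solving for
  \<open>\<delta>\<close> gives the parameter in the statement.\<close>

lemma A10_to_A18:
  assumes "y \<noteq> 0" "y \<noteq> 1"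
  shows "degenerates (strct_of (A10 (\<alpha> + y * (\<epsilon> - \<alpha>)) \<epsilon>)) (strct_of (A18 \<alpha>))"
  by (rule degenerates_strct_ofI[where p = "\<lambda>t. t" and q = "\<lambda>t. 0" and r = "\<lambda>t. t * y"
    and u = "\<lambda>t. t^2 * (y^2 - y)"
      and a = "\<lambda>t. vector [t, 1]" and b = "\<lambda>t. vector [0, t * y]" and c = "\<lambda>t. vector [0, t * y]"
        and d = "\<lambda>t. vector [0, t^2 * (y^2 - y)]"
      and a' = "\<lambda>t. vector [(\<alpha> + y * (\<epsilon> - \<alpha>)) * t, \<alpha>]" and b' = "\<lambda>t. vector [0, \<epsilon> * t * y]"
        and c' = "\<lambda>t. vector [0, \<epsilon> * t * y]" and d' = "\<lambda>t. vector [0, \<epsilon> * t^2 * (y^2 - y)]"])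
    (use assms in \<open>auto simp: degeneration_simps intro!: degeneration_intros\<close>)

lemma A11_to_A12:
  "degenerates (strct_of (A11 \<delta> \<epsilon>)) (strct_of (A12 \<delta> \<epsilon>))"
  by (rule degenerates_strct_ofI[where p = "\<lambda>t. 1" and q = "\<lambda>t. 0" and r = "\<lambda>t. 0"
    and u = "\<lambda>t. 1 / t"
      and a = "\<lambda>t. vector [1, 0]" and b = "\<lambda>t. vector [0, 1]" and c = "\<lambda>t. vector [0, 1]"
        and d = "\<lambda>t. 0"
      and a' = "\<lambda>t. vector [2 * \<delta> - \<epsilon>, t]" and b' = "\<lambda>t. vector [0, \<delta>]"
        and c' = "\<lambda>t. vector [0, \<epsilon>]" and d' = "\<lambda>t. 0"])
    (auto simp: degeneration_simps intro!: degeneration_intros)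

lemma A11_to_A04:
  "degenerates (strct_of (A11 \<delta> \<epsilon>)) (strct_of A04)"
  by (rule degenerates_strct_ofI[where p = "\<lambda>t. t" and q = "\<lambda>t. 0" and r = "\<lambda>t. 0" and u = "\<lambda>t. t^2"
      and a = "\<lambda>t. vector [t, 0]" and b = "\<lambda>t. vector [0, t]" and c = "\<lambda>t. vector [0, t]"
        and d = "\<lambda>t. 0"
      and a' = "\<lambda>t. vector [(2 * \<delta> - \<epsilon>) * t, 1]" and b' = "\<lambda>t. vector [0, \<delta> * t]"
        and c' = "\<lambda>t. vector [0, \<epsilon> * t]" and d' = "\<lambda>t. 0"])
    (auto simp: degeneration_simps intro!: degeneration_intros)

text \<open>The first vector is \<open>t *s (e1 + m *s e2)\<close>. The missing value
  \<open>2 * \<epsilon> - \<delta>\<close> would need an infinite \<open>m\<close>; it is reached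
  through \<open>A12\<close>.\<close>

lemma A11_to_A18:
  assumes "m \<noteq> 0"
  shows "degenerates (strct_of (A11 \<delta> \<epsilon>)) (strct_of (A18 (2 * \<epsilon> - \<delta> + 1 / m)))"
  by (rule degenerates_strct_ofI[where p = "\<lambda>t. t" and q = "\<lambda>t. 0" and r = "\<lambda>t. m * t"
    and u = "\<lambda>t. m * t^2"
      and a = "\<lambda>t. vector [t, 1]" and b = "\<lambda>t. vector [0, t]" and c = "\<lambda>t. vector [0, t]"
        and d = "\<lambda>t. 0"
      and a' = "\<lambda>t. vector [(2 * \<delta> - \<epsilon>) * t, 2 * \<epsilon> - \<delta> + 1 / m]" and b' = "\<lambda>t. vector [0, \<delta> * t]"
        and c' = "\<lambda>t. vector [0, \<epsilon> * t]" and d' = "\<lambda>t. 0"])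
    (use assms in \<open>auto simp: degeneration_simps intro!: degeneration_intros\<close>)

lemma A13_to_A14:
  "degenerates (strct_of (A13 \<delta>)) (strct_of (A14 \<delta>))"
  by (rule degenerates_strct_ofI[where p = "\<lambda>t. 1" and q = "\<lambda>t. 0" and r = "\<lambda>t. 0" and u = "\<lambda>t. t"
      and a = "\<lambda>t. vector [1, 0]" and b = "\<lambda>t. 0" and c = "\<lambda>t. 0" and d = "\<lambda>t. 0"
      and a' = "\<lambda>t. vector [\<delta>, 0]" and b' = "\<lambda>t. 0" and c' = "\<lambda>t. 0" and d' = "\<lambda>t. vector [0, t]"])
    (auto simp: degeneration_simps intro!: degeneration_intros)

lemma A13_to_A03:
  "degenerates (strct_of (A13 \<delta>)) (strct_of A03)"
  by (rule degenerates_strct_ofI[where p = "\<lambda>t. 0" and q = "\<lambda>t. t" and r = "\<lambda>t. 1" and u = "\<lambda>t. 0"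
      and a = "\<lambda>t. 0" and b = "\<lambda>t. 0" and c = "\<lambda>t. 0" and d = "\<lambda>t. vector [0, t]"
      and a' = "\<lambda>t. vector [1, 0]" and b' = "\<lambda>t. 0" and c' = "\<lambda>t. 0"
        and d' = "\<lambda>t. vector [0, \<delta> * t]"])
    (auto simp: degeneration_simps intro!: degeneration_intros)

lemma A13_to_A18:
  assumes "y \<noteq> 0"
  shows "degenerates (strct_of (A13 (\<alpha> + y))) (strct_of (A18 \<alpha>))"
  by (rule degenerates_strct_ofI[where p = "\<lambda>t. t" and q = "\<lambda>t. 0" and r = "\<lambda>t. t * y"
    and u = "\<lambda>t. - (t^2) * y"
      and a = "\<lambda>t. vector [t, 1]" and b = "\<lambda>t. 0" and c = "\<lambda>t. 0" and d = "\<lambda>t. 0"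
      and a' = "\<lambda>t. vector [(\<alpha> + y) * t, \<alpha>]" and b' = "\<lambda>t. vector [0, t * y]"
        and c' = "\<lambda>t. vector [0, t * y]" and d' = "\<lambda>t. vector [0, - (t^2) * y]"])
    (use assms in \<open>auto simp: degeneration_simps intro!: degeneration_intros\<close>)

lemma A15_to_A06:
  "degenerates (strct_of (A15 0)) (strct_of (A06 (- 2)))"
  by (rule degenerates_strct_ofI[where p = "\<lambda>t. 0" and q = "\<lambda>t. - 1" and r = "\<lambda>t. 1 / t"
    and u = "\<lambda>t. 0"
      and a = "\<lambda>t. 0" and b = "\<lambda>t. 0" and c = "\<lambda>t. 0" and d = "\<lambda>t. vector [t, 0]"
      and a' = "\<lambda>t. 0" and b' = "\<lambda>t. 0" and c' = "\<lambda>t. vector [- 1, 0]"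
        and d' = "\<lambda>t. vector [0, - 2]"])
    (auto simp: degeneration_simps intro!: degeneration_intros)

lemma A15_to_A02:
  "degenerates (strct_of (A15 1)) (strct_of A02)"
  by (rule degenerates_strct_ofI[where p = "\<lambda>t. 1" and q = "\<lambda>t. 0" and r = "\<lambda>t. 0"
    and u = "\<lambda>t. 1 / t"
      and a = "\<lambda>t. vector [0, t]" and b = "\<lambda>t. 0" and c = "\<lambda>t. 0" and d = "\<lambda>t. 0"
      and a' = "\<lambda>t. vector [1, 0]" and b' = "\<lambda>t. vector [0, 1]" and c' = "\<lambda>t. vector [0, 1]"
        and d' = "\<lambda>t. 0"])
    (auto simp: degeneration_simps intro!: degeneration_intros)

text \<open>In the basis \<open>(1 / t) *s e2\<close>, \<open>l *s e1\<close> the \<open>dot\<close>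
  product tends to 0 and \<open>circ\<close> does not depend on \<open>t\<close>. The parameter
  \<open>\<delta> = 0\<close> of \<open>A15\<close> corresponds to \<open>l = - 1\<close>, where the
  limit is the algebra \<open>A06 (- 2)\<close>.\<close>

lemma A15_to_A08:
  assumes "l \<noteq> 0"
  shows "degenerates (strct_of (A15 (1 + 1 / l))) (strct_of (A08 l))"
  by (rule degenerates_strct_ofI[where p = "\<lambda>t. 0" and q = "\<lambda>t. l" and r = "\<lambda>t. 1 / t"
    and u = "\<lambda>t. 0"
      and a = "\<lambda>t. 0" and b = "\<lambda>t. 0" and c = "\<lambda>t. 0" and d = "\<lambda>t. vector [l^2 * t, 0]"
      and a' = "\<lambda>t. 0" and b' = "\<lambda>t. vector [l + 1, 0]" and c' = "\<lambda>t. vector [l, 0]"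
        and d' = "\<lambda>t. vector [0, l - 1]"])
    (use assms in \<open>auto simp: degeneration_simps intro!: degeneration_intros\<close>)

text \<open>\<open>k\<close> is the slope of the first basis vector. For
  \<open>\<delta> \<noteq> 1/2\<close> the limit parameter takes every value as \<open>k\<close>
  varies.\<close>

lemma A15_to_A18:
  "degenerates (strct_of (A15 \<delta>)) (strct_of (A18 ((2 * \<delta> - 1) * k)))"
  by (rule degenerates_strct_ofI[where p = "\<lambda>t. t" and q = "\<lambda>t. 0" and r = "\<lambda>t. k * t"
    and u = "\<lambda>t. t^2"
      and a = "\<lambda>t. vector [0, 1]" and b = "\<lambda>t. 0" and c = "\<lambda>t. 0" and d = "\<lambda>t. 0"
      and a' = "\<lambda>t. vector [(2 - \<delta>) * t, (2 * \<delta> - 1) * k]" and b' = "\<lambda>t. vector [0, t]"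
        and c' = "\<lambda>t. vector [0, \<delta> * t]" and d' = "\<lambda>t. 0"])
    (auto simp: degeneration_simps intro!: degeneration_intros)

lemma A17_to_A08:
  "degenerates (strct_of A17) (strct_of (A08 0))"
  by (rule degenerates_strct_ofI[where p = "\<lambda>t. 0" and q = "\<lambda>t. 1" and r = "\<lambda>t. 1 / t"
    and u = "\<lambda>t. 0"
      and a = "\<lambda>t. 0" and b = "\<lambda>t. 0" and c = "\<lambda>t. 0" and d = "\<lambda>t. vector [t, 0]"
      and a' = "\<lambda>t. 0" and b' = "\<lambda>t. vector [1, 0]" and c' = "\<lambda>t. 0"
        and d' = "\<lambda>t. vector [0, - 1]"])
    (auto simp: degeneration_simps intro!: degeneration_intros)

lemma A17_to_A18:
  "degenerates (strct_of A17) (strct_of (A18 \<alpha>))"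
  by (rule degenerates_strct_ofI[where p = "\<lambda>t. t" and q = "\<lambda>t. 0" and r = "\<lambda>t. \<alpha> / 2 * t"
    and u = "\<lambda>t. t^2"
      and a = "\<lambda>t. vector [0, 1]" and b = "\<lambda>t. 0" and c = "\<lambda>t. 0" and d = "\<lambda>t. 0"
      and a' = "\<lambda>t. vector [- t, \<alpha>]" and b' = "\<lambda>t. 0" and c' = "\<lambda>t. vector [0, t]"
        and d' = "\<lambda>t. 0"])
    (auto simp: degeneration_simps intro!: degeneration_intros)

lemma A12_to_A18:
  "degenerates (strct_of (A12 \<beta> \<gamma>)) (strct_of (A18 (2 * \<gamma> - \<beta>)))"
  by (rule degenerates_strct_ofI[where p = "\<lambda>t. t" and q = "\<lambda>t. 0" and r = "\<lambda>t. 1" and u = "\<lambda>t. t"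
      and a = "\<lambda>t. vector [t, 1]" and b = "\<lambda>t. vector [0, t]" and c = "\<lambda>t. vector [0, t]"
        and d = "\<lambda>t. 0"
      and a' = "\<lambda>t. vector [(2 * \<beta> - \<gamma>) * t, 2 * \<gamma> - \<beta>]" and b' = "\<lambda>t. vector [0, \<beta> * t]"
        and c' = "\<lambda>t. vector [0, \<gamma> * t]" and d' = "\<lambda>t. 0"])
    (auto simp: degeneration_simps intro!: degeneration_intros)

lemma A16_to_A08:
  "degenerates (strct_of (A16 \<beta>)) (strct_of (A08 (- 2)))"
  by (rule degenerates_strct_ofI[where p = "\<lambda>t. 0" and q = "\<lambda>t. - 2" and r = "\<lambda>t. 1 / t"
    and u = "\<lambda>t. 0"
      and a = "\<lambda>t. 0" and b = "\<lambda>t. 0" and c = "\<lambda>t. 0" and d = "\<lambda>t. vector [4 * t, 0]"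
      and a' = "\<lambda>t. 0" and b' = "\<lambda>t. vector [- 1, 0]" and c' = "\<lambda>t. vector [- 2, 0]"
        and d' = "\<lambda>t. vector [4 * \<beta> * t, - 3]"])
    (auto simp: degeneration_simps intro!: degeneration_intros)

lemma A16_to_A18:
  "degenerates (strct_of (A16 \<beta>)) (strct_of (A18 \<beta>))"
  by (rule degenerates_strct_ofI[where p = "\<lambda>t. t" and q = "\<lambda>t. 0" and r = "\<lambda>t. 0" and u = "\<lambda>t. t^2"
      and a = "\<lambda>t. vector [0, 1]" and b = "\<lambda>t. 0" and c = "\<lambda>t. 0" and d = "\<lambda>t. 0"
      and a' = "\<lambda>t. vector [(3/2) * t, \<beta>]" and b' = "\<lambda>t. vector [0, t]"
        and c' = "\<lambda>t. vector [0, t / 2]" and d' = "\<lambda>t. 0"])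
    (auto simp: degeneration_simps intro!: degeneration_intros)

lemma A02_to_A04:
  "degenerates (strct_of A02) (strct_of A04)"
  by (rule degenerates_strct_ofI[where p = "\<lambda>t. t" and q = "\<lambda>t. 0" and r = "\<lambda>t. 1" and u = "\<lambda>t. t"
      and a = "\<lambda>t. 0" and b = "\<lambda>t. 0" and c = "\<lambda>t. 0" and d = "\<lambda>t. 0"
      and a' = "\<lambda>t. vector [t, 1]" and b' = "\<lambda>t. vector [0, t]" and c' = "\<lambda>t. vector [0, t]"
        and d' = "\<lambda>t. 0"])
    (auto simp: degeneration_simps intro!: degeneration_intros)

lemma A03_to_A04:
  "degenerates (strct_of A03) (strct_of A04)"
  by (rule degenerates_strct_ofI[where p = "\<lambda>t. t" and q = "\<lambda>t. 0" and r = "\<lambda>t. 1" and u = "\<lambda>t. - t"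
      and a = "\<lambda>t. 0" and b = "\<lambda>t. 0" and c = "\<lambda>t. 0" and d = "\<lambda>t. 0"
      and a' = "\<lambda>t. vector [t, 1]" and b' = "\<lambda>t. 0" and c' = "\<lambda>t. 0" and d' = "\<lambda>t. 0"])
    (auto simp: degeneration_simps intro!: degeneration_intros)

lemma A06_to_A04:
  assumes "m \<noteq> 0"
  shows "degenerates (strct_of (A06 (m - 1))) (strct_of A04)"
  by (rule degenerates_strct_ofI[where p = "\<lambda>t. 1" and q = "\<lambda>t. m * t" and r = "\<lambda>t. - t"
    and u = "\<lambda>t. 0"
      and a = "\<lambda>t. 0" and b = "\<lambda>t. 0" and c = "\<lambda>t. 0" and d = "\<lambda>t. 0"
      and a' = "\<lambda>t. vector [(1 - m) * t, 1]" and b' = "\<lambda>t. vector [0, t]" and c' = "\<lambda>t. 0"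
        and d' = "\<lambda>t. 0"])
    (use assms in \<open>auto simp: degeneration_simps intro!: degeneration_intros\<close>)

lemma A08_to_A04:
  assumes "m \<noteq> 0"
  shows "degenerates (strct_of (A08 (m - 2))) (strct_of A04)"
  by (rule degenerates_strct_ofI[where p = "\<lambda>t. 1" and q = "\<lambda>t. m * t" and r = "\<lambda>t. t"
    and u = "\<lambda>t. 0"
      and a = "\<lambda>t. 0" and b = "\<lambda>t. 0" and c = "\<lambda>t. 0" and d = "\<lambda>t. 0"
      and a' = "\<lambda>t. vector [(m - 3) * t, 1]" and b' = "\<lambda>t. vector [0, (m - 2) * t]"
        and c' = "\<lambda>t. vector [0, (m - 1) * t]" and d' = "\<lambda>t. 0"])
    (use assms in \<open>auto simp: degeneration_simps intro!: degeneration_intros\<close>)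

lemma A07_to_A04:
  "degenerates (strct_of A07) (strct_of A04)"
  by (rule degenerates_strct_ofI[where p = "\<lambda>t. 0" and q = "\<lambda>t. t^2" and r = "\<lambda>t. - t"
    and u = "\<lambda>t. 0"
      and a = "\<lambda>t. 0" and b = "\<lambda>t. 0" and c = "\<lambda>t. 0" and d = "\<lambda>t. 0"
      and a' = "\<lambda>t. vector [t, 1]" and b' = "\<lambda>t. vector [0, t]" and c' = "\<lambda>t. 0" and d' = "\<lambda>t. 0"])
    (auto simp: degeneration_simps intro!: degeneration_intros)

lemma A07_to_A06:
  "degenerates (strct_of A07) (strct_of (A06 (- 1)))"
  by (rule degenerates_strct_ofI[where p = "\<lambda>t. 1 / t" and q = "\<lambda>t. 0" and r = "\<lambda>t. 0"
    and u = "\<lambda>t. 1"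
      and a = "\<lambda>t. 0" and b = "\<lambda>t. 0" and c = "\<lambda>t. 0" and d = "\<lambda>t. 0"
      and a' = "\<lambda>t. 0" and b' = "\<lambda>t. 0" and c' = "\<lambda>t. vector [- 1, 0]"
        and d' = "\<lambda>t. vector [t, - 1]"])
    (auto simp: degeneration_simps intro!: degeneration_intros)

lemma A09_to_A04:
  "degenerates (strct_of A09) (strct_of A04)"
  by (rule degenerates_strct_ofI[where p = "\<lambda>t. 0" and q = "\<lambda>t. t^2" and r = "\<lambda>t. t" and u = "\<lambda>t. 0"
      and a = "\<lambda>t. 0" and b = "\<lambda>t. 0" and c = "\<lambda>t. 0" and d = "\<lambda>t. 0"
      and a' = "\<lambda>t. vector [- 3 * t, 1]" and b' = "\<lambda>t. vector [0, - 2 * t]"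
        and c' = "\<lambda>t. vector [0, - t]" and d' = "\<lambda>t. 0"])
    (auto simp: degeneration_simps intro!: degeneration_intros)

lemma A09_to_A08:
  "degenerates (strct_of A09) (strct_of (A08 (- 2)))"
  by (rule degenerates_strct_ofI[where p = "\<lambda>t. 1 / t" and q = "\<lambda>t. 0" and r = "\<lambda>t. 0"
    and u = "\<lambda>t. 1"
      and a = "\<lambda>t. 0" and b = "\<lambda>t. 0" and c = "\<lambda>t. 0" and d = "\<lambda>t. 0"
      and a' = "\<lambda>t. 0" and b' = "\<lambda>t. vector [- 1, 0]" and c' = "\<lambda>t. vector [- 2, 0]"
        and d' = "\<lambda>t. vector [t, - 3]"])
    (auto simp: degeneration_simps intro!: degeneration_intros)

text \<open>Scaling both basis vectors by \<open>t\<close> multiplies every structure constant by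
  \<open>t\<close>.\<close>

lemma degenerates_to_C8: "degenerates (strct_of T) (strct_of C8)"
proof -
  let ?v = "\<lambda>m i j t. t *s m (axis i 1) (axis j 1)"
  have tab: "m (t *s x) (t *s y) = t *s table (?v m 1 1 t) (?v m 1 2 t) (?v m 2 1 t) (?v m 2 2 t) x y"
    if "cbilinear m" for m :: "V \<Rightarrow> V \<Rightarrow> V" and t :: complex and x y
    by (subst cbilinear_eq_table[OF that]) (simp add: vec_eq_2 table_nth algebra_simps)
  have bil: "cbilinear (dot T)" "cbilinear (circ T)"
    using strct_of_Bil2[of T] by (simp_all add: Bil2_iff strct_of_def)
  have scal: "mat2 t 0 0 t *v x = t *s x" for t x
    by (simp add: vec_eq_2 matrix_vector_2)
  have cont: "isCont (\<lambda>t. t *s v) 0" for v :: V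
    unfolding isCont_def by (rule vec_tendstoI) (auto intro!: tendsto_eq_intros)
  show ?thesis
    by (rule degenerates_strct_ofI[where p = "\<lambda>t. t" and q = "\<lambda>t. 0" and r = "\<lambda>t. 0" and u = "\<lambda>t. t"
          and a = "?v (dot T) 1 1" and b = "?v (dot T) 1 2" and c = "?v (dot T) 2 1"
            and d = "?v (dot T) 2 2"
          and a' = "?v (circ T) 1 1" and b' = "?v (circ T) 1 2" and c' = "?v (circ T) 2 1"
            and d' = "?v (circ T) 2 2"])
      (simp_all add: scal tab[OF bil(1)] tab[OF bil(2)] cont)
qed

lemma A10_swap: "isomorphic (strct_of (A10 \<delta> \<epsilon>)) (strct_of (A10 \<epsilon> \<delta>))"
  unfolding isomorphic_def
  by (rule exI[of _ "mat2 0 1 1 0"])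
    (simp add: strct_of_def vec_eq_2 matrix_vector_2 table_nth)

lemma degenerates_strct_of_trans:
  "degenerates (strct_of T) (strct_of T') \<Longrightarrow> degenerates (strct_of T') (strct_of T'') \<Longrightarrow>
    degenerates (strct_of T) (strct_of T'')"
  using degenerates_trans strct_of_Bil2 by blast

lemma degeneration_step_degenerates:
  "degeneration_step T T' \<Longrightarrow> degenerates (strct_of T) (strct_of T')"
proof (induction rule: degeneration_step.induct)
  case (7 \<delta> \<epsilon>)
  show ?case
    using degenerates_strct_of_trans[OF isomorphic_degenerates[OF strct_of_Bil2 A10_swap]
        A10_to_A14] .
next
  case (9 \<delta> \<epsilon> \<alpha>)
  \<comment> \<open>Solving \<open>\<delta> = \<alpha> + y * (\<epsilon> - \<alpha>)\<close> gives
    \<open>y = 0\<close> for \<open>\<alpha> = \<delta>\<close> and no \<open>y\<close> for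
    \<open>\<alpha> = \<epsilon>\<close>; these two limits are obtained through
    \<open>A14\<close>.\<close>
  consider "\<alpha> = \<delta>" | "\<alpha> = \<epsilon>" | "\<alpha> \<noteq> \<delta>" "\<alpha> \<noteq> \<epsilon>" by blast
  then show ?case
  proof cases
    case 1
    then show ?thesis using degenerates_strct_of_trans[OF A10_to_A14 A14_to_A18] by blast
  next
    case 2
    have "degenerates (strct_of (A10 \<delta> \<epsilon>)) (strct_of (A14 \<epsilon>))"
      using degenerates_strct_of_trans[OF isomorphic_degenerates[OF strct_of_Bil2 A10_swap]
        A10_to_A14] .
    then show ?thesis using degenerates_strct_of_trans[OF _ A14_to_A18] 2 by blast
  next
    case 3
    define y where "y = (\<delta> - \<alpha>) / (\<epsilon> - \<alpha>)"
    have "y \<noteq> 0" "y \<noteq> 1" "\<alpha> + y * (\<epsilon> - \<alpha>) = \<delta>" using 3 9 by (auto simp: y_def)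
    then show ?thesis using A10_to_A18[of y \<alpha> \<epsilon>] by simp
  qed
next
  case (12 \<alpha> \<epsilon> \<delta>)
  then show ?case using A11_to_A18[of "1 / (\<alpha> - (2 * \<epsilon> - \<delta>))" \<delta> \<epsilon>] by simp
next
  case (15 \<alpha> \<delta>)
  then show ?case using A13_to_A18[of "\<delta> - \<alpha>" \<alpha>] by simp
next
  case (18 \<delta>)
  then show ?case using A15_to_A08[of "1 / (\<delta> - 1)"] by simp
next
  case (19 \<delta> \<alpha>)
  then have "2 * \<delta> - 1 \<noteq> 0" by (auto simp: field_simps)
  then show ?case using A15_to_A18[of \<delta> "\<alpha> / (2 * \<delta> - 1)"] by simp
next
  case (28 \<beta>)
  then have "\<beta> + 1 \<noteq> 0" by (simp add: add_eq_0_iff2)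
  then show ?case using A06_to_A04[of "\<beta> + 1"] by simp
next
  case (29 \<beta>)
  then have "\<beta> + 2 \<noteq> 0" by (simp add: add_eq_0_iff2)
  then show ?case using A08_to_A04[of "\<beta> + 2"] by simp
qed (use A01_to_A02 A01_to_A03 A05_to_A06 A05_to_A08 A10_to_A12 A10_to_A14 A10_to_A04 A11_to_A12
    A11_to_A04 A13_to_A14 A13_to_A03 A15_to_A06 A15_to_A02 A17_to_A08 A17_to_A18 A12_to_A18
    A14_to_A18 A16_to_A08 A16_to_A18 A02_to_A04 A03_to_A04 A07_to_A04
    A07_to_A06 A09_to_A04 A09_to_A08 degenerates_to_C8 in blast)+

lemma degeneration_steps_degenerates:
  assumes "degeneration_step\<^sup>+\<^sup>+ T T'"
  shows "degenerates (strct_of T) (strct_of T')"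
  using assms
  by induction (blast intro: degeneration_step_degenerates degenerates_strct_of_trans)+

section \<open>Covariant identities\<close>

text \<open>\<open>TrDot u v\<close>, \<open>TrL u v\<close>, \<open>TrR u v\<close> denote \<open>v\<close> multiplied by the trace of the left
  multiplication by \<open>u\<close> for the product \<open>dot\<close>, and by the traces of the left and right
  multiplication by \<open>u\<close> for the product \<open>circ\<close>.\<close>

datatype covariant = X | Y | Z
  | Dot covariant covariant | Circ covariant covariant
  | Plus covariant covariant | Scale complex covariant
  | TrDot covariant covariant | TrL covariant covariant | TrR covariant covariant

definition tr :: "(V \<Rightarrow> V) \<Rightarrow> complex" where
  "tr f = f e1 $ 1 + f e2 $ 2"

fun ev :: "strct \<Rightarrow> V \<Rightarrow> V \<Rightarrow> V \<Rightarrow> covariant \<Rightarrow> V" where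
  "ev s x y z X = x"
| "ev s x y z Y = y"
| "ev s x y z Z = z"
| "ev s x y z (Dot u v) = fst s (ev s x y z u) (ev s x y z v)"
| "ev s x y z (Circ u v) = snd s (ev s x y z u) (ev s x y z v)"
| "ev s x y z (Plus u v) = ev s x y z u + ev s x y z v"
| "ev s x y z (Scale c u) = c *s ev s x y z u"
| "ev s x y z (TrDot u v) = tr (\<lambda>w. fst s (ev s x y z u) w) *s ev s x y z v"
| "ev s x y z (TrL u v) = tr (\<lambda>w. snd s (ev s x y z u) w) *s ev s x y z v"
| "ev s x y z (TrR u v) = tr (\<lambda>w. snd s w (ev s x y z u)) *s ev s x y z v"

lemma poly_on_ev: "poly_on (\<lambda>s. ev s x y z t $ k)"
  by (induction t arbitrary: k)
    (auto simp: tr_def intro!: poly_on_const poly_on_add poly_on_mult poly_on_fst poly_on_snd)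

lemma tr_conj:
  assumes "Vector_Spaces.linear (*s) (*s) f" "invertible g"
  shows "tr (\<lambda>w. g *v f (matrix_inv g *v w)) = tr f"
proof -
  define M where "M = matrix f"
  have f: "f = (\<lambda>w. M *v w)" using assms(1) by (simp add: M_def matrix_works fun_eq_iff)
  have tr: "tr (\<lambda>w. A *v w) = trace A" for A :: "complex^2^2"
    by (simp add: tr_def trace_def sum_2 matrix_vector_2)
  have "tr (\<lambda>w. g *v f (matrix_inv g *v w)) = trace (g ** (M ** matrix_inv g))"
    by (simp add: f matrix_vector_mul_assoc tr)
  also have "\<dots> = trace (M ** matrix_inv g ** g)" by (rule trace_mul_sym)
  also have "\<dots> = tr f"
    using matrix_inv(2)[OF assms(2)] f by (simp add: matrix_mul_assoc[symmetric] tr)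
  finally show ?thesis .
qed

lemma ev_act:
  assumes "s \<in> Bil2" "invertible g"
  shows "ev (act g s) (g *v x) (g *v y) (g *v z) t = g *v ev s x y z t"
proof -
  have lin: "Vector_Spaces.linear (*s) (*s) (fst s u)" "Vector_Spaces.linear (*s) (*s) (snd s u)"
    "Vector_Spaces.linear (*s) (*s) (\<lambda>w. snd s w u)" for u
    using assms(1) by (simp_all add: Bil2_iff cbilinear_def)
  show ?thesis
    using assms(2) tr_conj[OF lin(1)] tr_conj[OF lin(2)] tr_conj[OF lin(3)]
    by (induction t) (simp_all add: act_def matrix_vector_right_distrib vector_scalar_commute)
qed

definition satisfies :: "algebra \<Rightarrow> covariant \<Rightarrow> bool" where
  "satisfies T t \<longleftrightarrow> (\<forall>x y z. ev (strct_of T) x y z t = 0)"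

text \<open>An identity is required for all \<open>x\<close>, \<open>y\<close>, \<open>z\<close>, so
  it can be moved along the orbit by transporting the arguments with the inverse matrix. For fixed
  arguments each coordinate is a polynomial in the structure, which passes to the closure.\<close>

lemma satisfies_degenerates:
  assumes "degenerates (strct_of T) (strct_of T')" "satisfies T t"
  shows "satisfies T' t"
  unfolding satisfies_def
proof (intro allI)
  fix x y z
  note bil = strct_of_Bil2
  have orb: "ev u x y z t = 0" if u: "u \<in> orbit (strct_of T)" for u
  proof -
    obtain g where g: "invertible g" "u = act g (strct_of T)" using u by (auto simp: orbit_def)
    have "ev u x y z t =
        g *v ev (strct_of T) (matrix_inv g *v x) (matrix_inv g *v y) (matrix_inv g *v z) t"
      using ev_act[OF bil[of T] g(1), of "matrix_inv g *v x" "matrix_inv g *v y" "matrix_inv g *v z"] g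
      by simp
    then show ?thesis using assms(2) by (simp add: satisfies_def)
  qed
  have "ev (strct_of T') x y z t $ k = 0" for k
  proof -
    obtain f where f: "f \<in> poly_funs" "\<forall>s \<in> Bil2. f s = ev s x y z t $ k"
      using poly_on_ev unfolding poly_on_def by blast
    have "\<forall>u \<in> orbit (strct_of T). f u = 0"
      using orb f(2) orbit_Bil2[OF bil] by (auto simp: subset_iff)
    then have "f (strct_of T') = 0"
      using f(1) assms(1) degenerates_iff[OF bil] in_closure_iff[OF orbit_Bil2[OF bil]] by blast
    then show ?thesis using f(2) bil by simp
  qed
  then show "ev (strct_of T') x y z t = 0" by (simp add: vec_eq_iff)
qed

abbreviation Minus :: "covariant \<Rightarrow> covariant \<Rightarrow> covariant" where
  "Minus u v \<equiv> Plus u (Scale (- 1) v)"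

text \<open>Apart from A01, A05, A10 and A13, every product \<open>x \<circ> y\<close> of the list has the form
  \<open>a \<eta>(x) y + b \<eta>(y) x + \<eta>(x) \<eta>(y) v\<close> with a linear form \<open>\<eta>\<close> and a vector \<open>v\<close>. The traces
  of the multiplications by \<open>x\<close> are then multiples of \<open>\<eta>(x)\<close>; their difference, used in \<open>Eta\<close>,
  is \<open>(a - b) \<eta>(x)\<close>. For A10 and A13 the combinations \<open>Part\<close> isolate the two idempotents.\<close>

abbreviation Eta :: "covariant \<Rightarrow> covariant \<Rightarrow> covariant" where
  "Eta u v \<equiv> Minus (TrL u v) (TrR u v)"

abbreviation Part :: "complex \<Rightarrow> covariant \<Rightarrow> covariant \<Rightarrow> covariant" where
  "Part c u v \<equiv> Minus (Circ u v) (Scale c (Dot u v))"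

abbreviation TrPart :: "complex \<Rightarrow> covariant \<Rightarrow> covariant \<Rightarrow> covariant" where
  "TrPart c u v \<equiv> Minus (TrL u v) (Scale c (TrDot u v))"

text \<open>Parameters appear as ratios of traces and in the value of the linear form on products.
  For \<open>A06 l\<close> and \<open>A08 l\<close>, \<open>Eta X\<close> is multiplication by
  \<open>- x$2\<close>, and the right trace of \<open>x\<close> is \<open>l * x$2\<close> and
  \<open>2 * l * x$2\<close>, respectively. At \<open>l = - 1\<close> and \<open>l = - 2\<close> the
  form expresses the whole product, which also excludes \<open>A04\<close>. \<open>A11\<close> and
  \<open>A12\<close> share three identities; the fourth one of \<open>A12\<close> expresses
  \<open>circ\<close> through \<open>dot\<close> and its trace.\<close>

fun identities :: "algebra \<Rightarrow> covariant list" where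
  "identities A01 = [Dot X Y, Minus (Circ X Y) (Circ Y X)]"
| "identities A02 = [Dot X Y, Minus (Circ X Y) (Circ Y X),
     Minus (Scale 2 (TrL (Circ X Y) Z)) (TrL X (TrL Y Z))]"
| "identities A03 = [Dot X Y, Minus (Circ X Y) (Circ Y X),
     Minus (Circ (Circ X Y) Z) (TrL Z (Circ X Y))]"
| "identities A04 = [Dot X Y, Circ X (Circ Y Z)]"
| "identities A05 = [Dot X Y, TrR X Y]"
| "identities (A06 l) =
     (if l = -1 then [Dot X Y, Minus (Circ X Y) (Eta X Y)]
      else [Dot X Y, Plus (TrR X Y) (Scale l (Eta X Y)),
        Plus (Eta (Circ X Y) Z) (Scale l (Eta X (Eta Y Z)))])"
| "identities A07 = [Dot X Y, Minus (TrR X Y) (Eta X Y), Minus (Eta (Circ X Y) Z) (Eta X (Eta Y Z))]"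
| "identities (A08 l) =
     (if l = -2 then [Dot X Y, Minus (Circ X Y) (Plus (Scale 2 (Eta X Y)) (Eta Y X))]
      else [Dot X Y, Plus (TrR X Y) (Scale (2 * l) (Eta X Y)),
        Minus (Eta (Circ X Y) Z) (Scale (1 - l) (Eta X (Eta Y Z)))])"
| "identities A09 = [Dot X Y, Minus (TrR X Y) (Scale 4 (Eta X Y)),
     Minus (Eta (Circ X Y) Z) (Scale 3 (Eta X (Eta Y Z)))]"
| "identities (A10 d e) =
     (if d = e then [Part d X Y]
      else [Minus (Circ X Y) (Circ Y X), Part d X (Part e Y Z),
        Minus (Part d (Part d X Y) Z) (TrPart d Z (Part d X Y)),
        Minus (Part e (Part e X Y) Z) (TrPart e Z (Part e X Y))])"
| "identities (A11 d e) = [Minus (Scale 2 (TrL X Y)) (Scale (3 * d - e) (TrDot X Y)),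
     Minus (TrR X Y) (Scale d (TrDot X Y)), Minus (Scale 2 (TrDot (Dot X Y) Z)) (TrDot X (TrDot Y Z))]"
| "identities (A12 d e) = [Minus (Scale 2 (TrL X Y)) (Scale (3 * d - e) (TrDot X Y)),
     Minus (TrR X Y) (Scale d (TrDot X Y)), Minus (Scale 2 (TrDot (Dot X Y) Z)) (TrDot X (TrDot Y Z)),
     Minus (Plus (Circ X Y) (Scale (d - 2 * e) (Dot X Y)))
       (Plus (Scale (d - e) (TrDot X Y)) (Scale ((d - e) / 2) (TrDot Y X)))]"
| "identities (A13 d) = [Minus (Circ X Y) (Circ Y X), Minus (Dot (Dot X Y) Z) (TrDot Z (Dot X Y)),
     Minus (Part d (Part d X Y) Z) (TrPart d Z (Part d X Y)), Dot X (Part d Y Z)]"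
| "identities (A14 b) = [Part b X Y, Minus (Dot (Dot X Y) Z) (TrDot Z (Dot X Y))]"
| "identities (A15 d) = [TrDot X Y, Minus (Scale 2 (TrL X Y)) (Scale (3 - d) (TrR X Y)),
     Minus (Scale 2 (TrR (Circ X Y) Z)) (Scale (2 - d) (TrR X (TrR Y Z)))]"
| "identities (A16 b) = [TrDot X Y,
     Minus (Scale 4 (Part b X Y)) (Plus (Scale 2 (TrR X Y)) (TrR Y X))]"
| "identities A17 = [TrDot X Y, TrR X Y, Minus (TrL (Circ X Y) Z) (TrL X (TrL Y Z))]"
| "identities (A18 a) = [Part a X Y, Dot X (Dot Y Z)]"
| "identities C8 = [Dot X Y, Circ X Y]"

lemma satisfies_identities: "t \<in> set (identities T) \<Longrightarrow> satisfies T t"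
  by (cases T)
    (auto simp: satisfies_def strct_of_def vec_eq_2 table_nth tr_def field_simps split: if_splits)

text \<open>A finite, computable consequence of degeneration: the identities of \<open>T\<close> at
  six triples of basis vectors of \<open>T'\<close>. They already leave only the candidates in the
  lemmas below.\<close>

definition fits :: "algebra \<Rightarrow> algebra \<Rightarrow> bool" where
  "fits T T' \<longleftrightarrow> list_all (\<lambda>t.
     ev (dot T', circ T') e1 e1 e1 t = 0 \<and> ev (dot T', circ T') e1 e1 e2 t = 0 \<and>
     ev (dot T', circ T') e1 e2 e1 t = 0 \<and> ev (dot T', circ T') e2 e1 e1 t = 0 \<and>
     ev (dot T', circ T') e2 e2 e1 t = 0 \<and> ev (dot T', circ T') e2 e2 e2 t = 0) (identities T)"

lemma degenerates_fits:
  assumes "degenerates (strct_of T) (strct_of T')"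
  shows "fits T T'"
proof -
  have "ev (dot T', circ T') x y z t = 0" if "t \<in> set (identities T)" for x y z t
    using satisfies_degenerates[OF assms satisfies_identities[OF that]]
    by (simp add: satisfies_def strct_of_def)
  then show ?thesis by (simp add: fits_def list_all_iff)
qed

lemmas fits_unfold = fits_def identities.simps list.pred_inject simp_thms if_False if_True
  ev.simps fst_conv snd_conv dot.simps circ.simps

lemma vector_2_eval:
  "e1 = vector [1, 0]" "e2 = vector [0, 1]" "(0 :: V) = vector [0, 0]"
  "vector [a, b] + vector [c, d] = (vector [a + c, b + d] :: V)"
  "vector [a, b] - vector [c, d] = (vector [a - c, b - d] :: V)"
  "- vector [a, b] = (vector [- a, - b] :: V)"
  "k *s vector [a, b] = (vector [k * a, k * b] :: V)"
  "vector [a, b] = (vector [c, d] :: V) \<longleftrightarrow> a = c \<and> b = d"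
  by (simp_all add: vec_eq_2)

lemma table_eval:
  "table (vector [a, a']) (vector [b, b']) (vector [c, c']) (vector [d, d'])
    (vector [x, x']) (vector [y, y']) =
    vector [x * y * a + x * y' * b + x' * y * c + x' * y' * d,
      x * y * a' + x * y' * b' + x' * y * c' + x' * y' * d']"
  by (simp add: vec_eq_2 table_nth)

text \<open>A conjunction of two equations \<open>l = m\<close> and \<open>m = l\<close> as a premise makes the simplifier loop;
  hence \<open>no_asm_use\<close> and \<open>conjE\<close> in the proofs below.\<close>

lemmas fits_simps = vector_2_eval table_eval tr_def listed_def

section \<open>Candidates left by the identities\<close>

text \<open>For each constructor of \<open>T'\<close> the identities become equations between
  complex parameters, which are contradictory or confine the parameters to the stated values. The
  same scheme serves the lemmas that follow.\<close>

lemma fits_A01: "fits A01 T' \<Longrightarrow> T' \<in> {A01, A02, A03, A04, C8}"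
  by (cases T'; hypsubst; simp only: fits_unfold; (simp (no_asm_use) add: fits_simps)?;
      (elim conjE)?; auto simp: algebra_simps add_eq_0_iff2)

lemma fits_A02: "fits A02 T' \<Longrightarrow> T' \<in> {A02, A04, C8}"
  by (cases T'; hypsubst; simp only: fits_unfold; (simp (no_asm_use) add: fits_simps)?;
      (elim conjE)?; auto simp: algebra_simps add_eq_0_iff2)

lemma fits_A03: "fits A03 T' \<Longrightarrow> T' \<in> {A03, A04, C8}"
  by (cases T'; hypsubst; simp only: fits_unfold; (simp (no_asm_use) add: fits_simps)?;
      (elim conjE)?; auto simp: algebra_simps add_eq_0_iff2)

lemma fits_A04: "fits A04 T' \<Longrightarrow> T' \<in> {A04, C8}"
  by (cases T'; hypsubst; simp only: fits_unfold; (simp (no_asm_use) add: fits_simps)?;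
      (elim conjE)?; auto simp: algebra_simps add_eq_0_iff2)

lemma fits_A05: "fits A05 T' \<Longrightarrow> T' \<in> {A04, A05, A06 0, A08 0, C8}"
  by (cases T'; hypsubst; simp only: fits_unfold; (simp (no_asm_use) add: fits_simps)?;
      (elim conjE)?; auto simp: algebra_simps add_eq_0_iff2)

text \<open>\<open>listed\<close> removes duplicates, which the identities could not tell apart:
  \<open>A08 (- 1)\<close> has the tables of \<open>A06 (- 2)\<close>, and \<open>A15 (1/2)\<close>
  those of \<open>A16 0\<close>.\<close>

lemma fits_A06: "fits (A06 l) T' \<Longrightarrow> T' \<in> listed \<Longrightarrow> l \<noteq> -1 \<Longrightarrow> T' \<in> {A04, A06 l, C8}"
  by (cases T'; hypsubst; simp only: fits_unfold; (simp (no_asm_use) add: fits_simps)?;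
      (elim conjE)?; auto simp: algebra_simps add_eq_0_iff2)

lemma fits_A06': "fits (A06 (-1)) T' \<Longrightarrow> T' \<in> listed \<Longrightarrow> T' \<in> {A06 (-1), C8}"
  by (cases T'; hypsubst; simp only: fits_unfold; (simp (no_asm_use) add: fits_simps)?;
      (elim conjE)?; auto simp: algebra_simps add_eq_0_iff2)

lemma fits_A07: "fits A07 T' \<Longrightarrow> T' \<in> listed \<Longrightarrow> T' \<in> {A04, A06 (-1), A07, C8}"
  by (cases T'; hypsubst; simp only: fits_unfold; (simp (no_asm_use) add: fits_simps)?;
      (elim conjE)?; auto simp: algebra_simps add_eq_0_iff2)

lemma fits_A08: "fits (A08 l) T' \<Longrightarrow> T' \<in> listed \<Longrightarrow> l \<noteq> -2 \<Longrightarrow> l \<noteq> -1 \<Longrightarrow> T' \<in> {A04, A08 l, C8}"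
  by (cases T'; hypsubst; simp only: fits_unfold; (simp (no_asm_use) add: fits_simps)?;
      (elim conjE)?; auto simp: algebra_simps add_eq_0_iff2)

lemma fits_A08': "fits (A08 (-2)) T' \<Longrightarrow> T' \<in> listed \<Longrightarrow> T' \<in> {A08 (-2), C8}"
  by (cases T'; hypsubst; simp only: fits_unfold; (simp (no_asm_use) add: fits_simps)?;
      (elim conjE)?; auto simp: algebra_simps add_eq_0_iff2)

lemma fits_A09: "fits A09 T' \<Longrightarrow> T' \<in> listed \<Longrightarrow> T' \<in> {A04, A08 (-2), A09, C8}"
  by (cases T'; hypsubst; simp only: fits_unfold; (simp (no_asm_use) add: fits_simps)?;
      (elim conjE)?; auto simp: algebra_simps add_eq_0_iff2)

lemma fits_A10: "fits (A10 d d) T' \<Longrightarrow> T' \<in> {A10 d d, A12 d d, A14 d, A18 d, C8}"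
  by (cases T'; hypsubst; simp only: fits_unfold; (simp (no_asm_use) add: fits_simps)?;
      (elim conjE)?; auto simp: algebra_simps add_eq_0_iff2)

lemma fits_A10':
  assumes "fits (A10 d e) T'" "d \<noteq> e"
  shows "T' \<in> {A10 d e, A10 e d, A14 d, A14 e, A04, C8} \<union> range A18"
proof -
  have "(d = e) = False" using assms(2) by simp
  with assms(1) show ?thesis
    by (cases T'; hypsubst; simp only: fits_unfold; (simp (no_asm_use) add: fits_simps)?;
      (elim conjE)?; auto simp: algebra_simps add_eq_0_iff2)
qed

lemma fits_A11: "fits (A11 d e) T' \<Longrightarrow> T' \<in> {A11 d e, A12 d e, A04, C8} \<union> range A18"
  by (cases T'; hypsubst; simp only: fits_unfold; (simp (no_asm_use) add: fits_simps)?;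
      (elim conjE)?; auto simp: algebra_simps add_eq_0_iff2)

lemma fits_A12: "fits (A12 d e) T' \<Longrightarrow> T' \<in> {A12 d e, A18 (2 * e - d), C8}"
  by (cases T'; hypsubst; simp only: fits_unfold; (simp (no_asm_use) add: fits_simps)?;
      (elim conjE)?; auto simp: algebra_simps add_eq_0_iff2)

lemma fits_A13: "fits (A13 d) T' \<Longrightarrow> T' \<in> {A13 d, A14 d, A03, A04, C8} \<union> range A18"
  by (cases T'; hypsubst; simp only: fits_unfold; (simp (no_asm_use) add: fits_simps)?;
      (elim conjE)?; auto simp: algebra_simps add_eq_0_iff2)

lemma fits_A14: "fits (A14 d) T' \<Longrightarrow> T' \<in> {A14 d, A18 d, C8}"
  by (cases T'; hypsubst; simp only: fits_unfold; (simp (no_asm_use) add: fits_simps)?;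
      (elim conjE)?; auto simp: algebra_simps add_eq_0_iff2)

lemma fits_A15:
  assumes "fits (A15 d) T'" "d \<noteq> 1/2" "T' \<in> listed"
  shows "T' \<in> {A15 d, A04, C8} \<union> range A18 \<or> d = 0 \<and> T' = A06 (-2) \<or>
    d = 1 \<and> T' = A02 \<or> d \<noteq> 0 \<and> d \<noteq> 1 \<and> T' = A08 (1 / (d - 1))"
proof (cases T')
  case (A08 l)
  \<comment> \<open>The equation is the second identity of \<open>A15 d\<close> at
    \<open>e2\<close>, whose left trace is \<open>2 * l - 1\<close> and right trace
    \<open>2 * l\<close>.\<close>
  have "4 * l - 2 = (3 - d) * (2 * l)" "l \<noteq> - 1"
    using assms(1,3) unfolding A08 by (simp_all only: fits_unfold) (simp_all add: fits_simps)
  then have "2 * ((d - 1) * l) = 2 * 1" by (simp add: algebra_simps)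
  then have l: "(d - 1) * l = 1" by (simp only: mult_cancel_left) simp
  then have "d \<noteq> 1" "d \<noteq> 0" using \<open>l \<noteq> - 1\<close> by (auto simp: minus_equation_iff)
  then show ?thesis using l A08 by (simp add: field_simps)
qed (use assms in \<open>hypsubst; simp only: fits_unfold; (simp (no_asm_use) add: fits_simps)?;
      (elim conjE)?; auto simp: algebra_simps add_eq_0_iff2\<close>)+

lemma fits_A16:
  assumes "fits (A16 b) T'" "T' \<in> listed"
  shows "T' \<in> {A16 b, A08 (-2), A18 b, C8}"
proof (cases T')
  case (A08 l)
  \<comment> \<open>The second identity of \<open>A16 b\<close> at \<open>e1\<close>,
    \<open>e2\<close>: the right trace of \<open>e1\<close> is 0 and that of \<open>e2\<close> is
    \<open>2 * l\<close>.\<close>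
  have "4 * (l + 1) = 2 * l"
    using assms unfolding A08
    by (simp only: fits_unfold) (simp (no_asm_use) add: fits_simps, auto simp: algebra_simps)
  then have "2 * (l + 2) = 0" by (simp add: algebra_simps)
  then have "l = - 2" by (simp add: add_eq_0_iff2)
  then show ?thesis using A08 by simp
qed (use assms in \<open>hypsubst; simp only: fits_unfold; (simp (no_asm_use) add: fits_simps)?;
      (elim conjE)?; auto simp: algebra_simps add_eq_0_iff2\<close>)+

lemma fits_A17: "fits A17 T' \<Longrightarrow> T' \<in> listed \<Longrightarrow> T' \<in> {A17, A08 0, A04, C8} \<union> range A18"
  by (cases T'; hypsubst; simp only: fits_unfold; (simp (no_asm_use) add: fits_simps)?;
      (elim conjE)?; auto simp: algebra_simps add_eq_0_iff2)

lemma fits_A18: "fits (A18 a) T' \<Longrightarrow> T' \<in> {A18 a, C8}"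
  by (cases T'; hypsubst; simp only: fits_unfold; (simp (no_asm_use) add: fits_simps)?;
      (elim conjE)?; auto simp: algebra_simps add_eq_0_iff2)

lemma fits_C8: "fits C8 T' \<Longrightarrow> T' = C8"
  by (cases T'; hypsubst; simp only: fits_unfold; (simp (no_asm_use) add: fits_simps)?;
      (elim conjE)?; auto simp: algebra_simps add_eq_0_iff2)


section \<open>The degeneration order\<close>

abbreviation reaches :: "algebra \<Rightarrow> algebra \<Rightarrow> bool" where
  "reaches \<equiv> degeneration_step\<^sup>*\<^sup>*"

text \<open>Steps to \<open>C8\<close> start only at \<open>A04\<close>, \<open>A06 (- 1)\<close>,
  \<open>A08 (- 2)\<close> and \<open>A18\<close>; all other algebras get there through
  \<open>A04\<close> or \<open>A18\<close>.\<close>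

lemma reaches_C8:
  assumes "T \<in> listed"
  shows "reaches T C8"
proof -
  note step = degeneration_step.intros
  note first = converse_rtranclp_into_rtranclp[of degeneration_step]
  have C8: "reaches A04 C8" "\<And>\<alpha>. reaches (A18 \<alpha>) C8"
      "reaches (A06 (- 1)) C8" "reaches (A08 (- 2)) C8"
    by (auto intro: step)
  note A04 = first[OF _ C8(1)]
  note A18 = first[OF _ C8(2)]
  show ?thesis
  proof (cases T)
    case A01
    then show ?thesis using first[OF step(1) A04[OF step(26)]] by simp
  next
    case A05
    then show ?thesis using first[OF step(3) A04[OF step(28)]] by simp
  next
    case (A06 l)
    then show ?thesis using C8 A04[OF step(28), of l] by (cases "l = -1") auto
  next
    case (A08 l)
    then show ?thesis
      using C8 A04[OF step(29), of l] assms by (cases "l = -2") (auto simp: listed_def)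
  next
    case (A10 d e)
    then show ?thesis using first[OF step(6) A18[OF step(23)]] by simp
  next
    case (A13 d)
    then show ?thesis using A18[OF step(15), of "d + 1" d] by simp
  next
    case (A15 d)
    then show ?thesis using A18[OF step(19)] assms by (auto simp: listed_def)
  qed (use C8 A04[OF step(26)] A04[OF step(27)] A04[OF step(30)] A04[OF step(32)]
      A04[OF step(11)] A18[OF step(22)] A18[OF step(23)] A18[OF step(25)] A18[OF step(21)]
      in simp_all)
qed

text \<open>The combinatorial half of the classification: every candidate left by the identities
  lies on a chain of steps. Isomorphism as a separate alternative accounts for \<open>A10\<close>
  with its two parameters exchanged.\<close>

lemma fits_reaches:
  assumes "fits T T'" "T \<in> listed" "T' \<in> listed"
  shows "reaches T T' \<or> isomorphic (strct_of T) (strct_of T')"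
proof (cases "T' = T \<or> T' = C8 \<or> degeneration_step T T'")
  case True
  then show ?thesis using reaches_C8[OF assms(2)] by auto
next
  case False
  note two = converse_rtranclp_into_rtranclp
    [of degeneration_step, OF _ r_into_rtranclp[of degeneration_step]]
  note step = degeneration_step.intros
  show ?thesis
  proof (cases T)
    case A01
    then show ?thesis using fits_A01 assms False two[OF step(1) step(26)] step(1,2) by auto
  next
    case A02
    then show ?thesis using fits_A02 assms False step(26) by auto
  next
    case A03
    then show ?thesis using fits_A03 assms False step(27) by auto
  next
    case A04
    then show ?thesis using fits_A04 assms False by auto
  next
    case A05
    then show ?thesis using fits_A05 assms False two[OF step(3) step(28)] step(3,4) by auto
  next
    case (A06 l)
    then show ?thesis using fits_A06 fits_A06' assms False step(28) by (cases "l = - 1") auto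
  next
    case A07
    then show ?thesis using fits_A07 assms False step(30,31) by auto
  next
    case (A08 l)
    then have "l \<noteq> - 1" using assms(2) by (simp add: listed_def)
    with A08 show ?thesis
      using fits_A08 fits_A08' assms False step(29) by (cases "l = - 2") auto
  next
    case A09
    then show ?thesis using fits_A09 assms False step(32,33) by auto
  next
    case (A10 d e)
    show ?thesis
    proof (cases "d = e")
      case True
      then show ?thesis
        using A10 fits_A10[of d T'] assms(1) False two[OF step(6) step(23), of d d] step(5,6) by auto
    next
      case d: False
      then show ?thesis
        using A10 fits_A10'[of d e T'] assms(1) False step(6-9) A10_swap by auto
    qed
  next
    case (A11 d e)
    \<comment> \<open>The value \<open>2 * e - d\<close> excluded from the direct step is supplied
      by the detour through \<open>A12 d e\<close>.\<close>
    have "reaches (A11 d e) (A18 \<alpha>)" for \<alpha>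
      using two[OF step(10) step(22), of d e] step(12)[of \<alpha> e d] by (cases "\<alpha> = 2 * e - d") auto
    then show ?thesis using A11 fits_A11[of d e T'] assms(1) False step(10,11) by auto
  next
    case (A12 d e)
    then show ?thesis using fits_A12[of d e T'] assms(1) False step(22) by auto
  next
    case (A13 d)
    \<comment> \<open>For \<open>\<alpha> = d\<close> the chain passes through
      \<open>A14 d\<close>.\<close>
    have "reaches (A13 d) (A18 \<alpha>)" for \<alpha>
      using two[OF step(13) step(23), of d] step(15)[of \<alpha> d] by (cases "\<alpha> = d") auto
    then show ?thesis
      using A13 fits_A13[of d T'] assms(1) False step(13,14) two[OF step(14) step(27), of d] by auto
  next
    case (A14 b)
    then show ?thesis using fits_A14[of b T'] assms(1) False step(23) by auto
  next
    case (A15 d)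
    have d: "d \<noteq> 1/2" using assms(2) A15 by (simp add: listed_def)
    have "reaches (A15 d) A04"
    proof -
      consider "d = 0" | "d = 1" | "d \<noteq> 0" "d \<noteq> 1" by blast
      then show ?thesis
      proof cases
        case 1
        then show ?thesis using two[OF step(16) step(28)] by simp
      next
        case 2
        then show ?thesis using two[OF step(17) step(26)] by simp
      next
        case 3
        \<comment> \<open>The two values would mean \<open>d = 0\<close> and
          \<open>d = 1/2\<close>.\<close>
        have "1 / (d - 1) \<noteq> - 1" "1 / (d - 1) \<noteq> - 2"
          using 3 d by (auto simp: field_simps)
        then show ?thesis using two[OF step(18) step(29)] 3 d by blast
      qed
    qed
    then show ?thesis using A15 d fits_A15[of d T'] assms False step(16-19) by auto
  next
    case (A16 b)
    then show ?thesis using fits_A16[of b T'] assms False step(24,25) by auto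
  next
    case A17
    have "reaches A17 A04" using two[OF step(20) step(29)] by simp
    then show ?thesis using A17 fits_A17[of T'] assms False step(20,21) by auto
  next
    case (A18 a)
    then show ?thesis using fits_A18[of a T'] assms(1) False by auto
  next
    case C8
    then show ?thesis using fits_C8[of T'] assms(1) False by auto
  qed
qed

theorem degenerates_iff_reaches:
  assumes "T \<in> listed" "T' \<in> listed"
  shows "degenerates (strct_of T) (strct_of T') \<longleftrightarrow>
    isomorphic (strct_of T) (strct_of T') \<or> degeneration_step\<^sup>+\<^sup>+ T T'"
proof
  assume "degenerates (strct_of T) (strct_of T')"
  then have "reaches T T' \<or> isomorphic (strct_of T) (strct_of T')"
    using fits_reaches degenerates_fits assms by blast
  \<comment> \<open>The empty chain, allowed in \<open>reaches\<close>, is accounted for by the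
    isomorphism of \<open>T\<close> with itself.\<close>
  moreover have "isomorphic (strct_of T) (strct_of T)" by (simp add: isomorphic_iff orbit_refl)
  ultimately show "isomorphic (strct_of T) (strct_of T') \<or> degeneration_step\<^sup>+\<^sup>+ T T'"
    using rtranclpD by metis
next
  assume "isomorphic (strct_of T) (strct_of T') \<or> degeneration_step\<^sup>+\<^sup>+ T T'"
  then show "degenerates (strct_of T) (strct_of T')"
    using isomorphic_degenerates strct_of_Bil2 degeneration_steps_degenerates by blast
qed

theorem lemma58:
  shows "(orbit_dim (strct_of A01) = 4 \<and>
      orbit_dim (strct_of A05) = 4 \<and>
      (\<forall>\<delta> \<epsilon>. orbit_dim (strct_of (A10 \<delta> \<epsilon>)) = 4) \<and>
      (\<forall>\<delta> \<epsilon>. orbit_dim (strct_of (A11 \<delta> \<epsilon>)) = 4) \<and>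
      (\<forall>\<delta>. orbit_dim (strct_of (A13 \<delta>)) = 4) \<and>
      (\<forall>\<delta>. \<delta> \<noteq> 1/2 \<longrightarrow> orbit_dim (strct_of (A15 \<delta>)) = 4) \<and>
      orbit_dim (strct_of A17) = 4 \<and>

      orbit_dim (strct_of A02) = 3 \<and>
      orbit_dim (strct_of A03) = 3 \<and>
      (\<forall>\<beta>. \<beta> \<noteq> -1 \<longrightarrow> orbit_dim (strct_of (A06 \<beta>)) = 3) \<and>
      orbit_dim (strct_of A07) = 3 \<and>
      (\<forall>\<beta>. \<beta> \<noteq> -1 \<longrightarrow> \<beta> \<noteq> -2 \<longrightarrow> orbit_dim (strct_of (A08 \<beta>)) = 3) \<and>
      orbit_dim (strct_of A09) = 3 \<and>
      (\<forall>\<beta> \<gamma>. orbit_dim (strct_of (A12 \<beta> \<gamma>)) = 3) \<and>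
      (\<forall>\<beta>. orbit_dim (strct_of (A14 \<beta>)) = 3) \<and>
      (\<forall>\<beta>. orbit_dim (strct_of (A16 \<beta>)) = 3) \<and>

      orbit_dim (strct_of A04) = 2 \<and>
      orbit_dim (strct_of (A06 (- 1))) = 2 \<and>
      orbit_dim (strct_of (A08 (- 2))) = 2 \<and>
      (\<forall>\<alpha>. orbit_dim (strct_of (A18 \<alpha>)) = 2) \<and>

      orbit_dim (strct_of C8) = 0) \<and>
    (\<forall>T \<in> listed. \<forall>T' \<in> listed.
      degenerates (strct_of T) (strct_of T') \<longleftrightarrow>
        isomorphic (strct_of T) (strct_of T') \<or> degeneration_step\<^sup>+\<^sup>+ T T')"
  (is "?dims \<and> ?degs")
proof
  show ?dims
    using orbit_dim_A01 orbit_dim_A02 orbit_dim_A03 orbit_dim_A04 orbit_dim_A05 orbit_dim_A06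
      orbit_dim_A06_minus_1 orbit_dim_A07 orbit_dim_A08 orbit_dim_A08_minus_2 orbit_dim_A09
      orbit_dim_A10 orbit_dim_A11 orbit_dim_A12 orbit_dim_A13 orbit_dim_A14 orbit_dim_A15
      orbit_dim_A16 orbit_dim_A17 orbit_dim_A18 orbit_dim_C8
    by simp
  show ?degs using degenerates_iff_reaches by blast
qed

end
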